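(* Let $\boldsymbol\lambda=(\lambda_1,\dots,\lambda_K)\ge 0$ and $\boldsymbol{\mathbb P}=(\mathbb P_0,\dots,\mathbb P_K)\in\mathbb M^{K+1}$, let $\rho_{\boldsymbol\lambda}$ be the (unique) solution of the integral equation $$\rho_{\boldsymbol\lambda}(\boldsymbol z,\theta)=\min\Big\{g_{\boldsymbol\lambda}(\boldsymbol z),\; z_0+\int\rho_{\boldsymbol\lambda}\big(\boldsymbol z\boldsymbol p_\theta(x),\xi_\theta(x)\big)\,\mu(\mathrm dx)\Big\},$$ and let $\Pi^*_{\boldsymbol\lambda}(\boldsymbol{\mathbb P})$ be the set of optimal time-homogeneous policies for the weighted sum cost $L_{\boldsymbol\lambda}(\cdot,\boldsymbol{\mathbb P})$. Then: 1. for all $\pi\in\Pi^*_{\boldsymbol\lambda}(\boldsymbol{\mathbb P})$ and all $k=1,\dots,K$, $$\gamma_{\pi,\mathbb P_0}\in\partial_{z_0}\rho_{\boldsymbol\lambda},\qquad \lambda_k\alpha^{(k)}_{\pi,\mathbb P_k}\in\partial_{z_k}\rho_{\boldsymbol\lambda};$$ 2. for all $(\boldsymbol z,\theta)\in\Omega_\rho$ and all $k=1,\dots,K$, $$\big\{\gamma_{\pi,\mathbb P_0}(\boldsymbol z,\theta):\pi\in\Pi^*_{\boldsymbol\lambda}(\boldsymbol{\mathbb P})\big\}=\partial_{z_0}\rho_{\boldsymbol\lambda}(\boldsymbol z,\theta),$$ $$\big\{\lambda_k\alpha^{(k)}_{\pi,\mathbb P_k}(\boldsymbol z,\theta):\pi\in\Pi^*_{\boldsymbol\lambda}(\boldsymbol{\mathbb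 P})\big\}=\partial_{z_k}\rho_{\boldsymbol\lambda}(\boldsymbol z,\theta).$$
   Context: Process. Let $(X_n)_{n\ge1}$ be a discrete-time process with values in a measurable space $(\Omega_X,\mathcal F_X)$, with natural filtration $(\mathcal F^n_X)_{n\ge1}$; let $(\Omega_\Theta,\mathcal F_\Theta)$ be a measurable space and $\mu$ a $\sigma$-finite reference measure on $(\Omega_X,\mathcal F_X)$. $\mathbb M$ is the set of joint distributions $\mathbb P$ of $(X_n)_{n\ge1}$ such that: (1) there is an adapted $\Omega_\Theta$-valued process $(\Theta_n)_{n\ge0}$, with $\Theta_0=\theta_0$ deterministic and known, such that $\mathbb P(X_{n+1}\in\mathcal E\mid X_1,\dots,X_n)=\mathbb P(X_{n+1}\in\mathcal E\mid\Theta_n)=:P_{\Theta_n}(\mathcal E)$ for all $n\ge1$, $\mathcal E\in\mathcal F_X$, and $X_1\sim P_{\theta_0}$; (2) $\Theta_{n+1}=\xi(\Theta_n,X_{n+1})=:\xi_{\Theta_n}(X_{n+1})$ for a measurable $\xi:\Omega_\Theta\times\Omega_X\to\Omega_\Theta$; (3) each $P_\theta$ has a density $p_\theta$ with respect to $\mu$. The statistic $\Theta$ (and $\xi$) is common to $\mathbb P_0,\dots,\mathbb P_K$; the conditional distributions and densities of $\mathbb P_k$ are $P^{(k)}_\theta$, $p^{(k)}_\theta$, and $\boldsymbol p_\theta=(p^{(0)}_\theta,\dots,p^{(K)}_\theta)$. Products and comparisons of vectors are element-wise. Cost function. $\Omega_\rho=\mathbb R_{\ge0}^{K+1}\times\Omega_\Theta$;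 for $\boldsymbol z=(z_0,\dots,z_K)\in\mathbb R_{\ge0}^{K+1}$, $G^{(k)}_{\boldsymbol\lambda}(\boldsymbol z)=\sum_{i=1,i\ne k}^K\lambda_iz_i$ and $g_{\boldsymbol\lambda}(\boldsymbol z)=\min_{1\le k\le K}G^{(k)}_{\boldsymbol\lambda}(\boldsymbol z)$. The function $\rho_{\boldsymbol\lambda}:\Omega_\rho\to\mathbb R_{\ge0}$ is the solution of the displayed integral equation (its existence and uniqueness are known); it is concave in $\boldsymbol z$. Generalized differentials. For a concave function $f:\mathcal Y\subset\mathbb R^{m}\to\mathbb R$, $\partial_{y_k}f(\boldsymbol y)$ is the partial superdifferential $\{c\in\mathbb R: f(\boldsymbol y')-f(\boldsymbol y)\le c\,(y'_k-y_k)\ \text{for all }\boldsymbol y'\in\mathcal Y\text{ with }y'_j=y_j\ \forall j\ne k\}$. For $\rho_{\boldsymbol\lambda}$ it is taken with respect to $z_k$ with $\theta$ fixed. $\partial_{y_k}f$ (without argument) denotes the set of all functions $f_{y_k}$ on the domain with $f_{y_k}(\boldsymbol y)\in\partial_{y_k}f(\boldsymbol y)$ for all $\boldsymbol y$. Policies. A (randomized) sequential test (policy) $\pi$ consists of stopping probabilities $\psi_n\in[0,1]$ and decision probability vectors $\boldsymbol\delta_n=(\delta_{1,n},\dots,\delta_{K,n})$ (nonnegative, summing to 1), functions of the observations up to time $n$; given that the test has not stopped before, it stops at time $n$ with probability $\psi_n$, and then decides for hypothesis $k$ with probability $\delta_{k,n}$. Stopping before any observation ($n=0$) is allowed. $\tau$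 is the stopping time. The weighted sum cost is $L_{\boldsymbol\lambda}(\pi,\boldsymbol{\mathbb P})=E_{\pi,\mathbb P_0}[\tau]+\sum_{k=1}^K\lambda_kE_{\pi,\mathbb P_k}[1-\delta_{k,\tau}]$. $\Pi^*_{\boldsymbol\lambda}(\boldsymbol{\mathbb P})$ is the set of time-homogeneous policies minimizing $L_{\boldsymbol\lambda}(\cdot,\boldsymbol{\mathbb P})$ over all policies; by a known characterization, these are the policies $\psi_n=\psi(\boldsymbol z_n,\theta_n)$, $\delta_{k,n}=\delta_k(\boldsymbol z_n)$ (time-independent $\psi,\delta_k$), with $\boldsymbol z_0=\boldsymbol 1$, $\boldsymbol z_{n+1}=\boldsymbol z_n\boldsymbol p_{\theta_n}(x_{n+1})$, $\theta_{n+1}=\xi_{\theta_n}(x_{n+1})$, such that, writing $c(\boldsymbol z,\theta)=z_0+\int\rho_{\boldsymbol\lambda}(\boldsymbol z\boldsymbol p_\theta(x),\xi_\theta(x))\mu(\mathrm dx)$, one has $\psi(\boldsymbol z,\theta)=1$ if $g_{\boldsymbol\lambda}(\boldsymbol z)<c(\boldsymbol z,\theta)$, $\psi(\boldsymbol z,\theta)=0$ if $g_{\boldsymbol\lambda}(\boldsymbol z)>c(\boldsymbol z,\theta)$, $\psi(\boldsymbol z,\theta)\in[0,1]$ otherwise, and $\delta_k(\boldsymbol z)=0$ whenever $G^{(k)}_{\boldsymbol\lambda}(\boldsymbol z)\ne g_{\boldsymbol\lambda}(\boldsymbol z)$. Conditional performance. For such a policy and $\mathbb P\in\mathbb M$ with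 conditional distributions $P_\theta$, $\gamma_{\pi,\mathbb P}(\boldsymbol z,\theta)=E_{\pi,\mathbb P}[\tau\mid\boldsymbol Z_0=\boldsymbol z,\Theta_0=\theta]\in\mathbb R_{\ge0}\cup\{\infty\}$ and $\alpha^{(k)}_{\pi,\mathbb P}(\boldsymbol z,\theta)=E_{\pi,\mathbb P}[1-\delta_{k,\tau}\mid\boldsymbol Z_0=\boldsymbol z,\Theta_0=\theta]\in[0,1]$, i.e. the statistic is started at $(\boldsymbol z,\theta)$. They satisfy $\gamma_{\pi,\mathbb P}(\boldsymbol z,\theta)=(1-\psi(\boldsymbol z,\theta))\big(1+\int\gamma_{\pi,\mathbb P}(\boldsymbol z\boldsymbol p_\theta(x),\xi_\theta(x))P_\theta(\mathrm dx)\big)$ and $\alpha^{(k)}_{\pi,\mathbb P}(\boldsymbol z,\theta)=\psi(\boldsymbol z,\theta)(1-\delta_k(\boldsymbol z))+(1-\psi(\boldsymbol z,\theta))\int\alpha^{(k)}_{\pi,\mathbb P}(\boldsymbol z\boldsymbol p_\theta(x),\xi_\theta(x))P_\theta(\mathrm dx)$.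
   Formalization: Superdifferential slopes may be +∞ (γ can be infinite at z_0=0, where no real slope fits); part 2 for α^(k) is claimed only where z_k>0 (at z_k=0 the superdifferential is unbounded above); ρ is taken as the least nonnegative measurable solution. *)

theory Defs
  imports "HOL-Probability.Probability"
begin

text \<open>
  The hypotheses \<open>0, 1, \<dots>, K\<close> are indexed by \<open>'k option\<close>, where \<open>'k\<close> is a finite type with
  \<open>K = CARD('k)\<close>: \<open>None\<close> is the index \<open>0\<close> and \<open>Some k\<close> are the indices \<open>1, \<dots>, K\<close>. A point
  \<open>(z\<^sub>0, \<dots>, z\<^sub>K)\<close> is a vector of type \<open>real ^ 'k option\<close>.

  The reference measure \<open>\<mu>\<close> carries the measurable space of the observations, \<open>MT\<close> is the measurable
  space of the statistic. An observation sequence is \<open>\<omega> :: nat \<Rightarrow> 'x\<close> with \<open>\<omega> n = X\<^sub>n\<^sub>+\<^sub>1\<close>.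
\<close>

definition obs_space :: "'x measure \<Rightarrow> (nat \<Rightarrow> 'x) measure" where
  "obs_space \<mu> = PiM UNIV (\<lambda>_. \<mu>)"

definition obs_filtration :: "'x measure \<Rightarrow> nat \<Rightarrow> (nat \<Rightarrow> 'x) measure" where
  "obs_filtration \<mu> n =
     vimage_algebra (space (obs_space \<mu>)) (\<lambda>\<omega>. restrict \<omega> {..<n}) (PiM {..<n} (\<lambda>_. \<mu>))"

primrec stat_seq :: "('t \<Rightarrow> 'x \<Rightarrow> 't) \<Rightarrow> 't \<Rightarrow> (nat \<Rightarrow> 'x) \<Rightarrow> nat \<Rightarrow> 't" where
  "stat_seq \<xi> \<theta> \<omega> 0 = \<theta>"
| "stat_seq \<xi> \<theta> \<omega> (Suc n) = \<xi> (stat_seq \<xi> \<theta> \<omega> n) (\<omega> n)"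

definition density_family :: "'x measure \<Rightarrow> 't measure \<Rightarrow> ('t \<Rightarrow> 'x \<Rightarrow> real) \<Rightarrow> bool" where
  "density_family \<mu> MT q \<longleftrightarrow>
     (\<lambda>(\<theta>, x). q \<theta> x) \<in> borel_measurable (MT \<Otimes>\<^sub>M \<mu>) \<and>
     (\<forall>\<theta>\<in>space MT. (\<forall>x\<in>space \<mu>. 0 \<le> q \<theta> x) \<and> prob_space (density \<mu> (\<lambda>x. ennreal (q \<theta> x))))"

text \<open>
  The joint distributions of the observations for which the statistic started in \<open>\<theta>\<close> is sufficient
  and the conditional distributions have the densities \<open>q\<close>. The case \<open>n = 0\<close> of the condition, where
  the conditioning \<open>\<sigma>\<close>-algebra is trivial, says that the first observation has density \<open>q \<theta>\<close>.
\<close>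

definition process_laws ::
  "'x measure \<Rightarrow> ('t \<Rightarrow> 'x \<Rightarrow> 't) \<Rightarrow> ('t \<Rightarrow> 'x \<Rightarrow> real) \<Rightarrow> 't \<Rightarrow> (nat \<Rightarrow> 'x) measure set" where
  "process_laws \<mu> \<xi> q \<theta> =
     {Q. prob_space Q \<and> sets Q = sets (obs_space \<mu>) \<and>
         (\<forall>n. \<forall>E\<in>sets \<mu>. AE \<omega> in Q.
            real_cond_exp Q (obs_filtration \<mu> n) (indicator {\<omega>' \<in> space Q. \<omega>' n \<in> E}) \<omega> =
            measure (density \<mu> (\<lambda>x. ennreal (q (stat_seq \<xi> \<theta> \<omega> n) x))) E)}"

definition nonneg_vecs :: "(real ^ 'i) set" where
  "nonneg_vecs = {z. \<forall>i. 0 \<le> z $ i}"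

definition rho_space :: "'t measure \<Rightarrow> ((real ^ 'k::finite option) \<times> 't) measure" where
  "rho_space MT = restrict_space borel nonneg_vecs \<Otimes>\<^sub>M MT"

definition vec_mult :: "real ^ 'i \<Rightarrow> ('i \<Rightarrow> real) \<Rightarrow> real ^ 'i" where
  "vec_mult z w = (\<chi> i. z $ i * w i)"

definition G_cost :: "('k::finite \<Rightarrow> real) \<Rightarrow> 'k \<Rightarrow> real ^ 'k option \<Rightarrow> real" where
  "G_cost lam k z = (\<Sum>i\<in>UNIV - {k}. lam i * z $ Some i)"

definition g_cost :: "('k::finite \<Rightarrow> real) \<Rightarrow> real ^ 'k option \<Rightarrow> real" where
  "g_cost lam z = Min (range (\<lambda>k. G_cost lam k z))"

definition cont_cost ::
  "'x measure \<Rightarrow> ('t \<Rightarrow> 'x \<Rightarrow> 't) \<Rightarrow> ('k::finite option \<Rightarrow> 't \<Rightarrow> 'x \<Rightarrow> real) \<Rightarrow>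
   (real ^ 'k option \<Rightarrow> 't \<Rightarrow> real) \<Rightarrow> real ^ 'k option \<Rightarrow> 't \<Rightarrow> real" where
  "cont_cost \<mu> \<xi> p \<rho> z \<theta> =
     z $ None + (LINT x|\<mu>. \<rho> (vec_mult z (\<lambda>i. p i \<theta> x)) (\<xi> \<theta> x))"

definition solves_cost_equation ::
  "'x measure \<Rightarrow> 't measure \<Rightarrow> ('t \<Rightarrow> 'x \<Rightarrow> 't) \<Rightarrow> ('k::finite option \<Rightarrow> 't \<Rightarrow> 'x \<Rightarrow> real) \<Rightarrow>
   ('k \<Rightarrow> real) \<Rightarrow> (real ^ 'k option \<Rightarrow> 't \<Rightarrow> real) \<Rightarrow> bool" where
  "solves_cost_equation \<mu> MT \<xi> p lam \<rho> \<longleftrightarrow>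
     (\<lambda>(z, \<theta>). \<rho> z \<theta>) \<in> borel_measurable (rho_space MT) \<and>
     (\<forall>z\<in>nonneg_vecs. \<forall>\<theta>\<in>space MT.
        0 \<le> \<rho> z \<theta> \<and> \<rho> z \<theta> = min (g_cost lam z) (cont_cost \<mu> \<xi> p \<rho> z \<theta>))"

text \<open>
  Leastness is automatic if the solution is unique. In general it need not be: if the hypotheses
  \<open>1, \<dots>, K\<close> cannot be told apart with certainty by unlimited sampling, there are several solutions,
  already on \<open>z\<^sub>0 = 0\<close>, where both \<open>0\<close> and the limiting Bayes risk solve the equation. The least
  solution is the optimal cost when a test that never stops makes no error (see \<open>expected_error\<close>).
\<close>

definition is_cost_function ::
  "'x measure \<Rightarrow> 't measure \<Rightarrow> ('t \<Rightarrow> 'x \<Rightarrow> 't) \<Rightarrow> ('k::finite option \<Rightarrow> 't \<Rightarrow> 'x \<Rightarrow> real) \<Rightarrow>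
   ('k \<Rightarrow> real) \<Rightarrow> (real ^ 'k option \<Rightarrow> 't \<Rightarrow> real) \<Rightarrow> bool" where
  "is_cost_function \<mu> MT \<xi> p lam \<rho> \<longleftrightarrow>
     solves_cost_equation \<mu> MT \<xi> p lam \<rho> \<and>
     (\<forall>\<rho>'. solves_cost_equation \<mu> MT \<xi> p lam \<rho>' \<longrightarrow>
        (\<forall>z\<in>nonneg_vecs. \<forall>\<theta>\<in>space MT. \<rho> z \<theta> \<le> \<rho>' z \<theta>))"

text \<open>
  A policy is a pair \<open>(\<psi>, \<delta>)\<close>; \<open>\<psi> n \<omega>\<close> and \<open>\<delta> n \<omega> k\<close> are the stopping and decision probabilities
  at time \<open>n\<close>.
\<close>

type_synonym ('x, 'k) policy =
  "(nat \<Rightarrow> (nat \<Rightarrow> 'x) \<Rightarrow> real) \<times> (nat \<Rightarrow> (nat \<Rightarrow> 'x) \<Rightarrow> 'k \<Rightarrow> real)"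

definition policies :: "'x measure \<Rightarrow> ('x, 'k::finite) policy set" where
  "policies \<mu> = {(\<psi>, \<delta>). \<forall>n.
     \<psi> n \<in> borel_measurable (obs_filtration \<mu> n) \<and>
     (\<forall>k. (\<lambda>\<omega>. \<delta> n \<omega> k) \<in> borel_measurable (obs_filtration \<mu> n)) \<and>
     (\<forall>\<omega>\<in>space (obs_space \<mu>).
        \<psi> n \<omega> \<in> {0..1} \<and> (\<forall>k. 0 \<le> \<delta> n \<omega> k) \<and> (\<Sum>k\<in>UNIV. \<delta> n \<omega> k) = 1)}"

definition continue_prob :: "('x, 'k) policy \<Rightarrow> nat \<Rightarrow> (nat \<Rightarrow> 'x) \<Rightarrow> real" where
  "continue_prob \<pi> n \<omega> = (\<Prod>i<n. 1 - fst \<pi> i \<omega>)"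

definition stop_prob :: "('x, 'k) policy \<Rightarrow> nat \<Rightarrow> (nat \<Rightarrow> 'x) \<Rightarrow> real" where
  "stop_prob \<pi> n \<omega> = continue_prob \<pi> n \<omega> * fst \<pi> n \<omega>"

text \<open>
  The conditional law of the stopping time \<open>\<tau>\<close> given \<open>\<omega>\<close> puts mass \<open>stop_prob \<pi> n \<omega>\<close> on \<open>n\<close> and
  the mass \<open>INF n. continue_prob \<pi> n \<omega>\<close> on \<open>\<infinity>\<close>.
\<close>

definition expected_time :: "(nat \<Rightarrow> 'x) measure \<Rightarrow> ('x, 'k) policy \<Rightarrow> ennreal" where
  "expected_time Q \<pi> =
     (\<integral>\<^sup>+\<omega>. (\<Sum>n. of_nat n * ennreal (stop_prob \<pi> n \<omega>)) +
            \<infinity> * (INF n. ennreal (continue_prob \<pi> n \<omega>)) \<partial>Q)"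

text \<open>
  \<open>\<delta>\<^bsub>k,\<tau>\<^esub>\<close> is only defined for \<open>\<tau> < \<infinity>\<close>; the event \<open>\<tau> = \<infinity>\<close>, on which no decision is made, does not
  contribute to the error probability.
\<close>

definition expected_error :: "(nat \<Rightarrow> 'x) measure \<Rightarrow> ('x, 'k) policy \<Rightarrow> 'k \<Rightarrow> ennreal" where
  "expected_error Q \<pi> k =
     (\<integral>\<^sup>+\<omega>. (\<Sum>n. ennreal (stop_prob \<pi> n \<omega> * (1 - snd \<pi> n \<omega> k))) \<partial>Q)"

definition weighted_cost ::
  "('k::finite \<Rightarrow> real) \<Rightarrow> ('k option \<Rightarrow> (nat \<Rightarrow> 'x) measure) \<Rightarrow> ('x, 'k) policy \<Rightarrow> ennreal" where
  "weighted_cost lam Q \<pi> =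
     expected_time (Q None) \<pi> + (\<Sum>k\<in>UNIV. ennreal (lam k) * expected_error (Q (Some k)) \<pi> k)"

type_synonym ('t, 'k) hom_policy =
  "(real ^ 'k option \<Rightarrow> 't \<Rightarrow> real) \<times> (real ^ 'k option \<Rightarrow> 'k \<Rightarrow> real)"

definition hom_policies :: "'t measure \<Rightarrow> ('t, 'k::finite) hom_policy set" where
  "hom_policies MT = {(\<psi>, \<delta>).
     (\<lambda>(z, \<theta>). \<psi> z \<theta>) \<in> borel_measurable (rho_space MT) \<and>
     (\<forall>k. (\<lambda>z. \<delta> z k) \<in> borel_measurable (restrict_space borel nonneg_vecs)) \<and>
     (\<forall>z\<in>nonneg_vecs. (\<forall>\<theta>\<in>space MT. \<psi> z \<theta> \<in> {0..1}) \<and>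
        (\<forall>k. 0 \<le> \<delta> z k) \<and> (\<Sum>k\<in>UNIV. \<delta> z k) = 1)}"

primrec weight_seq ::
  "('t \<Rightarrow> 'x \<Rightarrow> 't) \<Rightarrow> ('k::finite option \<Rightarrow> 't \<Rightarrow> 'x \<Rightarrow> real) \<Rightarrow> real ^ 'k option \<Rightarrow> 't \<Rightarrow>
   (nat \<Rightarrow> 'x) \<Rightarrow> nat \<Rightarrow> real ^ 'k option" where
  "weight_seq \<xi> p z \<theta> \<omega> 0 = z"
| "weight_seq \<xi> p z \<theta> \<omega> (Suc n) =
     vec_mult (weight_seq \<xi> p z \<theta> \<omega> n) (\<lambda>i. p i (stat_seq \<xi> \<theta> \<omega> n) (\<omega> n))"

text \<open>The policy induced by a time-homogeneous one when the statistic is started at \<open>(z, \<theta>)\<close>.\<close>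

definition run_policy ::
  "('t \<Rightarrow> 'x \<Rightarrow> 't) \<Rightarrow> ('k::finite option \<Rightarrow> 't \<Rightarrow> 'x \<Rightarrow> real) \<Rightarrow> ('t, 'k) hom_policy \<Rightarrow>
   real ^ 'k option \<Rightarrow> 't \<Rightarrow> ('x, 'k) policy" where
  "run_policy \<xi> p \<pi> z \<theta> =
     (\<lambda>n \<omega>. fst \<pi> (weight_seq \<xi> p z \<theta> \<omega> n) (stat_seq \<xi> \<theta> \<omega> n),
      \<lambda>n \<omega>. snd \<pi> (weight_seq \<xi> p z \<theta> \<omega> n))"

text \<open>
  Optimality of the cost from the actual start \<open>(1, \<theta>\<^sub>0)\<close> does not constrain \<open>\<psi>\<close> and \<open>\<delta>\<close> at points
  that are not reached from there; the known characterization of optimal policies fixes them on all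
  of \<open>\<Omega>\<^sub>\<rho>\<close>. Both requirements are listed.
\<close>

definition optimal_policies ::
  "'x measure \<Rightarrow> 't measure \<Rightarrow> ('t \<Rightarrow> 'x \<Rightarrow> 't) \<Rightarrow> ('k::finite option \<Rightarrow> 't \<Rightarrow> 'x \<Rightarrow> real) \<Rightarrow>
   ('k \<Rightarrow> real) \<Rightarrow> (real ^ 'k option \<Rightarrow> 't \<Rightarrow> real) \<Rightarrow> 't \<Rightarrow> ('k option \<Rightarrow> (nat \<Rightarrow> 'x) measure) \<Rightarrow>
   ('t, 'k) hom_policy set" where
  "optimal_policies \<mu> MT \<xi> p lam \<rho> \<theta>\<^sub>0 Q = {\<pi> \<in> hom_policies MT.
     (\<forall>\<pi>'\<in>policies \<mu>. weighted_cost lam Q (run_policy \<xi> p \<pi> 1 \<theta>\<^sub>0) \<le> weighted_cost lam Q \<pi>') \<and>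
     (\<forall>z\<in>nonneg_vecs. \<forall>\<theta>\<in>space MT.
        (g_cost lam z < cont_cost \<mu> \<xi> p \<rho> z \<theta> \<longrightarrow> fst \<pi> z \<theta> = 1) \<and>
        (g_cost lam z > cont_cost \<mu> \<xi> p \<rho> z \<theta> \<longrightarrow> fst \<pi> z \<theta> = 0)) \<and>
     (\<forall>z\<in>nonneg_vecs. \<forall>k. G_cost lam k z \<noteq> g_cost lam z \<longrightarrow> snd \<pi> z k = 0)}"

text \<open>
  In the conditional performance measures, \<open>Q \<theta>\<close> is the law of the observations when the statistic starts in \<open>\<theta>\<close>.
\<close>

definition perf_time ::
  "('t \<Rightarrow> 'x \<Rightarrow> 't) \<Rightarrow> ('k::finite option \<Rightarrow> 't \<Rightarrow> 'x \<Rightarrow> real) \<Rightarrow> ('t, 'k) hom_policy \<Rightarrow>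
   ('t \<Rightarrow> (nat \<Rightarrow> 'x) measure) \<Rightarrow> real ^ 'k option \<Rightarrow> 't \<Rightarrow> ennreal" where
  "perf_time \<xi> p \<pi> Q z \<theta> = expected_time (Q \<theta>) (run_policy \<xi> p \<pi> z \<theta>)"

definition perf_error ::
  "('t \<Rightarrow> 'x \<Rightarrow> 't) \<Rightarrow> ('k::finite option \<Rightarrow> 't \<Rightarrow> 'x \<Rightarrow> real) \<Rightarrow> ('t, 'k) hom_policy \<Rightarrow>
   ('t \<Rightarrow> (nat \<Rightarrow> 'x) measure) \<Rightarrow> 'k \<Rightarrow> real ^ 'k option \<Rightarrow> 't \<Rightarrow> real" where
  "perf_error \<xi> p \<pi> Q k z \<theta> = enn2real (expected_error (Q \<theta>) (run_policy \<xi> p \<pi> z \<theta>) k)"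

text \<open>
  The slopes are extended reals, since \<open>perf_time\<close> can be infinite. The only difference from real
  slopes is that \<open>\<infinity>\<close> belongs to the superdifferential at points where \<open>Y\<close> does not extend in the
  direction of decreasing \<open>y\<^sub>k\<close>; on the nonnegative orthant these are the points with \<open>y\<^sub>k = 0\<close>,
  where the superdifferential is unbounded above. (Note that \<open>\<infinity> * 0 = 0\<close>.)
\<close>

definition partial_superdiff ::
  "(real ^ 'i) set \<Rightarrow> (real ^ 'i \<Rightarrow> real) \<Rightarrow> 'i \<Rightarrow> real ^ 'i \<Rightarrow> ereal set" where
  "partial_superdiff Y f k y =
     {c. \<forall>y'\<in>Y. (\<forall>j. j \<noteq> k \<longrightarrow> y' $ j = y $ j) \<longrightarrow> ereal (f y' - f y) \<le> c * ereal (y' $ k - y $ k)}"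

definition rho_superdiff ::
  "(real ^ 'k::finite option \<Rightarrow> 't \<Rightarrow> real) \<Rightarrow> 'k option \<Rightarrow> real ^ 'k option \<Rightarrow> 't \<Rightarrow> ereal set" where
  "rho_superdiff \<rho> i z \<theta> = partial_superdiff nonneg_vecs (\<lambda>z. \<rho> z \<theta>) i z"

definition rho_superdiff_funs ::
  "'t measure \<Rightarrow> (real ^ 'k::finite option \<Rightarrow> 't \<Rightarrow> real) \<Rightarrow> 'k option \<Rightarrow>
   (real ^ 'k option \<Rightarrow> 't \<Rightarrow> ereal) set" where
  "rho_superdiff_funs MT \<rho> i =
     {h. \<forall>z\<in>nonneg_vecs. \<forall>\<theta>\<in>space MT. h z \<theta> \<in> rho_superdiff \<rho> i z \<theta>}"

end

theory Submission
  imports Defs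
begin

text \<open>
  Let \<open>v\<^sub>0\<close> be the expected stopping time of a policy under hypothesis \<open>0\<close> and \<open>v\<^sub>k\<close> its expected error under
  hypothesis \<open>k\<close> multiplied by \<open>\<lambda>\<^sub>k\<close>. The cost of the policy, when the hypotheses carry the weights
  \<open>u\<^sub>0, \<dots>, u\<^sub>K\<close>, is the linear form \<open>\<Sum>\<^sub>i u\<^sub>i v\<^sub>i\<close> in \<open>u\<close>. Two facts carry the proof. For every policy this form
  lies above \<open>\<rho> u \<theta>\<close> (\<open>rho_le_total\<close>), because \<open>\<rho>\<close> is the limit of value iteration started in \<open>0\<close>,
  whose \<open>n\<close>-th iterate bounds the cost of the first \<open>n\<close> stages from below. For the policy that a
  time-homogeneous test satisfying the pointwise optimality conditions induces from \<open>(z, \<theta>)\<close>, it equals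
  \<open>\<rho> z \<theta>\<close> at \<open>u = z\<close> (\<open>greedy_total_le_rho\<close>), because each stage then realizes the minimum in the cost
  equation. So the cost vector of such a test is a supergradient of \<open>\<rho>\<close> at the point where the test is
  started, which is the first claim (\<open>greedy_cost_component_in_superdiff\<close>). The case \<open>u = 1\<close> shows that all tests
  satisfying the pointwise conditions are optimal. As a minimum of linear forms, \<open>\<rho>\<close> is moreover
  concave and positively homogeneous in \<open>z\<close> (\<open>rho_superlinear\<close>).

  For the second claim, the one-sided derivative of \<open>\<rho>\<close> in a direction \<open>d \<ge> 0\<close> is computed. It satisfies
  the recursion that differentiating the minimum in the cost equation suggests (\<open>dir_deriv_ge\<close>):
  it is bounded below by the smallest derivative among the active alternatives, namely deciding for some
  \<open>k\<close> or continuing. A test that breaks all ties in favour of the smaller derivative therefore has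
  \<open>\<Sum>\<^sub>i d\<^sub>i v\<^sub>i\<close> at most equal to this derivative (\<open>mask_policy_total_le\<close>); here only nonnegative remainders
  are dropped. With \<open>d = z\<^sub>i e\<^sub>i\<close> this gives a test whose \<open>i\<close>-th component is the right derivative, the smallest
  element of the superdifferential if \<open>z\<^sub>i > 0\<close>. With \<open>d = z - z\<^sub>i e\<^sub>i\<close> it gives a test that minimizes the
  joint contribution of all other components; since \<open>\<Sum>\<^sub>j z\<^sub>j v\<^sub>j = \<rho> z \<theta>\<close> is the same for all tests, its
  \<open>i\<close>-th component is the largest possible.
  In this way the left derivative needs no recursion of its own.

  The values in between come from tests that randomize between these two with a parameter \<open>q\<close>. Each
  \<open>z\<^sub>j v\<^sub>j\<close> is lower semicontinuous in \<open>q\<close>, as a sum of nonnegative continuous functions, and their sum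
  is constant, so each is continuous (\<open>total_mix_continuous\<close>) and the intermediate value theorem
  applies (\<open>superdiff_attained\<close>).

  At \<open>z\<^sub>0 = 0\<close> the superdifferential with respect to \<open>z\<^sub>0\<close> contains everything from the right derivative
  up to infinity. There sampling is free, \<open>\<rho>\<close> vanishes, and once some decision has become free of cost a test may go on for a geometric number of
  observations. The parameter of that geometric distribution moves the expected time through this
  whole range (\<open>delayed_policy_time\<close>, \<open>superdiff_time_attained_at_zero\<close>).
\<close>

section \<open>The filtration of the observations\<close>

lemma space_obs_space: "space (obs_space \<mu>) = {\<omega>. \<forall>n. \<omega> n \<in> space \<mu>}"
  by (auto simp: obs_space_def space_PiM)

lemma space_obs_filtration [simp]: "space (obs_filtration \<mu> n) = space (obs_space \<mu>)"
  by (simp add: obs_filtration_def)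

lemma restrict_in_space: "(\<lambda>\<omega>. restrict \<omega> {..<n}) \<in> space (obs_space \<mu>) \<rightarrow> space (PiM {..<n} (\<lambda>_. \<mu>))"
  by (auto simp: space_obs_space space_PiM)

lemma measurable_obs_coord: "(\<lambda>\<omega>. \<omega> i) \<in> obs_space \<mu> \<rightarrow>\<^sub>M \<mu>"
  unfolding obs_space_def by measurable

lemma measurable_obs_filtration_coord:
  assumes "i < n"
  shows "(\<lambda>\<omega>. \<omega> i) \<in> obs_filtration \<mu> n \<rightarrow>\<^sub>M \<mu>"
proof -
  have "(\<lambda>\<omega>. restrict \<omega> {..<n}) \<in> obs_filtration \<mu> n \<rightarrow>\<^sub>M PiM {..<n} (\<lambda>_. \<mu>)"
    unfolding obs_filtration_def by (rule measurable_vimage_algebra1[OF restrict_in_space])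
  moreover have "(\<lambda>x. x i) \<in> PiM {..<n} (\<lambda>_. \<mu>) \<rightarrow>\<^sub>M \<mu>"
    using measurable_component_singleton[of i "{..<n}" "\<lambda>_. \<mu>"] assms by simp
  ultimately have "(\<lambda>\<omega>. restrict \<omega> {..<n} i) \<in> obs_filtration \<mu> n \<rightarrow>\<^sub>M \<mu>"
    by (rule measurable_compose[where g = "\<lambda>x. x i"])
  then show ?thesis using assms by simp
qed

lemma measurable_obs_spaceI:
  assumes "\<And>i. (\<lambda>x. f x i) \<in> M \<rightarrow>\<^sub>M \<mu>"
  shows "f \<in> M \<rightarrow>\<^sub>M obs_space \<mu>"
proof -
  have "f x i \<in> space \<mu>" if "x \<in> space M" for x i
    using measurable_space[OF assms[of i] that] .
  then show ?thesis
    unfolding obs_space_def using assms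
    by (intro measurable_PiM_single'[where f = "\<lambda>i x. f x i"]) (auto simp: PiE_iff)
qed

lemma measurable_obs_filtrationI:
  assumes "f \<in> space M \<rightarrow> space (obs_space \<mu>)" and "\<And>i. i < n \<Longrightarrow> (\<lambda>x. f x i) \<in> M \<rightarrow>\<^sub>M \<mu>"
  shows "f \<in> M \<rightarrow>\<^sub>M obs_filtration \<mu> n"
  unfolding obs_filtration_def
proof (rule measurable_vimage_algebra2)
  show "(\<lambda>x. restrict (f x) {..<n}) \<in> M \<rightarrow>\<^sub>M PiM {..<n} (\<lambda>_. \<mu>)"
    using assms(2) by (intro measurable_restrict[where X = "\<lambda>i x. f x i"]) simp
qed (use assms in auto)

lemma measurable_obs_filtration_mono:
  assumes "f \<in> obs_filtration \<mu> m \<rightarrow>\<^sub>M N" "m \<le> n"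
  shows "f \<in> obs_filtration \<mu> n \<rightarrow>\<^sub>M N"
proof -
  have "(\<lambda>\<omega>. \<omega>) \<in> obs_filtration \<mu> n \<rightarrow>\<^sub>M obs_filtration \<mu> m"
    using assms(2) by (intro measurable_obs_filtrationI measurable_obs_filtration_coord) auto
  from measurable_compose[OF this assms(1)] show ?thesis .
qed

lemma measurable_obs_filtrationD:
  assumes "f \<in> obs_filtration \<mu> m \<rightarrow>\<^sub>M N"
  shows "f \<in> obs_space \<mu> \<rightarrow>\<^sub>M N"
proof -
  have "(\<lambda>\<omega>. \<omega>) \<in> obs_space \<mu> \<rightarrow>\<^sub>M obs_filtration \<mu> m"
    by (intro measurable_obs_filtrationI measurable_obs_coord) auto
  from measurable_compose[OF this assms(1)] show ?thesis .
qed

lemma subalgebra_obs_filtration: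
  assumes "sets Q = sets (obs_space \<mu>)"
  shows "subalgebra Q (obs_filtration \<mu> n)"
proof -
  have *: "(\<lambda>\<omega>. \<omega>) \<in> obs_space \<mu> \<rightarrow>\<^sub>M obs_filtration \<mu> n"
    by (rule measurable_obs_filtrationD[of _ _ n]) (simp add: measurable_ident_sets)
  have "A \<in> sets (obs_space \<mu>)" if "A \<in> sets (obs_filtration \<mu> n)" for A
    using measurable_sets[OF * that] sets.sets_into_space[OF that] by (simp add: Int_absorb2)
  then show ?thesis
    using assms sets_eq_imp_space_eq[OF assms] by (auto simp: subalgebra_def)
qed

text \<open>
  Every set in the \<open>\<sigma>\<close>-algebra at time \<open>n\<close> is the preimage of a set under the restriction to the first
  \<open>n\<close> coordinates, so the level set of \<open>F\<close> through \<open>\<omega>'\<close> cannot separate \<open>\<omega>\<close> from \<open>\<omega>'\<close>.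
\<close>

lemma obs_filtration_eq_prefix:
  fixes F :: "(nat \<Rightarrow> 'x) \<Rightarrow> 'b::t1_space"
  assumes F: "F \<in> borel_measurable (obs_filtration \<mu> n)"
    and \<omega>: "\<omega> \<in> space (obs_space \<mu>)" "\<omega>' \<in> space (obs_space \<mu>)" and eq: "\<And>i. i < n \<Longrightarrow> \<omega> i = \<omega>' i"
  shows "F \<omega> = F \<omega>'"
proof -
  have "F -` {F \<omega>'} \<inter> space (obs_filtration \<mu> n) \<in> sets (obs_filtration \<mu> n)"
    by (rule measurable_sets[OF F]) simp
  then obtain A where A: "F -` {F \<omega>'} \<inter> space (obs_space \<mu>) = (\<lambda>\<omega>. restrict \<omega> {..<n}) -` A \<inter> space (obs_space \<mu>)"
    unfolding obs_filtration_def sets_vimage_algebra2[OF restrict_in_space] by auto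
  have "restrict \<omega> {..<n} = restrict \<omega>' {..<n}" using eq by auto
  then show ?thesis using A \<omega> by auto
qed

lemma measurable_stat_seq_filtration:
  assumes \<xi>: "(\<lambda>(\<theta>, x). \<xi> \<theta> x) \<in> MT \<Otimes>\<^sub>M \<mu> \<rightarrow>\<^sub>M MT" and \<theta>: "\<theta> \<in> space MT"
  shows "(\<lambda>\<omega>. stat_seq \<xi> \<theta> \<omega> n) \<in> obs_filtration \<mu> n \<rightarrow>\<^sub>M MT"
proof (induction n)
  case (Suc n)
  have "(\<lambda>\<omega>. (stat_seq \<xi> \<theta> \<omega> n, \<omega> n)) \<in> obs_filtration \<mu> (Suc n) \<rightarrow>\<^sub>M MT \<Otimes>\<^sub>M \<mu>"
    by (rule measurable_Pair[OF measurable_obs_filtration_mono[OF Suc] measurable_obs_filtration_coord]) auto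
  from measurable_compose[OF this \<xi>] show ?case by simp
qed (use \<theta> in simp)

section \<open>One step of a process law\<close>

text \<open>
  The condition in \<open>process_laws\<close> only concerns indicators of events \<open>\<omega> n \<in> E\<close>. It says that two finite measures on
  the product of the past and the next observation, the law of \<open>(\<omega>, \<omega> n)\<close> and the one with density
  \<open>q\<close> relative to the second factor, agree on rectangles; hence they agree, and integrals of functions
  of the past and the next observation can be computed by integrating out the latter.
\<close>

lemma process_law_step:
  assumes Q: "Q \<in> process_laws \<mu> \<xi> q \<theta>" and "sigma_finite_measure \<mu>"
    and density_families: "density_family \<mu> MT q"
    and \<xi>: "(\<lambda>(\<theta>, x). \<xi> \<theta> x) \<in> MT \<Otimes>\<^sub>M \<mu> \<rightarrow>\<^sub>M MT" and \<theta>: "\<theta> \<in> space MT"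
    and h: "h \<in> borel_measurable (obs_filtration \<mu> n \<Otimes>\<^sub>M \<mu>)"
  shows "(\<integral>\<^sup>+\<omega>. h (\<omega>, \<omega> n) \<partial>Q) =
    (\<integral>\<^sup>+\<omega>. \<integral>\<^sup>+y. ennreal (q (stat_seq \<xi> \<theta> \<omega> n) y) * h (\<omega>, y) \<partial>\<mu> \<partial>Q)"
proof -
  interpret sigma_finite_measure \<mu> by fact
  interpret Q: prob_space Q using Q by (simp add: process_laws_def)
  define F where "F = obs_filtration \<mu> n"
  have setsQ [measurable_cong]: "sets Q = sets (obs_space \<mu>)" using Q by (simp add: process_laws_def)
  have spaceQ: "space Q = space (obs_space \<mu>)" using sets_eq_imp_space_eq[OF setsQ] .
  have sub: "subalgebra Q F" unfolding F_def by (rule subalgebra_obs_filtration[OF setsQ])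
  interpret sub: finite_measure_subalgebra Q F by unfold_locales (rule sub)
  have Fsp: "space F = space Q" by (simp add: F_def spaceQ)
  have stat [measurable]: "(\<lambda>\<omega>. stat_seq \<xi> \<theta> \<omega> n) \<in> F \<rightarrow>\<^sub>M MT"
    unfolding F_def by (rule measurable_stat_seq_filtration[OF \<xi> \<theta>])
  have q [measurable]: "(\<lambda>(\<theta>, x). q \<theta> x) \<in> borel_measurable (MT \<Otimes>\<^sub>M \<mu>)"
    using density_families by (simp add: density_family_def)
  have q_prob: "prob_space (density \<mu> (\<lambda>x. ennreal (q (stat_seq \<xi> \<theta> \<omega> n) x)))" if "\<omega> \<in> space Q" for \<omega>
    using density_families measurable_space[OF stat] that by (auto simp: density_family_def Fsp)
  define dq where "dq \<omega> = density \<mu> (\<lambda>x. ennreal (q (stat_seq \<xi> \<theta> \<omega> n) x))" for \<omega>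
  define R where "R = restr_to_subalg Q F"
  have sets_R [measurable_cong]: "sets R = sets F" unfolding R_def by (rule sets_restr_to_subalg[OF sub])
  have spR: "space R = space Q" by (simp add: R_def space_restr_to_subalg)
  have qm [measurable]: "(\<lambda>(\<omega>, y). ennreal (q (stat_seq \<xi> \<theta> \<omega> n) y)) \<in> borel_measurable (F \<Otimes>\<^sub>M \<mu>)"
    by measurable
  have [measurable]: "(\<lambda>\<omega>. \<omega>) \<in> Q \<rightarrow>\<^sub>M F"
    by (rule measurable_from_subalg[OF sub]) simp
  have [measurable]: "(\<lambda>\<omega>. \<omega> n) \<in> Q \<rightarrow>\<^sub>M \<mu>"
    by (simp add: measurable_cong_sets[OF setsQ refl] measurable_obs_coord)
  have [measurable]: "(\<lambda>\<omega>. (\<omega>, \<omega> n)) \<in> Q \<rightarrow>\<^sub>M F \<Otimes>\<^sub>M \<mu>"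
    by measurable
  \<comment> \<open>\<open>M1\<close> is the law of the past and the next observation, \<open>M2\<close> integrates out the latter with density \<open>q\<close>\<close>
  define M1 where "M1 = distr Q (F \<Otimes>\<^sub>M \<mu>) (\<lambda>\<omega>. (\<omega>, \<omega> n))"
  define M2 where "M2 = density (R \<Otimes>\<^sub>M \<mu>) (\<lambda>(\<omega>, y). ennreal (q (stat_seq \<xi> \<theta> \<omega> n) y))"
  have sets12: "sets M1 = sets (F \<Otimes>\<^sub>M \<mu>)" "sets M2 = sets (F \<Otimes>\<^sub>M \<mu>)"
    by (simp_all add: M1_def M2_def sets_pair_measure_cong[OF sets_R refl])
  have int_R: "(\<integral>\<^sup>+\<omega>. f \<omega> \<partial>R) = (\<integral>\<^sup>+\<omega>. f \<omega> \<partial>Q)" if "f \<in> borel_measurable F" for f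
    unfolding R_def by (rule nn_integral_subalgebra2[OF sub that])
  have int_M2: "integral\<^sup>N M2 f = (\<integral>\<^sup>+\<omega>. \<integral>\<^sup>+y. ennreal (q (stat_seq \<xi> \<theta> \<omega> n) y) * f (\<omega>, y) \<partial>\<mu> \<partial>Q)"
    if [measurable]: "f \<in> borel_measurable (F \<Otimes>\<^sub>M \<mu>)" for f
  proof -
    have "integral\<^sup>N M2 f = (\<integral>\<^sup>+x. (case x of (\<omega>, y) \<Rightarrow> ennreal (q (stat_seq \<xi> \<theta> \<omega> n) y)) * f x \<partial>(R \<Otimes>\<^sub>M \<mu>))"
      unfolding M2_def by (subst nn_integral_density) (auto simp: case_prod_unfold)
    also have "\<dots> = (\<integral>\<^sup>+\<omega>. \<integral>\<^sup>+y. ennreal (q (stat_seq \<xi> \<theta> \<omega> n) y) * f (\<omega>, y) \<partial>\<mu> \<partial>R)"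
      by (subst nn_integral_fst[symmetric]) (auto simp: case_prod_unfold)
    also have "\<dots> = (\<integral>\<^sup>+\<omega>. \<integral>\<^sup>+y. ennreal (q (stat_seq \<xi> \<theta> \<omega> n) y) * f (\<omega>, y) \<partial>\<mu> \<partial>Q)"
      by (rule int_R) measurable
    finally show ?thesis .
  qed
  have rect: "emeasure M1 (A \<times> E) = emeasure M2 (A \<times> E)" if A: "A \<in> sets F" and E [measurable]: "E \<in> sets \<mu>" for A E
  proof -
    have AQ [measurable]: "A \<in> sets Q" using A sub by (auto simp: subalgebra_def)
    define I where "I = {\<omega> \<in> space Q. \<omega> n \<in> E}"
    have [measurable]: "I \<in> sets Q" unfolding I_def by measurable
    have AE: "AE \<omega> in Q. real_cond_exp Q F (indicator I) \<omega> = measure (dq \<omega>) E"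
      using Q E unfolding process_laws_def F_def dq_def I_def by blast
    have mdq [measurable]: "(\<lambda>\<omega>. measure (dq \<omega>) E) \<in> borel_measurable Q"
    proof -
      have "(\<lambda>\<omega>. enn2real (\<integral>\<^sup>+y. ennreal (q (stat_seq \<xi> \<theta> \<omega> n) y) * indicator E y \<partial>\<mu>)) \<in> borel_measurable F"
        by measurable
      moreover have "measure (dq \<omega>) E = enn2real (\<integral>\<^sup>+y. ennreal (q (stat_seq \<xi> \<theta> \<omega> n) y) * indicator E y \<partial>\<mu>)" 
        if "\<omega> \<in> space F" for \<omega>
      proof -
        have [measurable]: "stat_seq \<xi> \<theta> \<omega> n \<in> space MT" using measurable_space[OF stat that] .
        show ?thesis unfolding dq_def measure_def by (subst emeasure_density) auto
      qed
      ultimately have "(\<lambda>\<omega>. measure (dq \<omega>) E) \<in> borel_measurable F"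
        by (subst measurable_cong) auto
      then show ?thesis by measurable
    qed
    have "emeasure M1 (A \<times> E) = emeasure Q ((\<lambda>\<omega>. (\<omega>, \<omega> n)) -` (A \<times> E) \<inter> space Q)"
      unfolding M1_def using A E by (intro emeasure_distr) auto
    also have "(\<lambda>\<omega>. (\<omega>, \<omega> n)) -` (A \<times> E) \<inter> space Q = A \<inter> I"
      using sets.sets_into_space[OF AQ] by (auto simp: I_def)
    also have "emeasure Q (A \<inter> I) = ennreal (measure Q (A \<inter> I))"
      by (rule Q.emeasure_eq_measure)
    also have "measure Q (A \<inter> I) = (\<integral>\<omega>\<in>A. indicator I \<omega> \<partial>Q)"
      unfolding set_lebesgue_integral_def
      by (simp add: indicator_inter_arith[symmetric] Int_absorb2 sets.sets_into_space)
    also have "\<dots> = (\<integral>\<omega>\<in>A. real_cond_exp Q F (indicator I) \<omega> \<partial>Q)"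
      by (rule sub.real_cond_exp_intA)
         (auto simp: A Q.emeasure_eq_measure intro!: integrable_real_indicator)
    also have "\<dots> = (\<integral>\<omega>\<in>A. measure (dq \<omega>) E \<partial>Q)"
      unfolding set_lebesgue_integral_def using AE by (intro integral_cong_AE) (auto intro: borel_measurable_cond_exp2)
    also have "\<dots> = enn2real (\<integral>\<^sup>+\<omega>. ennreal (indicator A \<omega> * measure (dq \<omega>) E) \<partial>Q)"
      unfolding set_lebesgue_integral_def by (subst integral_eq_nn_integral) auto
    also have "ennreal \<dots> = (\<integral>\<^sup>+\<omega>. ennreal (indicator A \<omega> * measure (dq \<omega>) E) \<partial>Q)"
    proof (rule ennreal_enn2real)
      have "(\<integral>\<^sup>+\<omega>. ennreal (indicator A \<omega> * measure (dq \<omega>) E) \<partial>Q) \<le> (\<integral>\<^sup>+\<omega>. 1 \<partial>Q)"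
        using q_prob by (intro nn_integral_mono) (auto simp: dq_def indicator_def ennreal_le_1 prob_space.prob_le_1)
      then show "(\<integral>\<^sup>+\<omega>. ennreal (indicator A \<omega> * measure (dq \<omega>) E) \<partial>Q) < top"
        by (simp add: Q.emeasure_space_1 le_less_trans[OF _ ennreal_one_less_top])
    qed
    also have "\<dots> = (\<integral>\<^sup>+\<omega>. \<integral>\<^sup>+y. ennreal (q (stat_seq \<xi> \<theta> \<omega> n) y) * indicator (A \<times> E) (\<omega>, y) \<partial>\<mu> \<partial>Q)"
    proof (rule nn_integral_cong)
      fix \<omega> assume \<omega>: "\<omega> \<in> space Q"
      have [measurable]: "stat_seq \<xi> \<theta> \<omega> n \<in> space MT" using measurable_space[OF stat, of \<omega>] \<omega> by (simp add: Fsp)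
      interpret d: prob_space "dq \<omega>" unfolding dq_def by (rule q_prob[OF \<omega>])
      have "ennreal (measure (dq \<omega>) E) = (\<integral>\<^sup>+y. ennreal (q (stat_seq \<xi> \<theta> \<omega> n) y) * indicator E y \<partial>\<mu>)"
        unfolding d.emeasure_eq_measure[symmetric] unfolding dq_def by (subst emeasure_density) auto
      then show "ennreal (indicator A \<omega> * measure (dq \<omega>) E) =
          (\<integral>\<^sup>+y. ennreal (q (stat_seq \<xi> \<theta> \<omega> n) y) * indicator (A \<times> E) (\<omega>, y) \<partial>\<mu>)"
        by (auto simp: indicator_def)
    qed
    also have "\<dots> = (\<integral>\<^sup>+x. indicator (A \<times> E) x \<partial>M2)"
      by (rule int_M2[symmetric]) (use A in measurable)
    also have "\<dots> = emeasure M2 (A \<times> E)"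
      by (rule nn_integral_indicator) (use A in \<open>simp add: sets12\<close>)
    finally show ?thesis .
  qed
  \<comment> \<open>both measures are finite and agree on the rectangles, which generate the product \<open>\<sigma>\<close>-algebra\<close>
  have "M1 = M2"
  proof (rule measure_eqI_generator_eq[where A = "\<lambda>_. space F \<times> space \<mu>"])
    show "Int_stable {a \<times> b |a b. a \<in> sets F \<and> b \<in> sets \<mu>}" by (rule Int_stable_pair_measure_generator)
    show "{a \<times> b |a b. a \<in> sets F \<and> b \<in> sets \<mu>} \<subseteq> Pow (space F \<times> space \<mu>)" by (rule pair_measure_closed)
    show "sets M1 = sigma_sets (space F \<times> space \<mu>) {a \<times> b |a b. a \<in> sets F \<and> b \<in> sets \<mu>}"
      "sets M2 = sigma_sets (space F \<times> space \<mu>) {a \<times> b |a b. a \<in> sets F \<and> b \<in> sets \<mu>}"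
      unfolding sets12 by (rule sets_pair_measure)+
    show "emeasure M1 X = emeasure M2 X" if "X \<in> {a \<times> b |a b. a \<in> sets F \<and> b \<in> sets \<mu>}" for X
      using that rect by auto
    have "emeasure M1 (space F \<times> space \<mu>) \<le> 1"
      unfolding M1_def by (subst emeasure_distr) (auto intro: Q.measure_le_1)
    then show "\<And>i. emeasure M1 (space F \<times> space \<mu>) \<noteq> \<infinity>" 
      by (auto simp: top_unique)
  qed auto
  have [measurable]: "h \<in> borel_measurable (F \<Otimes>\<^sub>M \<mu>)"
    using h by (simp add: F_def)
  have "(\<integral>\<^sup>+\<omega>. h (\<omega>, \<omega> n) \<partial>Q) = integral\<^sup>N M1 h"
    unfolding M1_def by (subst nn_integral_distr) auto
  also have "\<dots> = integral\<^sup>N M2 h" by (simp add: \<open>M1 = M2\<close>)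
  finally show ?thesis using int_M2[of h] by simp
qed

lemma obs_filtration_upd_measurable:
  "(\<lambda>(\<omega>, y). fun_upd \<omega> n y) \<in> obs_filtration \<mu> n \<Otimes>\<^sub>M \<mu> \<rightarrow>\<^sub>M obs_filtration \<mu> (Suc n)"
proof (rule measurable_obs_filtrationI)
  show "(\<lambda>x. (case x of (\<omega>, y) \<Rightarrow> fun_upd \<omega> n y) i) \<in> obs_filtration \<mu> n \<Otimes>\<^sub>M \<mu> \<rightarrow>\<^sub>M \<mu>" if "i < Suc n" for i
    using that by (cases "i = n")
      (auto simp: case_prod_unfold intro!: measurable_compose[OF measurable_fst] measurable_obs_filtration_coord)
qed (auto simp: space_pair_measure space_obs_space)

lemma obs_filtration_upd_comp:
  assumes "F \<in> borel_measurable (obs_filtration \<mu> (Suc n))"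
  shows "(\<lambda>(\<omega>, y). F (fun_upd \<omega> n y)) \<in> borel_measurable (obs_filtration \<mu> n \<Otimes>\<^sub>M \<mu>)"
  using measurable_compose[OF obs_filtration_upd_measurable assms] by (simp add: case_prod_beta' del: fun_upd_apply)

lemma obs_upd_measurable: "(\<lambda>(\<omega>, y). fun_upd \<omega> n y) \<in> obs_space \<mu> \<Otimes>\<^sub>M \<mu> \<rightarrow>\<^sub>M obs_space \<mu>"
proof (rule measurable_obs_spaceI)
  show "(\<lambda>x. (case x of (\<omega>, y) \<Rightarrow> fun_upd \<omega> n y) i) \<in> obs_space \<mu> \<Otimes>\<^sub>M \<mu> \<rightarrow>\<^sub>M \<mu>" for i
    by (cases "i = n")
       (auto simp: case_prod_unfold intro!: measurable_compose[OF measurable_fst] measurable_obs_coord)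
qed

lemma obs_upd_space: "\<omega> \<in> space (obs_space \<mu>) \<Longrightarrow> y \<in> space \<mu> \<Longrightarrow> fun_upd \<omega> n y \<in> space (obs_space \<mu>)"
  by (auto simp: space_obs_space)

lemma obs_upd_comp:
  assumes "F \<in> borel_measurable (obs_space \<mu>)"
  shows "(\<lambda>(\<omega>, y). F (fun_upd \<omega> n y)) \<in> borel_measurable (obs_space \<mu> \<Otimes>\<^sub>M \<mu>)"
  using measurable_compose[OF obs_upd_measurable assms] by (simp add: case_prod_beta')

text \<open>
  The form in which the step is iterated: a function of the first \<open>n + 1\<close> observations is replaced by
  one of the first \<open>n\<close>.
\<close>

lemma process_law_integral_Suc:
  assumes Q: "Q \<in> process_laws \<mu> \<xi> q \<theta>" and "sigma_finite_measure \<mu>"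
    and density_families: "density_family \<mu> MT q"
    and \<xi>: "(\<lambda>(\<theta>, x). \<xi> \<theta> x) \<in> MT \<Otimes>\<^sub>M \<mu> \<rightarrow>\<^sub>M MT" and \<theta>: "\<theta> \<in> space MT"
    and F: "F \<in> borel_measurable (obs_filtration \<mu> (Suc n))"
  shows "(\<integral>\<^sup>+\<omega>. F \<omega> \<partial>Q) =
    (\<integral>\<^sup>+\<omega>. \<integral>\<^sup>+y. ennreal (q (stat_seq \<xi> \<theta> \<omega> n) y) * F (fun_upd \<omega> n y) \<partial>\<mu> \<partial>Q)"
proof -
  from process_law_step[OF assms(1-5) obs_filtration_upd_comp[OF F]] show ?thesis by simp
qed

section \<open>Decision costs\<close>

lemma ennreal_min: "ennreal (min a b) = min (ennreal a) (ennreal b)"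
  by (rule min_of_mono[symmetric]) (auto simp: mono_def ennreal_leI)

lemma borel_measurable_vecI:
  fixes f :: "'a \<Rightarrow> real ^ 'n"
  assumes "\<And>i. (\<lambda>x. f x $ i) \<in> borel_measurable M"
  shows "f \<in> borel_measurable M"
  by (subst borel_measurable_euclidean_space) (auto simp: Basis_vec_def inner_axis assms)

lemma nonneg_vecsD: "z \<in> nonneg_vecs \<Longrightarrow> 0 \<le> z $ i"
  by (simp add: nonneg_vecs_def)

lemma space_orthant [simp]: "space (restrict_space borel nonneg_vecs) = nonneg_vecs"
  by (simp add: space_restrict_space)

lemma measurable_nonneg_vecsI:
  fixes f :: "'a \<Rightarrow> real ^ 'n"
  assumes "\<And>i. (\<lambda>x. f x $ i) \<in> borel_measurable M" "\<And>x. x \<in> space M \<Longrightarrow> f x \<in> nonneg_vecs"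
  shows "f \<in> M \<rightarrow>\<^sub>M restrict_space borel nonneg_vecs"
  using assms by (intro measurable_restrict_space2 borel_measurable_vecI) auto

lemma measurable_nonneg_vecs_nth:
  fixes f :: "'a \<Rightarrow> real ^ 'n"
  assumes "f \<in> M \<rightarrow>\<^sub>M restrict_space borel nonneg_vecs"
  shows "(\<lambda>x. f x $ i) \<in> borel_measurable M"
  using measurable_compose[OF assms measurable_restrict_space1[OF borel_measurable_nth]] .

lemma G_cost_add: "G_cost lam k (z + z') = G_cost lam k z + G_cost lam k z'"
  by (simp add: G_cost_def sum.distrib algebra_simps)

lemma G_cost_scaleR: "G_cost lam k (s *\<^sub>R z) = s * G_cost lam k z"
  by (simp add: G_cost_def sum_distrib_left mult_ac)

lemma g_cost_le: "g_cost lam z \<le> G_cost lam k z"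
  by (simp add: g_cost_def)

lemma g_cost_attained: "\<exists>k. G_cost lam k z = g_cost lam z"
proof -
  have "Min (range (\<lambda>k. G_cost lam k z)) \<in> range (\<lambda>k. G_cost lam k z)"
    by (rule Min_in) auto
  then show ?thesis unfolding g_cost_def by (metis imageE)
qed

lemma le_g_cost_iff: "x \<le> g_cost lam z \<longleftrightarrow> (\<forall>k. x \<le> G_cost lam k z)"
  by (simp add: g_cost_def)

text \<open>
  The cost of stopping in \<open>z\<close> and deciding according to the probability vector \<open>d\<close>. It is the
  \<open>d\<close>-average of the decision costs \<open>G_cost\<close>, which is how it is compared with their minimum.
\<close>

definition error_cost :: "('k::finite \<Rightarrow> real) \<Rightarrow> real ^ 'k option \<Rightarrow> ('k \<Rightarrow> real) \<Rightarrow> real" where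
  "error_cost lam z d = (\<Sum>k\<in>UNIV. lam k * z $ Some k * (1 - d k))"

lemma error_cost_eq:
  assumes "(\<Sum>k\<in>UNIV. d k) = 1"
  shows "error_cost lam z d = (\<Sum>k\<in>UNIV. d k * G_cost lam k z)"
proof -
  define S where "S = (\<Sum>i\<in>UNIV. lam i * z $ Some i)"
  have "(\<Sum>k\<in>UNIV. d k * G_cost lam k z) = (\<Sum>k\<in>UNIV. d k * (S - lam k * z $ Some k))"
    unfolding G_cost_def S_def by (intro sum.cong refl arg_cong2[where f="(*)"]) (simp add: sum_diff1)
  also have "\<dots> = S - (\<Sum>k\<in>UNIV. d k * (lam k * z $ Some k))"
    using assms by (simp add: right_diff_distrib sum_subtractf sum_distrib_right[symmetric])
  also have "\<dots> = error_cost lam z d"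
    unfolding error_cost_def S_def by (simp add: algebra_simps sum_subtractf)
  finally show ?thesis by simp
qed

lemma g_cost_le_error_cost:
  assumes "(\<Sum>k\<in>UNIV. d k) = 1" "\<And>k. 0 \<le> d k"
  shows "g_cost lam z \<le> error_cost lam z d"
proof -
  have "g_cost lam z = (\<Sum>k\<in>UNIV. d k * g_cost lam z)"
    using assms(1) by (simp add: sum_distrib_right[symmetric])
  also have "\<dots> \<le> (\<Sum>k\<in>UNIV. d k * G_cost lam k z)"
    using assms(2) by (intro sum_mono mult_left_mono g_cost_le) auto
  finally show ?thesis using error_cost_eq[OF assms(1)] by metis
qed

lemma error_cost_eq_g_cost:
  assumes "(\<Sum>k\<in>UNIV. d k) = 1" "\<And>k. G_cost lam k z \<noteq> g_cost lam z \<Longrightarrow> d k = 0"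
  shows "error_cost lam z d = g_cost lam z"
proof -
  have "error_cost lam z d = (\<Sum>k\<in>UNIV. d k * g_cost lam z)"
    unfolding error_cost_eq[OF assms(1)] using assms(2) by (intro sum.cong) auto
  then show ?thesis using assms(1) by (simp add: sum_distrib_right[symmetric])
qed

section \<open>The cost equation and value iteration\<close>

text \<open>
  The hypotheses of the theorem without the actual start of the statistic: all results hold for
  every start \<open>\<theta>\<close>.
\<close>

locale sequential_test = sigma_finite_measure \<mu>
  for \<mu> :: "'x measure" +
  fixes MT :: "'t measure"
    and \<xi> :: "'t \<Rightarrow> 'x \<Rightarrow> 't"
    and p :: "'k::finite option \<Rightarrow> 't \<Rightarrow> 'x \<Rightarrow> real"
    and P :: "'k option \<Rightarrow> 't \<Rightarrow> (nat \<Rightarrow> 'x) measure"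
    and lam :: "'k \<Rightarrow> real"
    and \<rho> :: "real ^ 'k option \<Rightarrow> 't \<Rightarrow> real"
  assumes xi_measurable: "(\<lambda>(\<theta>, x). \<xi> \<theta> x) \<in> MT \<Otimes>\<^sub>M \<mu> \<rightarrow>\<^sub>M MT"
    and density_families: "\<And>i. density_family \<mu> MT (p i)"
    and process_law: "\<And>i \<theta>. \<theta> \<in> space MT \<Longrightarrow> P i \<theta> \<in> process_laws \<mu> \<xi> (p i) \<theta>"
    and lam_nonneg: "\<And>k. 0 \<le> lam k"
    and cost: "is_cost_function \<mu> MT \<xi> p lam \<rho>"
begin

abbreviation orthant :: "(real ^ 'k option) measure" where
  "orthant \<equiv> restrict_space borel nonneg_vecs"

abbreviation upd :: "real ^ 'k option \<Rightarrow> 't \<Rightarrow> 'x \<Rightarrow> real ^ 'k option" where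
  "upd z \<theta> x \<equiv> vec_mult z (\<lambda>i. p i \<theta> x)"

abbreviation g :: "real ^ 'k option \<Rightarrow> real" where
  "g \<equiv> g_cost lam"

abbreviation cont :: "real ^ 'k option \<Rightarrow> 't \<Rightarrow> real" where
  "cont \<equiv> cont_cost \<mu> \<xi> p \<rho>"

lemma xi_measurable_comp [measurable (raw)]:
  assumes "t \<in> M \<rightarrow>\<^sub>M MT" "y \<in> M \<rightarrow>\<^sub>M \<mu>"
  shows "(\<lambda>w. \<xi> (t w) (y w)) \<in> M \<rightarrow>\<^sub>M MT"
  using measurable_compose[OF measurable_Pair[OF assms] xi_measurable] by simp

lemma density_measurable_comp [measurable (raw)]:
  assumes "t \<in> M \<rightarrow>\<^sub>M MT" "y \<in> M \<rightarrow>\<^sub>M \<mu>"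
  shows "(\<lambda>w. p i (t w) (y w)) \<in> borel_measurable M"
proof -
  have "(\<lambda>(\<theta>, x). p i \<theta> x) \<in> borel_measurable (MT \<Otimes>\<^sub>M \<mu>)"
    using density_families by (simp add: density_family_def)
  from measurable_compose[OF measurable_Pair[OF assms] this] show ?thesis by simp
qed

lemma xi_space: "\<theta> \<in> space MT \<Longrightarrow> x \<in> space \<mu> \<Longrightarrow> \<xi> \<theta> x \<in> space MT"
  using measurable_space[OF xi_measurable, of "(\<theta>, x)"] by (simp add: space_pair_measure)

lemma p_nonneg: "\<theta> \<in> space MT \<Longrightarrow> x \<in> space \<mu> \<Longrightarrow> 0 \<le> p i \<theta> x"
  using density_families by (auto simp: density_family_def)

lemma p_integral:
  assumes "\<theta> \<in> space MT"
  shows "(\<integral>\<^sup>+x. ennreal (p i \<theta> x) \<partial>\<mu>) = 1"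
proof -
  have "prob_space (density \<mu> (\<lambda>x. ennreal (p i \<theta> x)))"
    using density_families assms by (simp add: density_family_def)
  from prob_space.emeasure_space_1[OF this] have "emeasure (density \<mu> (\<lambda>x. ennreal (p i \<theta> x))) (space \<mu>) = 1"
    by simp
  moreover have "(\<lambda>x. ennreal (p i \<theta> x)) \<in> borel_measurable \<mu>"
    using assms by measurable
  ultimately show ?thesis
    by (subst (asm) emeasure_density) (auto cong: nn_integral_cong)
qed

lemma space_mu_nonempty: "\<theta> \<in> space MT \<Longrightarrow> space \<mu> \<noteq> {}"
  using p_integral[of \<theta> None] nn_integral_empty[of \<mu>] by force

lemma upd_nonneg: "z \<in> nonneg_vecs \<Longrightarrow> \<theta> \<in> space MT \<Longrightarrow> x \<in> space \<mu> \<Longrightarrow> upd z \<theta> x \<in> nonneg_vecs"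
  using p_nonneg by (auto simp: nonneg_vecs_def vec_mult_def)

lemma upd_measurable [measurable (raw)]:
  assumes f: "f \<in> M \<rightarrow>\<^sub>M orthant" and t [measurable]: "t \<in> M \<rightarrow>\<^sub>M MT" and y [measurable]: "y \<in> M \<rightarrow>\<^sub>M \<mu>"
  shows "(\<lambda>w. upd (f w) (t w) (y w)) \<in> M \<rightarrow>\<^sub>M orthant"
proof (rule measurable_nonneg_vecsI)
  note [measurable] = measurable_nonneg_vecs_nth[OF f]
  show "(\<lambda>w. upd (f w) (t w) (y w) $ i) \<in> borel_measurable M" for i
    unfolding vec_mult_def by simp
  show "upd (f x) (t x) (y x) \<in> nonneg_vecs" if "x \<in> space M" for x
    using that measurable_space[OF f, of x] measurable_space[OF t, of x] measurable_space[OF y, of x]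
    by (auto intro!: upd_nonneg)
qed

lemma G_measurable [measurable (raw)]:
  assumes f: "f \<in> M \<rightarrow>\<^sub>M orthant"
  shows "(\<lambda>w. G_cost lam k (f w)) \<in> borel_measurable M"
  unfolding G_cost_def using measurable_nonneg_vecs_nth[OF f] by measurable

lemma g_measurable [measurable (raw)]:
  assumes f: "f \<in> M \<rightarrow>\<^sub>M orthant"
  shows "(\<lambda>w. g (f w)) \<in> borel_measurable M"
proof -
  have "(\<lambda>w. Min ((\<lambda>k. G_cost lam k (f w)) ` UNIV)) \<in> borel_measurable M"
    using G_measurable[OF f] by (intro borel_measurable_Min) auto
  then show ?thesis by (simp add: g_cost_def)
qed

lemma solves: "solves_cost_equation \<mu> MT \<xi> p lam \<rho>"
  using cost by (simp add: is_cost_function_def)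

lemma rho_measurable [measurable (raw)]:
  assumes "f \<in> M \<rightarrow>\<^sub>M orthant" "t \<in> M \<rightarrow>\<^sub>M MT"
  shows "(\<lambda>w. \<rho> (f w) (t w)) \<in> borel_measurable M"
proof -
  have "(\<lambda>(z, \<theta>). \<rho> z \<theta>) \<in> borel_measurable (orthant \<Otimes>\<^sub>M MT)"
    using solves by (simp add: solves_cost_equation_def rho_space_def)
  from measurable_compose[OF measurable_Pair[OF assms] this] show ?thesis by simp
qed

lemma rho_nonneg: "z \<in> nonneg_vecs \<Longrightarrow> \<theta> \<in> space MT \<Longrightarrow> 0 \<le> \<rho> z \<theta>"
  using solves unfolding solves_cost_equation_def by blast

lemma rho_eq: "z \<in> nonneg_vecs \<Longrightarrow> \<theta> \<in> space MT \<Longrightarrow> \<rho> z \<theta> = min (g z) (cont z \<theta>)"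
  using solves unfolding solves_cost_equation_def by blast

lemma G_nonneg: "z \<in> nonneg_vecs \<Longrightarrow> 0 \<le> G_cost lam k z"
  unfolding G_cost_def by (intro sum_nonneg mult_nonneg_nonneg) (auto simp: lam_nonneg nonneg_vecsD)

lemma g_nonneg: "z \<in> nonneg_vecs \<Longrightarrow> 0 \<le> g z"
  using G_nonneg by (simp add: le_g_cost_iff)

text \<open>
  The cost of continuing is defined by a Bochner integral. A nonnegative function below \<open>g\<close> has an
  integrable composition with the update, since \<open>g\<close> grows at most linearly and the densities integrate to one; from here
  on only nonnegative integrals are needed. The lemma is stated for general \<open>f\<close> because it is also applied
  to the limit of value iteration before that limit is known to be \<open>\<rho>\<close>.
\<close>

lemma cont_cost_eq:
  assumes m: "(\<lambda>(z, \<theta>). f z \<theta>) \<in> borel_measurable (orthant \<Otimes>\<^sub>M MT)"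
    and f: "\<And>z \<theta>. z \<in> nonneg_vecs \<Longrightarrow> \<theta> \<in> space MT \<Longrightarrow> 0 \<le> f z \<theta> \<and> f z \<theta> \<le> g z"
    and z: "z \<in> nonneg_vecs" and \<theta> [measurable]: "\<theta> \<in> space MT"
  shows "ennreal (cont_cost \<mu> \<xi> p f z \<theta>) = ennreal (z $ None) + (\<integral>\<^sup>+x. ennreal (f (upd z \<theta> x) (\<xi> \<theta> x)) \<partial>\<mu>)"
    and "0 \<le> cont_cost \<mu> \<xi> p f z \<theta>"
proof -
  have [measurable]: "z \<in> space orthant" using z by simp
  have [measurable]: "(\<lambda>x. f (upd z \<theta> x) (\<xi> \<theta> x)) \<in> borel_measurable \<mu>"
  proof -
    have "(\<lambda>x. (upd z \<theta> x, \<xi> \<theta> x)) \<in> \<mu> \<rightarrow>\<^sub>M orthant \<Otimes>\<^sub>M MT" by measurable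
    from measurable_compose[OF this m] show ?thesis by simp
  qed
  define b where "b x = (\<Sum>k\<in>UNIV. lam k * z $ Some k * p (Some k) \<theta> x)" for x
  have [measurable]: "b \<in> borel_measurable \<mu>" unfolding b_def by measurable
  have nn: "0 \<le> f (upd z \<theta> x) (\<xi> \<theta> x)" if "x \<in> space \<mu>" for x
    using f that upd_nonneg[OF z \<theta> that] xi_space[OF \<theta> that] by blast
  have fb: "f (upd z \<theta> x) (\<xi> \<theta> x) \<le> b x" if "x \<in> space \<mu>" for x
  proof -
    have "f (upd z \<theta> x) (\<xi> \<theta> x) \<le> G_cost lam (SOME k. True) (upd z \<theta> x)"
      using f[OF upd_nonneg[OF z \<theta> that] xi_space[OF \<theta> that]] g_cost_le order_trans by blast
    also have "\<dots> \<le> b x"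
      unfolding G_cost_def b_def vec_mult_def using lam_nonneg z p_nonneg[OF \<theta> that]
      by (auto intro!: sum_mono2 mult_nonneg_nonneg simp: nonneg_vecsD mult_ac)
    finally show ?thesis .
  qed
  have "(\<integral>\<^sup>+x. ennreal (b x) \<partial>\<mu>) = (\<integral>\<^sup>+x. (\<Sum>k\<in>UNIV. ennreal (lam k * z $ Some k) * ennreal (p (Some k) \<theta> x)) \<partial>\<mu>)"
  proof (rule nn_integral_cong)
    fix x assume "x \<in> space \<mu>"
    then show "ennreal (b x) = (\<Sum>k\<in>UNIV. ennreal (lam k * z $ Some k) * ennreal (p (Some k) \<theta> x))"
      unfolding b_def using lam_nonneg z p_nonneg[OF \<theta>]
      by (auto simp: ennreal_mult'[symmetric] sum_ennreal nonneg_vecsD)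
  qed
  also have "\<dots> = (\<Sum>k\<in>UNIV. ennreal (lam k * z $ Some k) * (\<integral>\<^sup>+x. ennreal (p (Some k) \<theta> x) \<partial>\<mu>))"
    by (subst nn_integral_sum) (auto simp: nn_integral_cmult)
  also have "\<dots> < \<infinity>" by (simp add: p_integral[OF \<theta>] less_top[symmetric])
  finally have fin: "(\<integral>\<^sup>+x. ennreal (b x) \<partial>\<mu>) < \<infinity>" .
  have "(\<integral>\<^sup>+x. ennreal (f (upd z \<theta> x) (\<xi> \<theta> x)) \<partial>\<mu>) \<le> (\<integral>\<^sup>+x. ennreal (b x) \<partial>\<mu>)"
    by (intro nn_integral_mono ennreal_leI fb)
  also note fin
  finally have "integrable \<mu> (\<lambda>x. f (upd z \<theta> x) (\<xi> \<theta> x))"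
    using nn by (intro integrableI_nonneg AE_I2) auto
  then have "(\<integral>\<^sup>+x. ennreal (f (upd z \<theta> x) (\<xi> \<theta> x)) \<partial>\<mu>) = ennreal (LINT x|\<mu>. f (upd z \<theta> x) (\<xi> \<theta> x))"
    using nn by (intro nn_integral_eq_integral AE_I2) auto
  moreover have i: "0 \<le> (LINT x|\<mu>. f (upd z \<theta> x) (\<xi> \<theta> x))"
    using nn by (intro integral_nonneg_AE AE_I2) auto
  ultimately show "ennreal (cont_cost \<mu> \<xi> p f z \<theta>) = ennreal (z $ None) + (\<integral>\<^sup>+x. ennreal (f (upd z \<theta> x) (\<xi> \<theta> x)) \<partial>\<mu>)"
    using z by (simp add: cont_cost_def nonneg_vecsD)
  show "0 \<le> cont_cost \<mu> \<xi> p f z \<theta>"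
    using z i by (simp add: cont_cost_def nonneg_vecsD)
qed

lemma rho_le_g: "z \<in> nonneg_vecs \<Longrightarrow> \<theta> \<in> space MT \<Longrightarrow> \<rho> z \<theta> \<le> g z"
  by (simp add: rho_eq)

lemma
  assumes z: "z \<in> nonneg_vecs" and \<theta>: "\<theta> \<in> space MT"
  shows cont_eq: "ennreal (cont z \<theta>) = ennreal (z $ None) + (\<integral>\<^sup>+x. ennreal (\<rho> (upd z \<theta> x) (\<xi> \<theta> x)) \<partial>\<mu>)"
    and cont_nonneg: "0 \<le> cont z \<theta>"
proof -
  have m: "(\<lambda>(z, \<theta>). \<rho> z \<theta>) \<in> borel_measurable (orthant \<Otimes>\<^sub>M MT)"
    by measurable
  have b: "0 \<le> \<rho> z \<theta> \<and> \<rho> z \<theta> \<le> g z" if "z \<in> nonneg_vecs" "\<theta> \<in> space MT" for z \<theta>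
    using rho_nonneg[OF that] rho_le_g[OF that] by simp
  show "ennreal (cont z \<theta>) = ennreal (z $ None) + (\<integral>\<^sup>+x. ennreal (\<rho> (upd z \<theta> x) (\<xi> \<theta> x)) \<partial>\<mu>)"
    and "0 \<le> cont z \<theta>"
    using cont_cost_eq[OF m b z \<theta>] by auto
qed

lemma cont_measurable [measurable (raw)]:
  assumes f [measurable]: "f \<in> M \<rightarrow>\<^sub>M orthant" and t [measurable]: "t \<in> M \<rightarrow>\<^sub>M MT"
  shows "(\<lambda>w. cont (f w) (t w)) \<in> borel_measurable M"
proof -
  note [measurable] = measurable_nonneg_vecs_nth[OF f]
  show ?thesis unfolding cont_cost_def by measurable
qed

text \<open>
  Value iteration: the least cost of a test that is charged for its first \<open>n\<close> stages only.
\<close>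

primrec cost_iter :: "nat \<Rightarrow> real ^ 'k option \<Rightarrow> 't \<Rightarrow> ennreal" where
  "cost_iter 0 = (\<lambda>z \<theta>. 0)"
| "cost_iter (Suc n) = (\<lambda>z \<theta>. min (ennreal (g z))
     (ennreal (z $ None) + (\<integral>\<^sup>+x. cost_iter n (upd z \<theta> x) (\<xi> \<theta> x) \<partial>\<mu>)))"

text \<open>
  The induction runs over functions on one fixed product space, because the step integrates over a
  parameter space of a different type; arbitrary compositions follow.
\<close>

lemma cost_iter_measurable_pair: "(\<lambda>w. cost_iter n (fst w) (snd w)) \<in> borel_measurable (orthant \<Otimes>\<^sub>M MT)"
proof (induction n)
  case (Suc n)
  have [measurable]: "(\<lambda>w. fst w $ i) \<in> borel_measurable (orthant \<Otimes>\<^sub>M MT)" for i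
    by (rule measurable_nonneg_vecs_nth) measurable
  have "(\<lambda>q. (upd (fst (fst q)) (snd (fst q)) (snd q), \<xi> (snd (fst q)) (snd q)))
      \<in> (orthant \<Otimes>\<^sub>M MT) \<Otimes>\<^sub>M \<mu> \<rightarrow>\<^sub>M orthant \<Otimes>\<^sub>M MT"
    by measurable
  from measurable_compose[OF this Suc.IH]
  have "(\<lambda>(w, x). cost_iter n (upd (fst w) (snd w) x) (\<xi> (snd w) x)) \<in> borel_measurable ((orthant \<Otimes>\<^sub>M MT) \<Otimes>\<^sub>M \<mu>)"
    by (simp add: case_prod_unfold)
  from borel_measurable_nn_integral[OF this] show ?case by simp
qed simp

lemma cost_iter_measurable [measurable (raw)]:
  assumes "f \<in> M \<rightarrow>\<^sub>M orthant" "t \<in> M \<rightarrow>\<^sub>M MT"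
  shows "(\<lambda>w. cost_iter n (f w) (t w)) \<in> borel_measurable M"
  using measurable_compose[OF measurable_Pair[OF assms] cost_iter_measurable_pair] by simp

lemma cost_iter_le_rho:
  "z \<in> nonneg_vecs \<Longrightarrow> \<theta> \<in> space MT \<Longrightarrow> cost_iter n z \<theta> \<le> ennreal (\<rho> z \<theta>)"
proof (induction n arbitrary: z \<theta>)
  case (Suc n)
  have eq: "ennreal (\<rho> z \<theta>) = min (ennreal (g z)) (ennreal (cont z \<theta>))"
    using Suc.prems by (simp add: rho_eq ennreal_min)
  have "(\<integral>\<^sup>+x. cost_iter n (upd z \<theta> x) (\<xi> \<theta> x) \<partial>\<mu>) \<le> (\<integral>\<^sup>+x. ennreal (\<rho> (upd z \<theta> x) (\<xi> \<theta> x)) \<partial>\<mu>)"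
    using Suc by (intro nn_integral_mono Suc.IH upd_nonneg xi_space) auto
  then show ?case
    unfolding eq cost_iter.simps cont_eq[OF Suc.prems] by (intro min.mono add_mono order_refl)
qed simp

lemma cost_iter_Suc_mono:
  "z \<in> nonneg_vecs \<Longrightarrow> \<theta> \<in> space MT \<Longrightarrow> cost_iter n z \<theta> \<le> cost_iter (Suc n) z \<theta>"
proof (induction n arbitrary: z \<theta>)
  case (Suc n)
  have "(\<integral>\<^sup>+x. cost_iter n (upd z \<theta> x) (\<xi> \<theta> x) \<partial>\<mu>) \<le> (\<integral>\<^sup>+x. cost_iter (Suc n) (upd z \<theta> x) (\<xi> \<theta> x) \<partial>\<mu>)"
    using Suc.prems by (intro nn_integral_mono Suc.IH upd_nonneg xi_space) auto
  then show ?case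
    unfolding cost_iter.simps(2)[of "Suc n"] cost_iter.simps(2)[of n] by (intro min.mono add_mono) auto
qed simp

text \<open>
  The iterates increase and stay below every solution of the cost equation. By monotone convergence
  their supremum is itself a solution, so the least solution cannot lie above it.
\<close>

lemma rho_eq_SUP_cost_iter:
  assumes z: "z \<in> nonneg_vecs" and \<theta>: "\<theta> \<in> space MT"
  shows "ennreal (\<rho> z \<theta>) = (SUP n. cost_iter n z \<theta>)"
proof (rule antisym)
  show "(SUP n. cost_iter n z \<theta>) \<le> ennreal (\<rho> z \<theta>)"
    by (intro SUP_least cost_iter_le_rho z \<theta>)
next
  define s where "s z \<theta> = (SUP n. cost_iter n z \<theta>)" for z \<theta>
  \<comment> \<open>the real-valued limit of the iterates is a competitor in the minimality of \<open>\<rho>\<close>\<close>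
  define f where "f z \<theta> = enn2real (s z \<theta>)" for z \<theta>
  have s_le: "s z \<theta> \<le> ennreal (g z)" if "z \<in> nonneg_vecs" "\<theta> \<in> space MT" for z \<theta>
    unfolding s_def using cost_iter_le_rho[OF that] rho_le_g[OF that]
    by (intro SUP_least) (meson ennreal_leI order_trans)
  have sf: "s z \<theta> = ennreal (f z \<theta>)" if "z \<in> nonneg_vecs" "\<theta> \<in> space MT" for z \<theta>
    using le_less_trans[OF s_le[OF that] ennreal_less_top] by (simp add: f_def)
  have f_bounds: "0 \<le> f z \<theta> \<and> f z \<theta> \<le> g z" if "z \<in> nonneg_vecs" "\<theta> \<in> space MT" for z \<theta>
  proof -
    have "0 \<le> f z \<theta>" by (simp add: f_def)
    moreover have "ennreal (f z \<theta>) \<le> ennreal (g z)" using s_le[OF that] by (simp only: sf[OF that])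
    ultimately show ?thesis using g_nonneg[OF that(1)] by simp
  qed
  have f_meas: "(\<lambda>(z, \<theta>). f z \<theta>) \<in> borel_measurable (orthant \<Otimes>\<^sub>M MT)"
    unfolding f_def s_def by measurable
  have s_lim: "(\<lambda>n. cost_iter n z \<theta>) \<longlonglongrightarrow> s z \<theta>" if "z \<in> nonneg_vecs" "\<theta> \<in> space MT" for z \<theta>
    unfolding s_def by (intro LIMSEQ_SUP incseq_SucI cost_iter_Suc_mono that)
  have f_eq: "f z \<theta> = min (g z) (cont_cost \<mu> \<xi> p f z \<theta>)" if z: "z \<in> nonneg_vecs" and \<theta> [measurable]: "\<theta> \<in> space MT" for z \<theta>
  proof -
    have [measurable]: "z \<in> space orthant" using z by simp
    have int_s: "(\<integral>\<^sup>+x. s (upd z \<theta> x) (\<xi> \<theta> x) \<partial>\<mu>) = (SUP n. \<integral>\<^sup>+x. cost_iter n (upd z \<theta> x) (\<xi> \<theta> x) \<partial>\<mu>)"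
      unfolding s_def
      by (intro nn_integral_monotone_convergence_SUP_AE AE_I2 cost_iter_Suc_mono upd_nonneg xi_space z \<theta>) auto
    have inc: "incseq (\<lambda>n. \<integral>\<^sup>+x. cost_iter n (upd z \<theta> x) (\<xi> \<theta> x) \<partial>\<mu>)"
      by (intro incseq_SucI nn_integral_mono cost_iter_Suc_mono upd_nonneg xi_space z \<theta>) auto
    have "(\<lambda>n. \<integral>\<^sup>+x. cost_iter n (upd z \<theta> x) (\<xi> \<theta> x) \<partial>\<mu>) \<longlonglongrightarrow> (\<integral>\<^sup>+x. s (upd z \<theta> x) (\<xi> \<theta> x) \<partial>\<mu>)"
      unfolding int_s by (rule LIMSEQ_SUP[OF inc])
    then have "(\<lambda>n. cost_iter (Suc n) z \<theta>) \<longlonglongrightarrow>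
        min (ennreal (g z)) (ennreal (z $ None) + (\<integral>\<^sup>+x. s (upd z \<theta> x) (\<xi> \<theta> x) \<partial>\<mu>))"
      by (auto intro!: tendsto_min tendsto_add)
    moreover have "(\<lambda>n. cost_iter (Suc n) z \<theta>) \<longlonglongrightarrow> s z \<theta>"
      by (rule LIMSEQ_Suc[OF s_lim[OF z \<theta>]])
    ultimately have "s z \<theta> = min (ennreal (g z)) (ennreal (z $ None) + (\<integral>\<^sup>+x. s (upd z \<theta> x) (\<xi> \<theta> x) \<partial>\<mu>))"
      by (rule LIMSEQ_unique[symmetric])
    also have "(\<integral>\<^sup>+x. s (upd z \<theta> x) (\<xi> \<theta> x) \<partial>\<mu>) = (\<integral>\<^sup>+x. ennreal (f (upd z \<theta> x) (\<xi> \<theta> x)) \<partial>\<mu>)"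
      by (intro nn_integral_cong sf upd_nonneg xi_space z \<theta>)
    also have "ennreal (z $ None) + \<dots> = ennreal (cont_cost \<mu> \<xi> p f z \<theta>)"
      by (rule cont_cost_eq(1)[OF f_meas f_bounds z \<theta>, symmetric])
    finally show ?thesis
      using sf[OF z \<theta>] f_bounds[OF z \<theta>] cont_cost_eq(2)[OF f_meas f_bounds z \<theta>] g_nonneg[OF z]
      by (simp add: ennreal_min[symmetric])
  qed
  have "solves_cost_equation \<mu> MT \<xi> p lam f"
    unfolding solves_cost_equation_def rho_space_def using f_meas f_bounds f_eq by blast
  then have "\<rho> z \<theta> \<le> f z \<theta>"
    using cost z \<theta> by (simp add: is_cost_function_def)
  then show "ennreal (\<rho> z \<theta>) \<le> (SUP n. cost_iter n z \<theta>)"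
    using sf[OF z \<theta>] unfolding s_def by (simp add: ennreal_leI)
qed

text \<open>
  Without a weight on hypothesis \<open>0\<close> observations are free, and a test that never stops makes no error.
  In terms of value iteration, all iterates vanish.
\<close>

lemma rho_eq_0:
  assumes "z \<in> nonneg_vecs" "\<theta> \<in> space MT" "z $ None = 0"
  shows "\<rho> z \<theta> = 0"
proof -
  have "cost_iter n z \<theta> = 0" for n
    using assms
  proof (induction n arbitrary: z \<theta>)
    case (Suc n)
    have "(\<integral>\<^sup>+x. cost_iter n (upd z \<theta> x) (\<xi> \<theta> x) \<partial>\<mu>) = (\<integral>\<^sup>+x. 0 \<partial>\<mu>)"
      using Suc.prems by (intro nn_integral_cong Suc.IH upd_nonneg xi_space) (auto simp: vec_mult_def)
    then show ?case using Suc.prems by simp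
  qed simp
  then have "ennreal (\<rho> z \<theta>) = 0" using rho_eq_SUP_cost_iter[OF assms(1,2)] by simp
  then show ?thesis using rho_nonneg[OF assms(1,2)] by simp
qed

end

section \<open>Expected stopping times and dependence on finitely many observations\<close>

lemma sum_option: "(\<Sum>i\<in>UNIV. f i) = f None + (\<Sum>k\<in>UNIV. f (Some k))" for f :: "'k::finite option \<Rightarrow> 'b::comm_monoid_add"
  by (simp add: UNIV_option_conv sum.reindex)

lemma ennreal_suminf_swap:
  fixes f :: "nat \<Rightarrow> nat \<Rightarrow> ennreal"
  shows "(\<Sum>n. \<Sum>m. f n m) = (\<Sum>m. \<Sum>n. f n m)"
  using nn_integral_suminf[of "\<lambda>m n. f n m" "count_space UNIV"] by (simp add: nn_integral_count_space_nat)

text \<open>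
  The formula \<open>E[\<tau>] = \<Sum>\<^sub>n P(\<tau> > n)\<close> for a stopping time that stops at \<open>n\<close> with probability \<open>s n\<close> and
  may be infinite with positive probability. In the latter case both sides are infinite.
\<close>

lemma tail_sum_formula:
  fixes s :: "nat \<Rightarrow> real"
  assumes s: "\<And>n. s n \<in> {0..1}"
  defines "c \<equiv> \<lambda>n. \<Prod>i<n. 1 - s i"
  shows "(\<Sum>n. of_nat n * ennreal (c n * s n)) + \<infinity> * (INF n. ennreal (c n)) = (\<Sum>n. ennreal (c (Suc n)))"
proof -
  have c01: "0 \<le> c n" "c n \<le> 1" for n
    unfolding c_def using s by (auto intro!: prod_nonneg prod_le_1)
  have cs: "c n * s n = c n - c (Suc n)" for n
    by (simp add: c_def algebra_simps)
  have stop_nonneg: "0 \<le> c n - c (Suc n)" for n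
    unfolding cs[symmetric] using c01 s by auto
  have dec: "decseq c"
    using stop_nonneg by (intro decseq_SucI) simp
  obtain L where L: "c \<longlonglongrightarrow> L" "\<And>i. L \<le> c i"
    using decseq_convergent[OF dec, of 0] c01 by metis
  have "0 \<le> L" using L(1) c01(1) by (meson LIMSEQ_le_const)
  have "(\<lambda>n. ennreal (c n)) \<longlonglongrightarrow> (INF n. ennreal (c n))"
    by (rule LIMSEQ_INF) (use dec in \<open>auto simp: decseq_def ennreal_leI\<close>)
  moreover have "(\<lambda>n. ennreal (c n)) \<longlonglongrightarrow> ennreal L" using L by simp
  ultimately have INF: "(INF n. ennreal (c n)) = ennreal L" by (rule LIMSEQ_unique)
  show ?thesis
  proof (cases "L = 0")
    case True
    have "of_nat n * ennreal (c n * s n) = (\<Sum>m. if m < n then ennreal (c n * s n) else 0)" for n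
    proof -
      have "(\<Sum>m. if m < n then ennreal (c n * s n) else 0) = (\<Sum>m<n. if m < n then ennreal (c n * s n) else 0)"
        by (rule suminf_finite) auto
      then show ?thesis by simp
    qed
    note weight = this
    have inner: "(\<Sum>n. if m < n then ennreal (c n * s n) else 0) = ennreal (c (Suc m))" for m
    proof -
      have part: "(\<Sum>n<m + k + 1. if m < n then c n * s n else 0) = c (Suc m) - c (m + k + 1)" for k
      proof (induction k)
        case 0
        then show ?case by (auto intro!: sum.neutral)
      next
        case (Suc k)
        then show ?case by (simp add: cs)
      qed
      have "(\<lambda>k. c (Suc m) - c (k + (m + 1))) \<longlonglongrightarrow> c (Suc m) - 0"
        using LIMSEQ_ignore_initial_segment[OF L(1), of "m + 1"] True by (intro tendsto_diff) auto
      then have "(\<lambda>k. \<Sum>n<k + (m + 1). if m < n then c n * s n else 0) \<longlonglongrightarrow> c (Suc m)"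
        using part by (simp add: add_ac)
      then have "(\<lambda>n. if m < n then c n * s n else 0) sums c (Suc m)"
        unfolding sums_def by (rule LIMSEQ_offset)
      then have "(\<lambda>n. ennreal (if m < n then c n * s n else 0)) sums ennreal (c (Suc m))"
        by (subst sums_ennreal) (auto simp: cs c01 intro: decseq_SucD[OF dec])
      then have "(\<Sum>n. ennreal (if m < n then c n * s n else 0)) = ennreal (c (Suc m))"
        by (rule sums_unique[symmetric])
      then show ?thesis by (simp add: if_distrib cong: if_cong)
    qed
    have "(\<Sum>n. of_nat n * ennreal (c n * s n)) = (\<Sum>m. \<Sum>n. if m < n then ennreal (c n * s n) else 0)"
      unfolding weight by (rule ennreal_suminf_swap)
    also have "\<dots> = (\<Sum>m. ennreal (c (Suc m)))"
      by (simp only: inner)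
    finally show ?thesis by (simp add: INF True)
  next
    case False
    then have "L > 0" using \<open>0 \<le> L\<close> by simp
    \<comment> \<open>with probability \<open>L > 0\<close> the test never stops\<close>
    have "(\<infinity>::ennreal) = \<infinity> * ennreal L" using \<open>L > 0\<close> by (simp add: ennreal_top_mult)
    also have "\<dots> = (\<Sum>n. ennreal L)"
      using \<open>L > 0\<close> by (simp add: nn_integral_count_space_nat[symmetric] ennreal_mult_top)
    also have "\<dots> \<le> (\<Sum>n. ennreal (c (Suc n)))"
      by (intro suminf_le ennreal_leI L) auto
    finally have "(\<Sum>n. ennreal (c (Suc n))) = \<infinity>" by (simp add: top_unique)
    moreover have "\<infinity> * ennreal L = \<infinity>" using \<open>L > 0\<close> by (simp add: ennreal_top_mult)
    ultimately show ?thesis by (simp add: INF)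
  qed
qed

text \<open>
  Expected times on one observation sequence, with \<open>A\<close> the condition under which one test stops and the other
  one continues with probability \<open>q\<close>. Once \<open>A\<close> holds it holds forever, so the second test takes
  an additional geometric number of steps.
\<close>

lemma suminf_absorbed_geometric:
  fixes A :: "nat \<Rightarrow> bool" and q :: real
  assumes A: "\<And>i. A i \<Longrightarrow> A (Suc i)"
  shows "(\<Sum>m. ennreal (\<Prod>i<Suc m. if A i then q else 1)) =
    (\<Sum>m. ennreal (\<Prod>i<Suc m. if A i then 0 else 1)) + (\<Sum>m. ennreal (q ^ Suc m))"
proof (cases "\<exists>i. A i")
  case False
  have "(\<Sum>m::nat. (1::ennreal)) = \<infinity>"
    by (simp add: nn_integral_count_space_nat[symmetric])
  then show ?thesis using False by simp
next
  case True
  define s where "s = (LEAST i. A i)"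
  have before: "\<not> A i" if "i < s" for i using that not_less_Least s_def by blast
  have at: "A s" unfolding s_def using True by (rule LeastI_ex)
  have after: "A (n + s)" for n by (induction n) (auto intro: A at)
  have prod: "(\<Prod>i<n + s. if A i then x else (1::real)) = x ^ n" for n x
  proof (induction n)
    case 0
    then show ?case using before by (auto intro!: prod.neutral)
  next
    case (Suc n)
    then show ?case using after[of n] by simp
  qed
  have shift: "(\<Prod>i<Suc (n + s). if A i then x else (1::real)) = x ^ Suc n" for n x
    using prod[where n = "Suc n" and x = x] by simp
  have sums: "(\<Sum>m. ennreal (\<Prod>i<Suc m. if A i then x else 1)) = (\<Sum>n. ennreal (x ^ Suc n)) + of_nat s" for x :: real
  proof -
    have "(\<Sum>m. ennreal (\<Prod>i<Suc m. if A i then x else 1)) =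
      (\<Sum>n. ennreal (\<Prod>i<Suc (n + s). if A i then x else 1)) + (\<Sum>m<s. ennreal (\<Prod>i<Suc m. if A i then x else 1))"
      by (rule suminf_offset) simp
    also have "(\<Sum>m<s. ennreal (\<Prod>i<Suc m. if A i then x else 1)) = (\<Sum>m<s. 1)"
    proof (rule sum.cong)
      fix m assume "m \<in> {..<s}"
      then have "(\<Prod>i<Suc m. if A i then x else 1) = 1" using before by (intro prod.neutral) auto
      then show "ennreal (\<Prod>i<Suc m. if A i then x else 1) = 1" by simp
    qed simp
    finally show ?thesis by (simp only: shift) simp
  qed
  show ?thesis unfolding sums by (simp add: add.commute)
qed

lemma stat_seq_cong: "(\<And>i. i < n \<Longrightarrow> \<omega> i = \<omega>' i) \<Longrightarrow> stat_seq \<xi> \<theta> \<omega> n = stat_seq \<xi> \<theta> \<omega>' n"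
  by (induction n) auto

lemma weight_seq_cong:
  "(\<And>i. i < n \<Longrightarrow> \<omega> i = \<omega>' i) \<Longrightarrow> weight_seq \<xi> p u \<theta> \<omega> n = weight_seq \<xi> p u \<theta> \<omega>' n"
proof (induction n)
  case (Suc n)
  have "stat_seq \<xi> \<theta> \<omega> n = stat_seq \<xi> \<theta> \<omega>' n" using Suc.prems by (intro stat_seq_cong) simp
  with Suc show ?case by simp
qed simp

lemma stat_seq_upd: "stat_seq \<xi> \<theta> (fun_upd \<omega> m y) m = stat_seq \<xi> \<theta> \<omega> m"
  by (rule stat_seq_cong) simp

lemma weight_seq_upd: "weight_seq \<xi> p u \<theta> (fun_upd \<omega> m y) m = weight_seq \<xi> p u \<theta> \<omega> m"
  by (rule weight_seq_cong) simp

lemma policies_bounds: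
  assumes "\<pi> \<in> policies \<mu>" "\<omega> \<in> space (obs_space \<mu>)"
  shows "0 \<le> fst \<pi> n \<omega>" "fst \<pi> n \<omega> \<le> 1" "0 \<le> snd \<pi> n \<omega> k" "(\<Sum>k\<in>UNIV. snd \<pi> n \<omega> k) = 1" "snd \<pi> n \<omega> k \<le> 1"
proof -
  have *: "fst \<pi> n \<omega> \<in> {0..1} \<and> (\<forall>k. 0 \<le> snd \<pi> n \<omega> k) \<and> (\<Sum>k\<in>UNIV. snd \<pi> n \<omega> k) = 1"
    using assms unfolding policies_def by (cases \<pi>) auto
  then show "0 \<le> fst \<pi> n \<omega>" "fst \<pi> n \<omega> \<le> 1" "0 \<le> snd \<pi> n \<omega> k" "(\<Sum>k\<in>UNIV. snd \<pi> n \<omega> k) = 1"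
    by auto
  then show "snd \<pi> n \<omega> k \<le> 1"
    using member_le_sum[of k UNIV "snd \<pi> n \<omega>"] * by simp
qed

lemma policies_measurable:
  assumes "\<pi> \<in> policies \<mu>"
  shows "fst \<pi> n \<in> borel_measurable (obs_filtration \<mu> n)"
    and "(\<lambda>\<omega>. snd \<pi> n \<omega> k) \<in> borel_measurable (obs_filtration \<mu> n)"
  using assms unfolding policies_def by (cases \<pi>; auto)+

lemma continue_prob_Suc: "continue_prob \<pi> (Suc m) \<omega> = continue_prob \<pi> m \<omega> * (1 - fst \<pi> m \<omega>)"
  by (simp add: continue_prob_def)

lemma continue_prob_bounds:
  assumes "\<pi> \<in> policies \<mu>" "\<omega> \<in> space (obs_space \<mu>)"
  shows "0 \<le> continue_prob \<pi> n \<omega>" "continue_prob \<pi> n \<omega> \<le> 1"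
  unfolding continue_prob_def using policies_bounds[OF assms] by (auto intro!: prod_nonneg prod_le_1)

lemma stop_prob_nonneg:
  assumes "\<pi> \<in> policies \<mu>" "\<omega> \<in> space (obs_space \<mu>)"
  shows "0 \<le> stop_prob \<pi> n \<omega>"
  unfolding stop_prob_def using policies_bounds[OF assms] continue_prob_bounds[OF assms] by auto

lemma continue_prob_measurable:
  assumes "\<pi> \<in> policies \<mu>"
  shows "continue_prob \<pi> (Suc n) \<in> borel_measurable (obs_filtration \<mu> n)"
    and "continue_prob \<pi> n \<in> borel_measurable (obs_filtration \<mu> n)"
    and "stop_prob \<pi> n \<in> borel_measurable (obs_filtration \<mu> n)"
proof -
  have *: "fst \<pi> i \<in> borel_measurable (obs_filtration \<mu> n)" if "i \<le> n" for i
    using measurable_obs_filtration_mono[OF policies_measurable(1)[OF assms] that] .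
  have m: "(\<lambda>\<omega>. \<Prod>i<j. 1 - fst \<pi> i \<omega>) \<in> borel_measurable (obs_filtration \<mu> n)" if "j \<le> Suc n" for j
    using that by (intro borel_measurable_prod borel_measurable_diff borel_measurable_const *) auto
  from m[of "Suc n"] m[of n] show c: "continue_prob \<pi> (Suc n) \<in> borel_measurable (obs_filtration \<mu> n)"
    "continue_prob \<pi> n \<in> borel_measurable (obs_filtration \<mu> n)"
    by (simp_all add: continue_prob_def[abs_def])
  have "(\<lambda>\<omega>. continue_prob \<pi> n \<omega> * fst \<pi> n \<omega>) \<in> borel_measurable (obs_filtration \<mu> n)"
    using c(2) *[of n] by (intro borel_measurable_times) auto
  then show "stop_prob \<pi> n \<in> borel_measurable (obs_filtration \<mu> n)"
    by (simp add: stop_prob_def[abs_def])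
qed

section \<open>Likelihood weights as a change of measure\<close>

context sequential_test
begin

lemma sets_P: "\<theta> \<in> space MT \<Longrightarrow> sets (P i \<theta>) = sets (obs_space \<mu>)"
  using process_law[of \<theta> i] by (simp add: process_laws_def)

lemma space_P: "\<theta> \<in> space MT \<Longrightarrow> space (P i \<theta>) = space (obs_space \<mu>)"
  by (rule sets_eq_imp_space_eq[OF sets_P])

lemma stat_seq_filtration: "\<theta> \<in> space MT \<Longrightarrow> (\<lambda>\<omega>. stat_seq \<xi> \<theta> \<omega> n) \<in> obs_filtration \<mu> n \<rightarrow>\<^sub>M MT"
  by (rule measurable_stat_seq_filtration[OF xi_measurable])

lemma weight_seq_filtration:
  assumes u: "u \<in> nonneg_vecs" and \<theta>: "\<theta> \<in> space MT"
  shows "(\<lambda>\<omega>. weight_seq \<xi> p u \<theta> \<omega> n) \<in> obs_filtration \<mu> n \<rightarrow>\<^sub>M orthant"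
proof (induction n)
  case (Suc n)
  have "(\<lambda>\<omega>. upd (weight_seq \<xi> p u \<theta> \<omega> n) (stat_seq \<xi> \<theta> \<omega> n) (\<omega> n)) \<in> obs_filtration \<mu> (Suc n) \<rightarrow>\<^sub>M orthant"
    by (rule upd_measurable[OF measurable_obs_filtration_mono[OF Suc] measurable_obs_filtration_mono[OF stat_seq_filtration[OF \<theta>]]
          measurable_obs_filtration_coord]) auto
  then show ?case by simp
qed (use u in simp)

lemmas stat_seq_measurable = measurable_obs_filtrationD[OF stat_seq_filtration]
lemmas weight_seq_measurable = measurable_obs_filtrationD[OF weight_seq_filtration]

lemma stat_seq_space: "\<theta> \<in> space MT \<Longrightarrow> \<omega> \<in> space (obs_space \<mu>) \<Longrightarrow> stat_seq \<xi> \<theta> \<omega> n \<in> space MT"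
  using measurable_space[OF stat_seq_measurable] .

lemma weight_seq_nonneg:
  "u \<in> nonneg_vecs \<Longrightarrow> \<theta> \<in> space MT \<Longrightarrow> \<omega> \<in> space (obs_space \<mu>) \<Longrightarrow> weight_seq \<xi> p u \<theta> \<omega> n \<in> nonneg_vecs"
  using measurable_space[OF weight_seq_measurable] by simp

definition obs0 :: "nat \<Rightarrow> 'x" where
  "obs0 = (\<lambda>_. SOME x. x \<in> space \<mu>)"

lemma obs0_space: "\<theta> \<in> space MT \<Longrightarrow> obs0 \<in> space (obs_space \<mu>)"
  unfolding obs0_def space_obs_space using space_mu_nonempty by (auto simp: some_in_eq)

text \<open>
  The \<open>n\<close>-fold product of the reference measure, realized on infinite sequences by rewriting the first
  \<open>n\<close> entries of a fixed one. A \<open>\<sigma>\<close>-finite measure has no infinite product, but functions of the first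
  \<open>n\<close> observations do not see the remaining entries.
\<close>

primrec obs_iter :: "nat \<Rightarrow> (nat \<Rightarrow> 'x) measure" where
  "obs_iter 0 = return (obs_space \<mu>) obs0"
| "obs_iter (Suc n) = distr (obs_iter n \<Otimes>\<^sub>M \<mu>) (obs_space \<mu>) (\<lambda>(\<omega>, y). fun_upd \<omega> n y)"

lemma sets_obs_iter [simp, measurable_cong]: "sets (obs_iter n) = sets (obs_space \<mu>)"
  by (cases n) auto

lemma space_obs_iter [simp]: "space (obs_iter n) = space (obs_space \<mu>)"
  by (rule sets_eq_imp_space_eq) simp

lemma nn_integral_obs_iter_Suc:
  assumes F: "F \<in> borel_measurable (obs_space \<mu>)"
  shows "(\<integral>\<^sup>+\<omega>. F \<omega> \<partial>obs_iter (Suc n)) = (\<integral>\<^sup>+\<omega>. \<integral>\<^sup>+y. F (fun_upd \<omega> n y) \<partial>\<mu> \<partial>obs_iter n)"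
proof -
  have cong: "obs_iter n \<Otimes>\<^sub>M \<mu> \<rightarrow>\<^sub>M N = obs_space \<mu> \<Otimes>\<^sub>M \<mu> \<rightarrow>\<^sub>M N" for N :: "'z measure"
    by (intro measurable_cong_sets sets_pair_measure_cong) auto
  have "(\<integral>\<^sup>+\<omega>. F \<omega> \<partial>obs_iter (Suc n)) = (\<integral>\<^sup>+x. F (case x of (\<omega>, y) \<Rightarrow> fun_upd \<omega> n y) \<partial>(obs_iter n \<Otimes>\<^sub>M \<mu>))"
    unfolding obs_iter.simps by (rule nn_integral_distr) (auto simp: cong obs_upd_measurable F)
  also have "\<dots> = (\<integral>\<^sup>+x. (case x of (\<omega>, y) \<Rightarrow> F (fun_upd \<omega> n y)) \<partial>(obs_iter n \<Otimes>\<^sub>M \<mu>))"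
    by (simp add: case_prod_unfold)
  also have "\<dots> = (\<integral>\<^sup>+\<omega>. \<integral>\<^sup>+y. F (fun_upd \<omega> n y) \<partial>\<mu> \<partial>obs_iter n)"
    using obs_upd_comp[OF F, of n] by (subst nn_integral_fst[symmetric]) (auto simp: cong)
  finally show ?thesis .
qed

text \<open>
  A weight \<open>u\<^sub>i\<close> times an expectation under hypothesis \<open>i\<close> is an integral against the reference measure in
  which the weight process started in \<open>u\<close> acts as the likelihood. This brings the expectations under
  all hypotheses into one integral, where the pointwise minimum of the cost equation can be applied.
\<close>

lemma weight_integral:
  assumes u: "u \<in> nonneg_vecs" and \<theta>: "\<theta> \<in> space MT"
    and F: "F \<in> borel_measurable (obs_filtration \<mu> m)"
  shows "ennreal (u $ i) * (\<integral>\<^sup>+\<omega>. F \<omega> \<partial>P i \<theta>) =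
    (\<integral>\<^sup>+\<omega>. ennreal (weight_seq \<xi> p u \<theta> \<omega> m $ i) * F \<omega> \<partial>obs_iter m)"
  using F
proof (induction m arbitrary: F)
  case 0
  interpret prob_space "P i \<theta>" using process_law[OF \<theta>, of i] by (simp add: process_laws_def)
  have "(\<integral>\<^sup>+\<omega>. F \<omega> \<partial>P i \<theta>) = (\<integral>\<^sup>+\<omega>. F obs0 \<partial>P i \<theta>)"
    by (intro nn_integral_cong obs_filtration_eq_prefix[OF 0]) (auto simp: space_P[OF \<theta>] obs0_space[OF \<theta>])
  also have "\<dots> = F obs0" by (simp add: emeasure_space_1)
  finally show ?case
    using measurable_obs_filtrationD[OF 0] obs0_space[OF \<theta>]
    by (simp add: nn_integral_return)
next
  case (Suc m)
  let ?H = "\<lambda>\<omega>. \<integral>\<^sup>+y. ennreal (p i (stat_seq \<xi> \<theta> \<omega> m) y) * F (fun_upd \<omega> m y) \<partial>\<mu>"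
  have [measurable]: "(\<lambda>\<omega>. stat_seq \<xi> \<theta> \<omega> m) \<in> obs_filtration \<mu> m \<rightarrow>\<^sub>M MT" by (rule stat_seq_filtration[OF \<theta>])
  have [measurable]: "(\<lambda>\<omega>. stat_seq \<xi> \<theta> \<omega> m) \<in> obs_space \<mu> \<rightarrow>\<^sub>M MT" by (rule stat_seq_measurable[OF \<theta>])
  note Fupd = obs_filtration_upd_comp[OF Suc.prems]
  note [measurable] = Fupd
  have H: "?H \<in> borel_measurable (obs_filtration \<mu> m)" by measurable
  have Fo: "F \<in> borel_measurable (obs_space \<mu>)" by (rule measurable_obs_filtrationD[OF Suc.prems])
  note [measurable] = obs_upd_comp[OF Fo, of m]
  have w [measurable]: "(\<lambda>\<omega>. weight_seq \<xi> p u \<theta> \<omega> n $ i) \<in> borel_measurable (obs_space \<mu>)" for n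
    by (rule measurable_nonneg_vecs_nth[OF weight_seq_measurable[OF u \<theta>]])
  have "ennreal (u $ i) * (\<integral>\<^sup>+\<omega>. F \<omega> \<partial>P i \<theta>) = ennreal (u $ i) * (\<integral>\<^sup>+\<omega>. ?H \<omega> \<partial>P i \<theta>)"
    by (rule arg_cong[OF process_law_integral_Suc[OF process_law[OF \<theta>] sigma_finite_measure_axioms density_families
            xi_measurable \<theta> Suc.prems]])
  also have "\<dots> = (\<integral>\<^sup>+\<omega>. ennreal (weight_seq \<xi> p u \<theta> \<omega> m $ i) * ?H \<omega> \<partial>obs_iter m)"
    by (rule Suc.IH[OF H])
  also have "\<dots> = (\<integral>\<^sup>+\<omega>. \<integral>\<^sup>+y. ennreal (weight_seq \<xi> p u \<theta> (fun_upd \<omega> m y) (Suc m) $ i) * F (fun_upd \<omega> m y) \<partial>\<mu> \<partial>obs_iter m)"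
  proof (rule nn_integral_cong)
    fix \<omega> assume "\<omega> \<in> space (obs_iter m)"
    then have \<omega> [measurable]: "\<omega> \<in> space (obs_space \<mu>)" by simp
    have [measurable]: "stat_seq \<xi> \<theta> \<omega> m \<in> space MT" by (rule stat_seq_space[OF \<theta> \<omega>])
    have w0: "0 \<le> weight_seq \<xi> p u \<theta> \<omega> m $ i" by (rule nonneg_vecsD[OF weight_seq_nonneg[OF u \<theta> \<omega>]])
    have [measurable]: "(\<lambda>y. F (fun_upd \<omega> m y)) \<in> borel_measurable \<mu>" by measurable
    have "ennreal (weight_seq \<xi> p u \<theta> \<omega> m $ i) * ?H \<omega> =
        (\<integral>\<^sup>+y. ennreal (weight_seq \<xi> p u \<theta> \<omega> m $ i) * (ennreal (p i (stat_seq \<xi> \<theta> \<omega> m) y) * F (fun_upd \<omega> m y)) \<partial>\<mu>)"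
      by (rule nn_integral_cmult[symmetric]) measurable
    also have "\<dots> = (\<integral>\<^sup>+y. ennreal (weight_seq \<xi> p u \<theta> (fun_upd \<omega> m y) (Suc m) $ i) * F (fun_upd \<omega> m y) \<partial>\<mu>)"
      by (intro nn_integral_cong)
         (simp add: weight_seq_upd stat_seq_upd vec_mult_def ennreal_mult'[OF w0] mult.assoc)
    finally show "ennreal (weight_seq \<xi> p u \<theta> \<omega> m $ i) * ?H \<omega> = \<dots>" .
  qed
  also have "\<dots> = (\<integral>\<^sup>+\<omega>. ennreal (weight_seq \<xi> p u \<theta> \<omega> (Suc m) $ i) * F \<omega> \<partial>obs_iter (Suc m))"
  proof (rule nn_integral_obs_iter_Suc[symmetric])
    show "(\<lambda>\<omega>. ennreal (weight_seq \<xi> p u \<theta> \<omega> (Suc m) $ i) * F \<omega>) \<in> borel_measurable (obs_space \<mu>)"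
      by (rule borel_measurable_times_ennreal[OF measurable_compose[OF w measurable_ennreal] Fo])
  qed
  finally show ?case .
qed

section \<open>The cost vector of a policy\<close>

text \<open>
  The share of stage \<open>m\<close> in the cost: for hypothesis \<open>0\<close> the probability of asking for another
  observation at time \<open>m\<close>, for the others the cost of a wrong decision at time \<open>m\<close>.
\<close>

definition stage_cost :: "('x, 'k) policy \<Rightarrow> 't \<Rightarrow> 'k option \<Rightarrow> nat \<Rightarrow> ennreal" where
  "stage_cost \<pi> \<theta> i m = (case i of
     None \<Rightarrow> (\<integral>\<^sup>+\<omega>. ennreal (continue_prob \<pi> (Suc m) \<omega>) \<partial>P None \<theta>)
   | Some k \<Rightarrow> ennreal (lam k) * (\<integral>\<^sup>+\<omega>. ennreal (stop_prob \<pi> m \<omega> * (1 - snd \<pi> m \<omega> k)) \<partial>P (Some k) \<theta>))"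

definition cost_component :: "('x, 'k) policy \<Rightarrow> 't \<Rightarrow> 'k option \<Rightarrow> ennreal" where
  "cost_component \<pi> \<theta> i = (\<Sum>m. stage_cost \<pi> \<theta> i m)"

definition total_cost :: "('x, 'k) policy \<Rightarrow> 't \<Rightarrow> real ^ 'k option \<Rightarrow> ennreal" where
  "total_cost \<pi> \<theta> u = (\<Sum>i\<in>UNIV. ennreal (u $ i) * cost_component \<pi> \<theta> i)"

lemma total_eq_suminf: "total_cost \<pi> \<theta> u = (\<Sum>m. \<Sum>i\<in>UNIV. ennreal (u $ i) * stage_cost \<pi> \<theta> i m)"
  unfolding total_cost_def cost_component_def by (subst suminf_sum) (auto simp: ennreal_suminf_cmult)

lemma measurable_P:
  assumes "\<theta> \<in> space MT" "f \<in> obs_filtration \<mu> n \<rightarrow>\<^sub>M N"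
  shows "f \<in> P i \<theta> \<rightarrow>\<^sub>M N"
  using measurable_cong_sets[OF sets_P[OF assms(1)] refl] measurable_obs_filtrationD[OF assms(2)] by blast

lemma expected_time_eq_cost_component:
  assumes \<pi>: "\<pi> \<in> policies \<mu>" and \<theta>: "\<theta> \<in> space MT"
  shows "expected_time (P None \<theta>) \<pi> = cost_component \<pi> \<theta> None"
proof -
  have "expected_time (P None \<theta>) \<pi> = (\<integral>\<^sup>+\<omega>. (\<Sum>n. ennreal (continue_prob \<pi> (Suc n) \<omega>)) \<partial>P None \<theta>)"
    unfolding expected_time_def stop_prob_def
  proof (rule nn_integral_cong)
    fix \<omega> assume "\<omega> \<in> space (P None \<theta>)"
    then have "fst \<pi> n \<omega> \<in> {0..1}" for n using policies_bounds[OF \<pi>, of \<omega> n] space_P[OF \<theta>] by auto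
    from tail_sum_formula[of "\<lambda>n. fst \<pi> n \<omega>", OF this]
    show "(\<Sum>n. of_nat n * ennreal (continue_prob \<pi> n \<omega> * fst \<pi> n \<omega>)) + \<infinity> * (INF n. ennreal (continue_prob \<pi> n \<omega>)) =
        (\<Sum>n. ennreal (continue_prob \<pi> (Suc n) \<omega>))"
      by (simp add: continue_prob_def)
  qed
  also have "\<dots> = cost_component \<pi> \<theta> None"
    unfolding cost_component_def stage_cost_def option.case
    by (rule nn_integral_suminf) (rule measurable_compose[OF measurable_P[OF \<theta> continue_prob_measurable(1)[OF \<pi>]] measurable_ennreal])
  finally show ?thesis .
qed

lemma stop_error_measurable:
  assumes \<pi>: "\<pi> \<in> policies \<mu>"
  shows "(\<lambda>\<omega>. stop_prob \<pi> m \<omega> * (1 - snd \<pi> m \<omega> k)) \<in> borel_measurable (obs_filtration \<mu> m)"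
  by (intro borel_measurable_times borel_measurable_diff borel_measurable_const
      continue_prob_measurable(3)[OF \<pi>] policies_measurable(2)[OF \<pi>])

lemma expected_error_eq_cost_component:
  assumes \<pi>: "\<pi> \<in> policies \<mu>" and \<theta>: "\<theta> \<in> space MT"
  shows "ennreal (lam k) * expected_error (P (Some k) \<theta>) \<pi> k = cost_component \<pi> \<theta> (Some k)"
proof -
  have "expected_error (P (Some k) \<theta>) \<pi> k = (\<Sum>n. \<integral>\<^sup>+\<omega>. ennreal (stop_prob \<pi> n \<omega> * (1 - snd \<pi> n \<omega> k)) \<partial>P (Some k) \<theta>)"
    unfolding expected_error_def
    by (rule nn_integral_suminf) (rule measurable_compose[OF measurable_P[OF \<theta> stop_error_measurable[OF \<pi>]] measurable_ennreal])
  then show ?thesis unfolding cost_component_def stage_cost_def option.case by simp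
qed

lemma weighted_cost_eq_total:
  assumes \<pi>: "\<pi> \<in> policies \<mu>" and \<theta>: "\<theta> \<in> space MT"
  shows "weighted_cost lam (\<lambda>i. P i \<theta>) \<pi> = total_cost \<pi> \<theta> 1"
  unfolding weighted_cost_def total_cost_def sum_option
  by (simp add: expected_time_eq_cost_component[OF assms] expected_error_eq_cost_component[OF assms])

text \<open>
  The right-hand side of the cost equation for a policy in place of the minimum, with \<open>\<Phi> (Suc m)\<close> as
  the cost-to-go after the next observation. The weights started in \<open>u\<close> need not be the ones by which the
  policy acts; this freedom is what makes costs linear in \<open>u\<close>.
\<close>

definition one_step :: "('x, 'k) policy \<Rightarrow> 't \<Rightarrow> real ^ 'k option \<Rightarrow> (nat \<Rightarrow> (nat \<Rightarrow> 'x) \<Rightarrow> ennreal) \<Rightarrow> nat \<Rightarrow> (nat \<Rightarrow> 'x) \<Rightarrow> ennreal" where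
  "one_step \<pi> \<theta> u \<Phi> m \<omega> =
     ennreal (fst \<pi> m \<omega>) * ennreal (error_cost lam (weight_seq \<xi> p u \<theta> \<omega> m) (snd \<pi> m \<omega>)) +
     ennreal (1 - fst \<pi> m \<omega>) *
       (ennreal (weight_seq \<xi> p u \<theta> \<omega> m $ None) + (\<integral>\<^sup>+y. \<Phi> (Suc m) (fun_upd \<omega> m y) \<partial>\<mu>))"

text \<open>
  One stage of the dynamic programming identity, integrated over the past. Telescoping it compares the
  cost of a policy with any family \<open>\<Phi>\<close> that is a sub- or supersolution of the one-step recursion.
\<close>

lemma one_step_integral:
  assumes \<pi>: "\<pi> \<in> policies \<mu>" and u: "u \<in> nonneg_vecs" and \<theta>: "\<theta> \<in> space MT"
    and \<Phi>: "\<Phi> (Suc m) \<in> borel_measurable (obs_space \<mu>)"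
  shows "(\<integral>\<^sup>+\<omega>. ennreal (continue_prob \<pi> m \<omega>) * one_step \<pi> \<theta> u \<Phi> m \<omega> \<partial>obs_iter m) =
    (\<Sum>i\<in>UNIV. ennreal (u $ i) * stage_cost \<pi> \<theta> i m) +
    (\<integral>\<^sup>+\<omega>. ennreal (continue_prob \<pi> (Suc m) \<omega>) * \<Phi> (Suc m) \<omega> \<partial>obs_iter (Suc m))"
proof -
  let ?w = "\<lambda>\<omega>. weight_seq \<xi> p u \<theta> \<omega> m"
  let ?A = "\<lambda>\<omega>. ennreal (?w \<omega> $ None) * ennreal (continue_prob \<pi> (Suc m) \<omega>)"
  let ?B = "\<lambda>k \<omega>. ennreal (?w \<omega> $ Some k) * ennreal (stop_prob \<pi> m \<omega> * (1 - snd \<pi> m \<omega> k))"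
  let ?C = "\<lambda>\<omega>. \<integral>\<^sup>+y. ennreal (continue_prob \<pi> (Suc m) (fun_upd \<omega> m y)) * \<Phi> (Suc m) (fun_upd \<omega> m y) \<partial>\<mu>"
  have c [measurable]: "continue_prob \<pi> (Suc m) \<in> borel_measurable (obs_space \<mu>)"
    by (rule measurable_obs_filtrationD[OF continue_prob_measurable(1)[OF \<pi>]])
  have [measurable]: "(\<lambda>\<omega>. stop_prob \<pi> m \<omega> * (1 - snd \<pi> m \<omega> k)) \<in> borel_measurable (obs_space \<mu>)" for k
    by (rule measurable_obs_filtrationD[OF stop_error_measurable[OF \<pi>]])
  have [measurable]: "(\<lambda>\<omega>. ?w \<omega> $ i) \<in> borel_measurable (obs_space \<mu>)" for i
    by (rule measurable_nonneg_vecs_nth[OF weight_seq_measurable[OF u \<theta>]])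
  have c\<Phi>: "(\<lambda>\<omega>. ennreal (continue_prob \<pi> (Suc m) \<omega>) * \<Phi> (Suc m) \<omega>) \<in> borel_measurable (obs_space \<mu>)"
    using c \<Phi> by measurable
  have [measurable]: "?C \<in> borel_measurable (obs_space \<mu>)"
    by (rule borel_measurable_nn_integral[OF obs_upd_comp[OF c\<Phi>]])
  have split: "ennreal (continue_prob \<pi> m \<omega>) * one_step \<pi> \<theta> u \<Phi> m \<omega> = ?A \<omega> + (\<Sum>k\<in>UNIV. ennreal (lam k) * ?B k \<omega>) + ?C \<omega>"
    if \<omega>: "\<omega> \<in> space (obs_space \<mu>)" for \<omega>
  proof -
    note b = policies_bounds[OF \<pi> \<omega>] continue_prob_bounds[OF \<pi> \<omega>]
    have w0: "0 \<le> ?w \<omega> $ i" for i by (rule nonneg_vecsD[OF weight_seq_nonneg[OF u \<theta> \<omega>]])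
    have "ennreal (continue_prob \<pi> m \<omega>) * (ennreal (fst \<pi> m \<omega>) * ennreal (error_cost lam (?w \<omega>) (snd \<pi> m \<omega>)))
        = ennreal (stop_prob \<pi> m \<omega>) * ennreal (error_cost lam (?w \<omega>) (snd \<pi> m \<omega>))"
      using b by (simp add: stop_prob_def ennreal_mult' mult.assoc)
    also have "\<dots> = ennreal (\<Sum>k\<in>UNIV. lam k * (?w \<omega> $ Some k * (stop_prob \<pi> m \<omega> * (1 - snd \<pi> m \<omega> k))))"
      using stop_prob_nonneg[OF \<pi> \<omega>]
      by (simp add: ennreal_mult'[symmetric] error_cost_def sum_distrib_left mult_ac)
    also have "\<dots> = (\<Sum>k\<in>UNIV. ennreal (lam k * (?w \<omega> $ Some k * (stop_prob \<pi> m \<omega> * (1 - snd \<pi> m \<omega> k)))))"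
      using lam_nonneg w0 stop_prob_nonneg[OF \<pi> \<omega>] b by (intro sum_ennreal[symmetric] mult_nonneg_nonneg) auto
    also have "\<dots> = (\<Sum>k\<in>UNIV. ennreal (lam k) * ?B k \<omega>)"
      using lam_nonneg w0 by (simp add: ennreal_mult')
    finally have 1: "ennreal (continue_prob \<pi> m \<omega>) * (ennreal (fst \<pi> m \<omega>) * ennreal (error_cost lam (?w \<omega>) (snd \<pi> m \<omega>)))
        = (\<Sum>k\<in>UNIV. ennreal (lam k) * ?B k \<omega>)" .
    have cc: "ennreal (continue_prob \<pi> m \<omega>) * ennreal (1 - fst \<pi> m \<omega>) = ennreal (continue_prob \<pi> (Suc m) \<omega>)"
      using b by (simp add: continue_prob_Suc ennreal_mult')
    have [measurable]: "\<omega> \<in> space (obs_space \<mu>)" by (rule \<omega>)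
    note [measurable] = obs_upd_comp[OF \<Phi>, of m]
    have "ennreal (continue_prob \<pi> (Suc m) \<omega>) * (\<integral>\<^sup>+y. \<Phi> (Suc m) (fun_upd \<omega> m y) \<partial>\<mu>) =
        (\<integral>\<^sup>+y. ennreal (continue_prob \<pi> (Suc m) \<omega>) * \<Phi> (Suc m) (fun_upd \<omega> m y) \<partial>\<mu>)"
      by (rule nn_integral_cmult[symmetric]) measurable
    also have "\<dots> = ?C \<omega>"
    proof (rule nn_integral_cong)
      fix y assume "y \<in> space \<mu>"
      then have "continue_prob \<pi> (Suc m) \<omega> = continue_prob \<pi> (Suc m) (fun_upd \<omega> m y)"
        by (intro obs_filtration_eq_prefix[OF continue_prob_measurable(1)[OF \<pi>]] \<omega> obs_upd_space) auto
      then show "ennreal (continue_prob \<pi> (Suc m) \<omega>) * \<Phi> (Suc m) (fun_upd \<omega> m y) =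
          ennreal (continue_prob \<pi> (Suc m) (fun_upd \<omega> m y)) * \<Phi> (Suc m) (fun_upd \<omega> m y)" by simp
    qed
    finally have 2: "ennreal (continue_prob \<pi> (Suc m) \<omega>) * (\<integral>\<^sup>+y. \<Phi> (Suc m) (fun_upd \<omega> m y) \<partial>\<mu>) = ?C \<omega>" .
    show ?thesis
      unfolding one_step_def distrib_left 1 unfolding mult.assoc[symmetric] cc
      unfolding distrib_left 2 by (simp add: mult.commute add_ac)
  qed
  have int_B: "(\<integral>\<^sup>+\<omega>. ?B k \<omega> \<partial>obs_iter m) = ennreal (u $ Some k) * (\<integral>\<^sup>+\<omega>. ennreal (stop_prob \<pi> m \<omega> * (1 - snd \<pi> m \<omega> k)) \<partial>P (Some k) \<theta>)" for k
    by (rule weight_integral[OF u \<theta>, symmetric]) (rule measurable_compose[OF stop_error_measurable[OF \<pi>] measurable_ennreal])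
  have "(\<integral>\<^sup>+\<omega>. ennreal (continue_prob \<pi> m \<omega>) * one_step \<pi> \<theta> u \<Phi> m \<omega> \<partial>obs_iter m) =
      (\<integral>\<^sup>+\<omega>. ?A \<omega> + (\<Sum>k\<in>UNIV. ennreal (lam k) * ?B k \<omega>) + ?C \<omega> \<partial>obs_iter m)"
    by (intro nn_integral_cong split) simp
  also have "\<dots> = (\<integral>\<^sup>+\<omega>. ?A \<omega> \<partial>obs_iter m) + (\<Sum>k\<in>UNIV. ennreal (lam k) * (\<integral>\<^sup>+\<omega>. ?B k \<omega> \<partial>obs_iter m)) + (\<integral>\<^sup>+\<omega>. ?C \<omega> \<partial>obs_iter m)"
    by (simp add: nn_integral_add nn_integral_sum nn_integral_cmult)
  also have "(\<integral>\<^sup>+\<omega>. ?C \<omega> \<partial>obs_iter m) = (\<integral>\<^sup>+\<omega>. ennreal (continue_prob \<pi> (Suc m) \<omega>) * \<Phi> (Suc m) \<omega> \<partial>obs_iter (Suc m))"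
    by (rule nn_integral_obs_iter_Suc[OF c\<Phi>, symmetric])
  also have "(\<integral>\<^sup>+\<omega>. ?A \<omega> \<partial>obs_iter m) = ennreal (u $ None) * stage_cost \<pi> \<theta> None m"
    unfolding stage_cost_def option.case
    by (rule weight_integral[OF u \<theta>, symmetric]) (rule measurable_compose[OF continue_prob_measurable(1)[OF \<pi>] measurable_ennreal])
  finally show ?thesis
    unfolding sum_option int_B by (simp add: stage_cost_def mult_ac)
qed

end

section \<open>The cost function as the least weighted cost\<close>

lemma convex_comb_ge_ennreal:
  fixes a b c :: ennreal
  assumes "0 \<le> s" "s \<le> 1" "a \<le> b" "a \<le> c"
  shows "a \<le> ennreal s * b + ennreal (1 - s) * c"
proof -
  have "a = (ennreal s + ennreal (1 - s)) * a"
    using assms(1,2) by (simp add: ennreal_plus[symmetric])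
  also have "\<dots> = ennreal s * a + ennreal (1 - s) * a" by (rule distrib_right)
  also have "\<dots> \<le> ennreal s * b + ennreal (1 - s) * c"
    using assms(3,4) by (intro add_mono mult_left_mono) auto
  finally show ?thesis .
qed

lemma convex_comb_eq_ennreal:
  fixes a :: ennreal
  assumes "0 \<le> s" "s \<le> 1"
  shows "ennreal s * a + ennreal (1 - s) * a = a"
  using assms by (simp add: distrib_right[symmetric] ennreal_plus[symmetric])

context sequential_test
begin

abbreviation remainder :: "('x, 'k) policy \<Rightarrow> (nat \<Rightarrow> (nat \<Rightarrow> 'x) \<Rightarrow> ennreal) \<Rightarrow> nat \<Rightarrow> ennreal" where
  "remainder \<pi> \<Phi> n \<equiv> (\<integral>\<^sup>+\<omega>. ennreal (continue_prob \<pi> n \<omega>) * \<Phi> n \<omega> \<partial>obs_iter n)"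

lemma remainder_0:
  assumes "\<theta> \<in> space MT" "\<Phi> 0 \<in> borel_measurable (obs_space \<mu>)"
  shows "remainder \<pi> \<Phi> 0 = \<Phi> 0 obs0"
  using assms(2) obs0_space[OF assms(1)] by (simp add: continue_prob_def nn_integral_return)

lemma telescope_le:
  assumes \<pi>: "\<pi> \<in> policies \<mu>" and u: "u \<in> nonneg_vecs" and \<theta>: "\<theta> \<in> space MT"
    and \<Phi>: "\<And>m. \<Phi> m \<in> borel_measurable (obs_space \<mu>)"
    and le: "\<And>m \<omega>. m < n \<Longrightarrow> \<omega> \<in> space (obs_space \<mu>) \<Longrightarrow> \<Phi> m \<omega> \<le> one_step \<pi> \<theta> u \<Phi> m \<omega>"
  shows "\<Phi> 0 obs0 \<le> (\<Sum>m<n. \<Sum>i\<in>UNIV. ennreal (u $ i) * stage_cost \<pi> \<theta> i m) + remainder \<pi> \<Phi> n"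
  using le
proof (induction n)
  case 0
  then show ?case using remainder_0[where \<Phi> = \<Phi> and \<pi> = \<pi>, OF \<theta> \<Phi>] by (simp del: obs_iter.simps)
next
  case (Suc n)
  have "remainder \<pi> \<Phi> n \<le> (\<integral>\<^sup>+\<omega>. ennreal (continue_prob \<pi> n \<omega>) * one_step \<pi> \<theta> u \<Phi> n \<omega> \<partial>obs_iter n)"
    by (intro nn_integral_mono mult_left_mono Suc.prems) auto
  also have "\<dots> = (\<Sum>i\<in>UNIV. ennreal (u $ i) * stage_cost \<pi> \<theta> i n) + remainder \<pi> \<Phi> (Suc n)"
    by (rule one_step_integral[OF \<pi> u \<theta> \<Phi>])
  finally have *: "remainder \<pi> \<Phi> n \<le> \<dots>" .
  have "\<Phi> 0 obs0 \<le> (\<Sum>m<n. \<Sum>i\<in>UNIV. ennreal (u $ i) * stage_cost \<pi> \<theta> i m) + remainder \<pi> \<Phi> n"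
    using Suc by simp
  also have "\<dots> \<le> (\<Sum>m<n. \<Sum>i\<in>UNIV. ennreal (u $ i) * stage_cost \<pi> \<theta> i m) +
      ((\<Sum>i\<in>UNIV. ennreal (u $ i) * stage_cost \<pi> \<theta> i n) + remainder \<pi> \<Phi> (Suc n))"
    by (intro add_left_mono *)
  finally show ?case by (simp add: add.assoc)
qed

text \<open>
  A nonnegative supersolution dominates the cost, since the remainder after finitely many stages can be
  dropped.
\<close>

lemma telescope_ge:
  assumes \<pi>: "\<pi> \<in> policies \<mu>" and u: "u \<in> nonneg_vecs" and \<theta>: "\<theta> \<in> space MT"
    and \<Phi>: "\<And>m. \<Phi> m \<in> borel_measurable (obs_space \<mu>)"
    and ge: "\<And>m \<omega>. \<omega> \<in> space (obs_space \<mu>) \<Longrightarrow> one_step \<pi> \<theta> u \<Phi> m \<omega> \<le> \<Phi> m \<omega>"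
  shows "total_cost \<pi> \<theta> u \<le> \<Phi> 0 obs0"
proof -
  have "(\<Sum>m<n. \<Sum>i\<in>UNIV. ennreal (u $ i) * stage_cost \<pi> \<theta> i m) + remainder \<pi> \<Phi> n \<le> \<Phi> 0 obs0" for n
  proof (induction n)
    case 0
    then show ?case using remainder_0[where \<Phi> = \<Phi> and \<pi> = \<pi>, OF \<theta> \<Phi>] by (simp del: obs_iter.simps)
  next
    case (Suc n)
    have "(\<Sum>i\<in>UNIV. ennreal (u $ i) * stage_cost \<pi> \<theta> i n) + remainder \<pi> \<Phi> (Suc n) =
        (\<integral>\<^sup>+\<omega>. ennreal (continue_prob \<pi> n \<omega>) * one_step \<pi> \<theta> u \<Phi> n \<omega> \<partial>obs_iter n)"
      by (rule one_step_integral[OF \<pi> u \<theta> \<Phi>, symmetric])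
    also have "\<dots> \<le> remainder \<pi> \<Phi> n"
      by (intro nn_integral_mono mult_left_mono ge) auto
    finally have "(\<Sum>m<n. \<Sum>i\<in>UNIV. ennreal (u $ i) * stage_cost \<pi> \<theta> i m) +
      ((\<Sum>i\<in>UNIV. ennreal (u $ i) * stage_cost \<pi> \<theta> i n) + remainder \<pi> \<Phi> (Suc n)) \<le> 
      (\<Sum>m<n. \<Sum>i\<in>UNIV. ennreal (u $ i) * stage_cost \<pi> \<theta> i m) + remainder \<pi> \<Phi> n"
      by (rule add_left_mono)
    also note Suc
    finally show ?case by (simp add: add.assoc del: obs_iter.simps)
  qed
  note partial = this
  have "(\<Sum>m<n. \<Sum>i\<in>UNIV. ennreal (u $ i) * stage_cost \<pi> \<theta> i m) \<le> \<Phi> 0 obs0" for n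
    by (rule order_trans[OF _ partial[of n]]) (simp add: add_increasing2)
  then show ?thesis
    unfolding total_eq_suminf by (intro suminf_le_const) auto
qed

text \<open>
  Backward induction over \<open>n\<close> stages with the iterates \<open>cost_iter (n - m)\<close> as costs-to-go: the minimum
  in the cost equation lies below the convex combination of stopping and continuing that the policy
  chooses, and the cost-to-go \<open>0\<close> at the end of the horizon lies below whatever the policy incurs later.
\<close>

theorem rho_le_total:
  assumes \<pi>: "\<pi> \<in> policies \<mu>" and u: "u \<in> nonneg_vecs" and \<theta>: "\<theta> \<in> space MT"
  shows "ennreal (\<rho> u \<theta>) \<le> total_cost \<pi> \<theta> u"
proof -
  have "cost_iter n u \<theta> \<le> total_cost \<pi> \<theta> u" for n
  proof -
    define \<Phi> where "\<Phi> m \<omega> = cost_iter (n - m) (weight_seq \<xi> p u \<theta> \<omega> m) (stat_seq \<xi> \<theta> \<omega> m)" for m \<omega>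
    have m: "\<Phi> m \<in> borel_measurable (obs_space \<mu>)" for m
      unfolding \<Phi>_def by (rule cost_iter_measurable[OF weight_seq_measurable[OF u \<theta>] stat_seq_measurable[OF \<theta>]])
    have "\<Phi> 0 obs0 \<le> (\<Sum>m<n. \<Sum>i\<in>UNIV. ennreal (u $ i) * stage_cost \<pi> \<theta> i m) + remainder \<pi> \<Phi> n"
    proof (rule telescope_le[where \<Phi> = \<Phi>, OF \<pi> u \<theta> m])
      fix m \<omega> assume "m < n" and \<omega>: "\<omega> \<in> space (obs_space \<mu>)"
      then have n: "n - m = Suc (n - Suc m)" by simp
      note b = policies_bounds[OF \<pi> \<omega>]
      show "\<Phi> m \<omega> \<le> one_step \<pi> \<theta> u \<Phi> m \<omega>"
        unfolding one_step_def
      proof (intro convex_comb_ge_ennreal b)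
        have "\<Phi> m \<omega> \<le> ennreal (g (weight_seq \<xi> p u \<theta> \<omega> m))"
          unfolding \<Phi>_def n by simp
        also have "\<dots> \<le> ennreal (error_cost lam (weight_seq \<xi> p u \<theta> \<omega> m) (snd \<pi> m \<omega>))"
          by (intro ennreal_leI g_cost_le_error_cost b)
        finally show "\<Phi> m \<omega> \<le> \<dots>" .
        show "\<Phi> m \<omega> \<le> ennreal (weight_seq \<xi> p u \<theta> \<omega> m $ None) + (\<integral>\<^sup>+y. \<Phi> (Suc m) (fun_upd \<omega> m y) \<partial>\<mu>)"
          unfolding \<Phi>_def n by (simp add: weight_seq_upd stat_seq_upd fun_upd_same del: fun_upd_apply)
      qed
    qed
    also have "remainder \<pi> \<Phi> n = 0" by (simp add: \<Phi>_def)
    also have "(\<Sum>m<n. \<Sum>i\<in>UNIV. ennreal (u $ i) * stage_cost \<pi> \<theta> i m) + 0 \<le> total_cost \<pi> \<theta> u"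
      unfolding total_eq_suminf by (simp add: sum_le_suminf)
    finally show ?thesis by (simp add: \<Phi>_def)
  qed
  then show ?thesis unfolding rho_eq_SUP_cost_iter[OF u \<theta>] by (intro SUP_least)
qed

text \<open>
  The pointwise conditions in the characterization of optimal tests. Minimality of the expected cost is
  a consequence, see \<open>optimal_policies_eq_greedy\<close>.
\<close>

definition greedy :: "('t, 'k) hom_policy \<Rightarrow> bool" where
  "greedy \<pi> \<longleftrightarrow> \<pi> \<in> hom_policies MT \<and>
     (\<forall>z\<in>nonneg_vecs. \<forall>\<theta>\<in>space MT.
        (g z < cont z \<theta> \<longrightarrow> fst \<pi> z \<theta> = 1) \<and> (g z > cont z \<theta> \<longrightarrow> fst \<pi> z \<theta> = 0)) \<and>
     (\<forall>z\<in>nonneg_vecs. \<forall>k. G_cost lam k z \<noteq> g z \<longrightarrow> snd \<pi> z k = 0)"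

abbreviation run :: "('t, 'k) hom_policy \<Rightarrow> real ^ 'k option \<Rightarrow> 't \<Rightarrow> ('x, 'k) policy" where
  "run \<equiv> run_policy \<xi> p"

lemma hom_policiesD:
  assumes "\<pi> \<in> hom_policies MT" "z \<in> nonneg_vecs"
  shows "\<theta> \<in> space MT \<Longrightarrow> 0 \<le> fst \<pi> z \<theta>" "\<theta> \<in> space MT \<Longrightarrow> fst \<pi> z \<theta> \<le> 1"
    and "0 \<le> snd \<pi> z k" "(\<Sum>k\<in>UNIV. snd \<pi> z k) = 1"
  using assms unfolding hom_policies_def by (cases \<pi>; auto)+

lemma hom_policies_measurable:
  assumes "\<pi> \<in> hom_policies MT"
  shows "f \<in> M \<rightarrow>\<^sub>M orthant \<Longrightarrow> t \<in> M \<rightarrow>\<^sub>M MT \<Longrightarrow> (\<lambda>w. fst \<pi> (f w) (t w)) \<in> borel_measurable M"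
    and "f \<in> M \<rightarrow>\<^sub>M orthant \<Longrightarrow> (\<lambda>w. snd \<pi> (f w) k) \<in> borel_measurable M"
proof -
  have 1: "(\<lambda>(z, \<theta>). fst \<pi> z \<theta>) \<in> borel_measurable (orthant \<Otimes>\<^sub>M MT)"
    and 2: "(\<lambda>z. snd \<pi> z k) \<in> borel_measurable orthant"
    using assms unfolding hom_policies_def rho_space_def by (cases \<pi>; auto)+
  show "(\<lambda>w. fst \<pi> (f w) (t w)) \<in> borel_measurable M" if "f \<in> M \<rightarrow>\<^sub>M orthant" "t \<in> M \<rightarrow>\<^sub>M MT"
    using measurable_compose[OF measurable_Pair[OF that] 1] by simp
  show "(\<lambda>w. snd \<pi> (f w) k) \<in> borel_measurable M" if "f \<in> M \<rightarrow>\<^sub>M orthant"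
    using measurable_compose[OF that 2] .
qed

lemma run_in_policies:
  assumes \<pi>: "\<pi> \<in> hom_policies MT" and z: "z \<in> nonneg_vecs" and \<theta>: "\<theta> \<in> space MT"
  shows "run \<pi> z \<theta> \<in> policies \<mu>"
  unfolding policies_def run_policy_def mem_Collect_eq prod.case
proof (intro allI conjI ballI)
  show "(\<lambda>\<omega>. fst \<pi> (weight_seq \<xi> p z \<theta> \<omega> n) (stat_seq \<xi> \<theta> \<omega> n)) \<in> borel_measurable (obs_filtration \<mu> n)" for n
    by (rule hom_policies_measurable(1)[OF \<pi> weight_seq_filtration[OF z \<theta>] stat_seq_filtration[OF \<theta>]])
  show "(\<lambda>\<omega>. snd \<pi> (weight_seq \<xi> p z \<theta> \<omega> n) k) \<in> borel_measurable (obs_filtration \<mu> n)" for n k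
    by (rule hom_policies_measurable(2)[OF \<pi> weight_seq_filtration[OF z \<theta>]])
qed (use hom_policiesD[OF \<pi> weight_seq_nonneg[OF z \<theta>]] stat_seq_space[OF \<theta>] in auto)

text \<open>
  Along the run of such a test \<open>\<rho>\<close> solves the one-step recursion exactly.
\<close>

theorem greedy_total_le_rho:
  assumes gr: "greedy \<pi>" and z: "z \<in> nonneg_vecs" and \<theta>: "\<theta> \<in> space MT"
  shows "total_cost (run \<pi> z \<theta>) \<theta> z \<le> ennreal (\<rho> z \<theta>)"
proof -
  have \<pi>: "\<pi> \<in> hom_policies MT" using gr by (simp add: greedy_def)
  define \<Phi> where "\<Phi> m \<omega> = ennreal (\<rho> (weight_seq \<xi> p z \<theta> \<omega> m) (stat_seq \<xi> \<theta> \<omega> m))" for m \<omega>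
  have m: "\<Phi> m \<in> borel_measurable (obs_space \<mu>)" for m
    unfolding \<Phi>_def by (rule measurable_compose[OF rho_measurable[OF weight_seq_measurable[OF z \<theta>] stat_seq_measurable[OF \<theta>]] measurable_ennreal])
  have "total_cost (run \<pi> z \<theta>) \<theta> z \<le> \<Phi> 0 obs0"
  proof (rule telescope_ge[where \<Phi> = \<Phi>, OF run_in_policies[OF \<pi> z \<theta>] z \<theta> m])
    fix m \<omega> assume \<omega>: "\<omega> \<in> space (obs_space \<mu>)"
    define w where "w = weight_seq \<xi> p z \<theta> \<omega> m"
    define t where "t = stat_seq \<xi> \<theta> \<omega> m"
    have w: "w \<in> nonneg_vecs" and t: "t \<in> space MT"
      unfolding w_def t_def by (rule weight_seq_nonneg[OF z \<theta> \<omega>], rule stat_seq_space[OF \<theta> \<omega>])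
    have err: "error_cost lam w (snd \<pi> w) = g w"
      using gr w hom_policiesD[OF \<pi> w] by (intro error_cost_eq_g_cost) (auto simp: greedy_def)
    have "one_step (run \<pi> z \<theta>) \<theta> z \<Phi> m \<omega> = ennreal (fst \<pi> w t) * ennreal (g w) + ennreal (1 - fst \<pi> w t) * ennreal (cont w t)"
      unfolding one_step_def \<Phi>_def cont_eq[OF w t]
      by (simp add: run_policy_def weight_seq_upd stat_seq_upd w_def[symmetric] t_def[symmetric] err fun_upd_same del: fun_upd_apply)
    also have "\<dots> = ennreal (\<rho> w t)"
      using gr w t hom_policiesD[OF \<pi> w] convex_comb_eq_ennreal[of "fst \<pi> w t"]
      by (cases "g w" "cont w t" rule: linorder_cases) (auto simp: rho_eq greedy_def)
    finally show "one_step (run \<pi> z \<theta>) \<theta> z \<Phi> m \<omega> \<le> \<Phi> m \<omega>"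
      by (simp add: \<Phi>_def w_def t_def)
  qed
  then show ?thesis by (simp add: \<Phi>_def)
qed

lemma greedy_total_eq_rho:
  assumes "greedy \<pi>" and "z \<in> nonneg_vecs" and "\<theta> \<in> space MT"
  shows "total_cost (run \<pi> z \<theta>) \<theta> z = ennreal (\<rho> z \<theta>)"
proof (rule antisym)
  show "ennreal (\<rho> z \<theta>) \<le> total_cost (run \<pi> z \<theta>) \<theta> z"
    using assms by (intro rho_le_total run_in_policies) (auto simp: greedy_def)
qed (rule greedy_total_le_rho[OF assms])

lemma nonneg_comb: "u \<in> nonneg_vecs \<Longrightarrow> v \<in> nonneg_vecs \<Longrightarrow> 0 \<le> s \<Longrightarrow> 0 \<le> t \<Longrightarrow> s *\<^sub>R u + t *\<^sub>R v \<in> nonneg_vecs"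
  by (auto simp: nonneg_vecs_def)

lemma total_comb:
  assumes "u \<in> nonneg_vecs" "v \<in> nonneg_vecs" "0 \<le> s" "0 \<le> t"
  shows "total_cost \<pi> \<theta> (s *\<^sub>R u + t *\<^sub>R v) = ennreal s * total_cost \<pi> \<theta> u + ennreal t * total_cost \<pi> \<theta> v"
  unfolding total_cost_def using assms
  by (simp add: sum_distrib_left sum.distrib[symmetric] ennreal_plus ennreal_mult' nonneg_vecsD distrib_right mult.assoc)

section \<open>Directional derivatives and tie-breaking tests\<close>

text \<open>
  The derivative of \<open>\<rho>\<close> at \<open>z\<close> in the direction \<open>d\<close>. By homogeneity
  \<open>\<rho> (N z + d) - N \<rho> z = N (\<rho> (z + d / N) - \<rho> z)\<close>, the difference quotient with step \<open>1 / N\<close>. In the form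
  without division the quotients increase in \<open>N\<close> directly by superadditivity (\<open>difference_mono\<close>).
\<close>

definition dir_deriv :: "real ^ 'k option \<Rightarrow> real ^ 'k option \<Rightarrow> 't \<Rightarrow> ennreal" where
  "dir_deriv z d \<theta> = (SUP N. ennreal (\<rho> (real N *\<^sub>R z + d) \<theta> - real N * \<rho> z \<theta>))"

text \<open>
  The derivative of the cost of continuing in the direction \<open>d\<close>, see \<open>cont_difference_tendsto\<close>.
\<close>

definition cont_deriv :: "real ^ 'k option \<Rightarrow> real ^ 'k option \<Rightarrow> 't \<Rightarrow> ennreal" where
  "cont_deriv z d \<theta> = ennreal (d $ None) + (\<integral>\<^sup>+x. dir_deriv (upd z \<theta> x) (upd d \<theta> x) (\<xi> \<theta> x) \<partial>\<mu>)"

text \<open>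
  The directions in which derivatives are taken: \<open>z\<^sub>i e\<^sub>i\<close> is \<open>mask {i} z\<close> and \<open>z - z\<^sub>i e\<^sub>i\<close> is \<open>mask (- {i}) z\<close>.
  These are functions of \<open>z\<close> and commute with the update of the weights, so a test that
  only knows the current \<open>z\<close> can use the direction that has been carried along from its start.
\<close>

definition mask :: "'k option set \<Rightarrow> real ^ 'k option \<Rightarrow> real ^ 'k option" where
  "mask S z = (\<chi> i. if i \<in> S then z $ i else 0)"

text \<open>
  The optimal decisions whose cost grows least in the direction \<open>d\<close>.
\<close>

definition best :: "real ^ 'k option \<Rightarrow> real ^ 'k option \<Rightarrow> 'k set" where
  "best z d = {k. G_cost lam k z = g z \<and> (\<forall>j. G_cost lam j z = g z \<longrightarrow> G_cost lam k d \<le> G_cost lam j d)}"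

definition mask_decision :: "'k option set \<Rightarrow> real ^ 'k option \<Rightarrow> 'k \<Rightarrow> real" where
  "mask_decision S z k = (if k \<in> best z (mask S z) then 1 / real (card (best z (mask S z))) else 0)"

text \<open>
  The test that resolves all ties in the optimality conditions in favour of the alternative with the
  smaller derivative in the direction \<open>mask S z\<close>; ties among the best decisions are split evenly.
\<close>

definition mask_policy :: "'k option set \<Rightarrow> ('t, 'k) hom_policy" where
  "mask_policy S = (\<lambda>z \<theta>. if g z < cont z \<theta> \<or>
      g z = cont z \<theta> \<and> ennreal (error_cost lam (mask S z) (mask_decision S z)) \<le> cont_deriv z (mask S z) \<theta>
      then 1 else 0, mask_decision S)"

lemma mask_nonneg: "z \<in> nonneg_vecs \<Longrightarrow> mask S z \<in> nonneg_vecs"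
  by (auto simp: nonneg_vecs_def mask_def)

lemma mask_upd: "upd (mask S z) \<theta> x = mask S (upd z \<theta> x)"
  by (auto simp: mask_def vec_mult_def vec_eq_iff)

lemma mask_measurable [measurable (raw)]:
  assumes f: "f \<in> M \<rightarrow>\<^sub>M orthant"
  shows "(\<lambda>w. mask S (f w)) \<in> M \<rightarrow>\<^sub>M orthant"
proof (rule measurable_nonneg_vecsI)
  show "(\<lambda>w. mask S (f w) $ i) \<in> borel_measurable M" for i
    using measurable_nonneg_vecs_nth[OF f, of i] by (cases "i \<in> S") (auto simp: mask_def)
  show "mask S (f w) \<in> nonneg_vecs" if "w \<in> space M" for w
    using measurable_space[OF f that] by (simp add: mask_nonneg)
qed

lemma comb_measurable [measurable (raw)]:
  assumes f: "f \<in> M \<rightarrow>\<^sub>M orthant" and f': "f' \<in> M \<rightarrow>\<^sub>M orthant"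
  shows "(\<lambda>w. real N *\<^sub>R f w + f' w) \<in> M \<rightarrow>\<^sub>M orthant"
proof (rule measurable_nonneg_vecsI)
  note [measurable] = measurable_nonneg_vecs_nth[OF f] measurable_nonneg_vecs_nth[OF f']
  show "(\<lambda>w. (real N *\<^sub>R f w + f' w) $ i) \<in> borel_measurable M" for i
    by simp
  show "real N *\<^sub>R f w + f' w \<in> nonneg_vecs" if "w \<in> space M" for w
    using measurable_space[OF f that] measurable_space[OF f' that] nonneg_comb[of "f w" "f' w" "real N" 1] by simp
qed

lemma dir_deriv_measurable [measurable (raw)]:
  assumes "f \<in> M \<rightarrow>\<^sub>M orthant" "f' \<in> M \<rightarrow>\<^sub>M orthant" "t \<in> M \<rightarrow>\<^sub>M MT"
  shows "(\<lambda>w. dir_deriv (f w) (f' w) (t w)) \<in> borel_measurable M"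
proof -
  note [measurable] = assms
  show ?thesis unfolding dir_deriv_def by measurable
qed

lemma cont_deriv_measurable [measurable (raw)]:
  assumes "f \<in> M \<rightarrow>\<^sub>M orthant" "f' \<in> M \<rightarrow>\<^sub>M orthant" "t \<in> M \<rightarrow>\<^sub>M MT"
  shows "(\<lambda>w. cont_deriv (f w) (f' w) (t w)) \<in> borel_measurable M"
proof -
  note [measurable] = assms measurable_nonneg_vecs_nth[OF assms(2)]
  show ?thesis unfolding cont_deriv_def by measurable
qed

lemma best_measurable [measurable (raw)]:
  assumes f: "f \<in> M \<rightarrow>\<^sub>M orthant" and f': "f' \<in> M \<rightarrow>\<^sub>M orthant"
  shows "Measurable.pred M (\<lambda>w. k \<in> best (f w) (f' w))"
proof -
  note [measurable] = assms
  show ?thesis unfolding best_def mem_Collect_eq by measurable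
qed

lemma card_best: "real (card (best z d)) = (\<Sum>k\<in>UNIV. if k \<in> best z d then 1 else 0)"
  by (simp add: sum.If_cases)

lemma mask_decision_measurable [measurable (raw)]:
  assumes f: "f \<in> M \<rightarrow>\<^sub>M orthant"
  shows "(\<lambda>w. mask_decision S (f w) k) \<in> borel_measurable M"
proof -
  note [measurable] = assms
  show ?thesis unfolding mask_decision_def card_best by measurable
qed

lemma best_nonempty: "best z d \<noteq> {}"
proof -
  define A where "A = {k. G_cost lam k z = g z}"
  have "A \<noteq> {}" using g_cost_attained[of lam z] by (auto simp: A_def)
  then have "Min ((\<lambda>k. G_cost lam k d) ` A) \<in> (\<lambda>k. G_cost lam k d) ` A" by (intro Min_in) auto
  then obtain k where k: "k \<in> A" "G_cost lam k d = Min ((\<lambda>k. G_cost lam k d) ` A)" by auto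
  have "G_cost lam k d \<le> G_cost lam j d" if "j \<in> A" for j
    unfolding k(2) using that by (intro Min_le) auto
  then have "k \<in> best z d" using k(1) by (auto simp: best_def A_def)
  then show ?thesis by auto
qed

lemma mask_decision_sum: "(\<Sum>k\<in>UNIV. mask_decision S z k) = 1"
  using best_nonempty[of z "mask S z"] by (simp add: mask_decision_def sum.If_cases card_gt_0_iff)

lemma mask_decision_error_le:
  assumes "G_cost lam j z = g z"
  shows "error_cost lam (mask S z) (mask_decision S z) \<le> G_cost lam j (mask S z)"
proof -
  have "error_cost lam (mask S z) (mask_decision S z) = (\<Sum>k\<in>UNIV. mask_decision S z k * G_cost lam k (mask S z))"
    by (rule error_cost_eq[OF mask_decision_sum])
  also have "\<dots> \<le> (\<Sum>k\<in>UNIV. mask_decision S z k * G_cost lam j (mask S z))"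
    using assms by (intro sum_mono) (auto simp: mask_decision_def best_def intro!: divide_right_mono)
  also have "\<dots> = G_cost lam j (mask S z)" by (simp add: sum_distrib_right[symmetric] mask_decision_sum)
  finally show ?thesis .
qed

lemma mask_policy_greedy: "greedy (mask_policy S)"
  unfolding greedy_def
proof (intro conjI ballI allI impI)
  show "mask_policy S \<in> hom_policies MT"
    unfolding hom_policies_def mask_policy_def mem_Collect_eq prod.case
  proof (intro conjI ballI allI)
    show "(\<lambda>(z, \<theta>). if g z < cont z \<theta> \<or> g z = cont z \<theta> \<and>
        ennreal (error_cost lam (mask S z) (mask_decision S z)) \<le> cont_deriv z (mask S z) \<theta> then 1 else 0 :: real)
      \<in> borel_measurable (rho_space MT)"
    proof -
      have [measurable]: "fst \<in> orthant \<Otimes>\<^sub>M MT \<rightarrow>\<^sub>M orthant" by measurable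
      have [measurable]: "(\<lambda>w. mask S (fst w) $ i) \<in> borel_measurable (orthant \<Otimes>\<^sub>M MT)" for i
        by (rule measurable_nonneg_vecs_nth) measurable
      show ?thesis
        unfolding rho_space_def case_prod_unfold error_cost_def by measurable
    qed
    show "(\<lambda>z. mask_decision S z k) \<in> borel_measurable orthant" for k by measurable
  qed (auto simp: mask_decision_sum, auto simp: mask_decision_def)
qed (auto simp: mask_policy_def mask_decision_def best_def)

text \<open>
  At \<open>s z + t z'\<close> the cost function equals a linear form, the cost of one fixed policy, and this form
  dominates the cost function at \<open>z\<close> and at \<open>z'\<close>.
\<close>

lemma rho_superlinear:
  assumes z: "z \<in> nonneg_vecs" "z' \<in> nonneg_vecs" and s: "0 \<le> s" "0 \<le> t" and \<theta>: "\<theta> \<in> space MT"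
  shows "s * \<rho> z \<theta> + t * \<rho> z' \<theta> \<le> \<rho> (s *\<^sub>R z + t *\<^sub>R z') \<theta>"
proof -
  \<comment> \<open>any test satisfying the optimality conditions would do\<close>
  define \<pi> where "\<pi> = run (mask_policy {}) (s *\<^sub>R z + t *\<^sub>R z') \<theta>"
  note n = nonneg_comb[OF z s]
  have \<pi>: "\<pi> \<in> policies \<mu>"
    unfolding \<pi>_def using mask_policy_greedy n \<theta> by (intro run_in_policies) (auto simp: greedy_def)
  have "ennreal (s * \<rho> z \<theta> + t * \<rho> z' \<theta>) = ennreal s * ennreal (\<rho> z \<theta>) + ennreal t * ennreal (\<rho> z' \<theta>)"
    using s z \<theta> by (simp add: ennreal_plus ennreal_mult rho_nonneg)
  also have "\<dots> \<le> ennreal s * total_cost \<pi> \<theta> z + ennreal t * total_cost \<pi> \<theta> z'"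
    by (intro add_mono mult_left_mono rho_le_total \<pi> z \<theta>) auto
  also have "\<dots> = total_cost \<pi> \<theta> (s *\<^sub>R z + t *\<^sub>R z')" by (rule total_comb[OF z s, symmetric])
  also have "\<dots> = ennreal (\<rho> (s *\<^sub>R z + t *\<^sub>R z') \<theta>)"
    unfolding \<pi>_def by (rule greedy_total_eq_rho[OF mask_policy_greedy n \<theta>])
  finally show ?thesis using rho_nonneg[OF n \<theta>] by simp
qed

lemma rho_scale:
  assumes z: "z \<in> nonneg_vecs" and \<theta>: "\<theta> \<in> space MT" and s: "0 < s"
  shows "\<rho> (s *\<^sub>R z) \<theta> = s * \<rho> z \<theta>"
proof (rule antisym)
  show "s * \<rho> z \<theta> \<le> \<rho> (s *\<^sub>R z) \<theta>" using rho_superlinear[OF z z, of s 0] s \<theta> by simp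
  have "s *\<^sub>R z \<in> nonneg_vecs" using nonneg_comb[OF z z, of s 0] s by simp
  from rho_superlinear[OF this this, of "1/s" 0] show "\<rho> (s *\<^sub>R z) \<theta> \<le> s * \<rho> z \<theta>"
    using s \<theta> by (simp add: field_simps)
qed

lemma difference_mono:
  assumes z: "z \<in> nonneg_vecs" and d: "d \<in> nonneg_vecs" and \<theta>: "\<theta> \<in> space MT"
  shows "0 \<le> \<rho> (real N *\<^sub>R z + d) \<theta> - real N * \<rho> z \<theta>"
    and "\<rho> (real N *\<^sub>R z + d) \<theta> - real N * \<rho> z \<theta> \<le> \<rho> (real (Suc N) *\<^sub>R z + d) \<theta> - real (Suc N) * \<rho> z \<theta>"
proof -
  show "0 \<le> \<rho> (real N *\<^sub>R z + d) \<theta> - real N * \<rho> z \<theta>"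
    using rho_superlinear[OF z d _ _ \<theta>, of "real N" 1] rho_nonneg[OF d \<theta>] by simp
  have n: "real N *\<^sub>R z + d \<in> nonneg_vecs" using nonneg_comb[OF z d, of "real N" 1] by simp
  have eq: "z + (real N *\<^sub>R z + d) = real (Suc N) *\<^sub>R z + d" by (simp add: algebra_simps)
  show "\<rho> (real N *\<^sub>R z + d) \<theta> - real N * \<rho> z \<theta> \<le> \<rho> (real (Suc N) *\<^sub>R z + d) \<theta> - real (Suc N) * \<rho> z \<theta>"
    using rho_superlinear[OF z n _ _ \<theta>, of 1 1] unfolding scaleR_one eq by (simp add: algebra_simps)
qed

section \<open>The recursion for directional derivatives\<close>

lemma upd_comb: "upd (s *\<^sub>R z + z') \<theta> x = s *\<^sub>R upd z \<theta> x + upd z' \<theta> x"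
  by (simp add: vec_mult_def vec_eq_iff algebra_simps)

lemma cont_difference:
  fixes N :: nat
  assumes z: "z \<in> nonneg_vecs" and d: "d \<in> nonneg_vecs" and \<theta>: "\<theta> \<in> space MT"
  shows "ennreal (cont (real N *\<^sub>R z + d) \<theta> - real N * cont z \<theta>) = ennreal (d $ None) +
      (\<integral>\<^sup>+x. ennreal (\<rho> (real N *\<^sub>R upd z \<theta> x + upd d \<theta> x) (\<xi> \<theta> x) - real N * \<rho> (upd z \<theta> x) (\<xi> \<theta> x)) \<partial>\<mu>)"
    (is "_ = ?X")
    and "real N * cont z \<theta> \<le> cont (real N *\<^sub>R z + d) \<theta>"
proof -
  have n: "real N *\<^sub>R z + d \<in> nonneg_vecs" using nonneg_comb[OF z d, of "real N" 1] by simp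
  let ?r = "\<lambda>x. ennreal (\<rho> (upd z \<theta> x) (\<xi> \<theta> x))"
  let ?q = "\<lambda>x. ennreal (\<rho> (real N *\<^sub>R upd z \<theta> x + upd d \<theta> x) (\<xi> \<theta> x) - real N * \<rho> (upd z \<theta> x) (\<xi> \<theta> x))"
  have [measurable]: "z \<in> space orthant" "d \<in> space orthant" "\<theta> \<in> space MT" using z d \<theta> by auto
  have split: "ennreal (\<rho> (upd (real N *\<^sub>R z + d) \<theta> x) (\<xi> \<theta> x)) = ennreal (real N) * ?r x + ?q x" if x: "x \<in> space \<mu>" for x
    using rho_nonneg[OF upd_nonneg[OF z \<theta> x] xi_space[OF \<theta> x]]
      difference_mono(1)[OF upd_nonneg[OF z \<theta> x] upd_nonneg[OF d \<theta> x] xi_space[OF \<theta> x], of N]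
    by (simp add: upd_comb ennreal_mult[symmetric] ennreal_plus[symmetric] del: ennreal_plus)
  have "ennreal (cont (real N *\<^sub>R z + d) \<theta>) =
      ennreal ((real N *\<^sub>R z + d) $ None) + (\<integral>\<^sup>+x. ennreal (\<rho> (upd (real N *\<^sub>R z + d) \<theta> x) (\<xi> \<theta> x)) \<partial>\<mu>)"
    by (rule cont_eq[OF n \<theta>])
  also have "(\<integral>\<^sup>+x. ennreal (\<rho> (upd (real N *\<^sub>R z + d) \<theta> x) (\<xi> \<theta> x)) \<partial>\<mu>) = (\<integral>\<^sup>+x. ennreal (real N) * ?r x + ?q x \<partial>\<mu>)"
    by (intro nn_integral_cong split)
  also have "\<dots> = ennreal (real N) * (\<integral>\<^sup>+x. ?r x \<partial>\<mu>) + (\<integral>\<^sup>+x. ?q x \<partial>\<mu>)"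
    by (subst nn_integral_add) (auto simp: nn_integral_cmult)
  also have "ennreal ((real N *\<^sub>R z + d) $ None) = ennreal (real N) * ennreal (z $ None) + ennreal (d $ None)"
    using z d by (simp add: ennreal_mult ennreal_plus nonneg_vecsD)
  also have "ennreal (real N) * ennreal (z $ None) + ennreal (d $ None) +
      (ennreal (real N) * (\<integral>\<^sup>+x. ?r x \<partial>\<mu>) + (\<integral>\<^sup>+x. ?q x \<partial>\<mu>)) = ennreal (real N) * ennreal (cont z \<theta>) + ?X"
    unfolding cont_eq[OF z \<theta>] distrib_left by (simp only: add_ac)
  also have "ennreal (real N) * ennreal (cont z \<theta>) = ennreal (real N * cont z \<theta>)"
    by (simp add: ennreal_mult cont_nonneg[OF z \<theta>])
  finally have eq: "ennreal (cont (real N *\<^sub>R z + d) \<theta>) = ennreal (real N * cont z \<theta>) + ?X" .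
  then have "ennreal (real N * cont z \<theta>) \<le> ennreal (cont (real N *\<^sub>R z + d) \<theta>)"
    by (simp add: le_iff_add)
  then show "real N * cont z \<theta> \<le> cont (real N *\<^sub>R z + d) \<theta>"
    using cont_nonneg[OF n \<theta>] by simp
  have "ennreal (cont (real N *\<^sub>R z + d) \<theta> - real N * cont z \<theta>) =
      ennreal (cont (real N *\<^sub>R z + d) \<theta>) - ennreal (real N * cont z \<theta>)"
    by (rule ennreal_minus[symmetric]) (simp add: cont_nonneg[OF z \<theta>])
  also have "\<dots> = ?X"
    unfolding eq by (rule ennreal_add_diff_cancel_left) simp
  finally show "ennreal (cont (real N *\<^sub>R z + d) \<theta> - real N * cont z \<theta>) = ?X" .
qed

lemma cont_difference_tendsto:
  assumes z: "z \<in> nonneg_vecs" and d: "d \<in> nonneg_vecs" and \<theta>: "\<theta> \<in> space MT"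
  shows "(\<lambda>N::nat. ennreal (cont (real N *\<^sub>R z + d) \<theta> - real N * cont z \<theta>)) \<longlonglongrightarrow> cont_deriv z d \<theta>"
proof -
  let ?q = "\<lambda>N x. ennreal (\<rho> (real N *\<^sub>R upd z \<theta> x + upd d \<theta> x) (\<xi> \<theta> x) - real N * \<rho> (upd z \<theta> x) (\<xi> \<theta> x))"
  have [measurable]: "z \<in> space orthant" "d \<in> space orthant" "\<theta> \<in> space MT" using z d \<theta> by auto
  have mono: "?q N x \<le> ?q (Suc N) x" if "x \<in> space \<mu>" for N x
    by (intro ennreal_leI difference_mono(2) upd_nonneg z d \<theta> xi_space that)
  have "(\<integral>\<^sup>+x. dir_deriv (upd z \<theta> x) (upd d \<theta> x) (\<xi> \<theta> x) \<partial>\<mu>) = (SUP N. \<integral>\<^sup>+x. ?q N x \<partial>\<mu>)"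
    unfolding dir_deriv_def
    by (rule nn_integral_monotone_convergence_SUP_AE) (auto intro!: AE_I2 mono simp del: of_nat_Suc)
  moreover have "incseq (\<lambda>N. \<integral>\<^sup>+x. ?q N x \<partial>\<mu>)"
    by (intro incseq_SucI nn_integral_mono mono)
  ultimately have "(\<lambda>N. \<integral>\<^sup>+x. ?q N x \<partial>\<mu>) \<longlonglongrightarrow> (\<integral>\<^sup>+x. dir_deriv (upd z \<theta> x) (upd d \<theta> x) (\<xi> \<theta> x) \<partial>\<mu>)"
    by (simp only: LIMSEQ_SUP)
  then show ?thesis
    unfolding cont_difference(1)[OF z d \<theta>] cont_deriv_def by (intro tendsto_add tendsto_const)
qed

text \<open>
  The quotient \<open>\<rho> (N z + d) - N \<rho> z\<close> is the minimum of the corresponding quotients for deciding for some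
  \<open>k\<close> and for continuing. An alternative that is not active at \<open>z\<close> costs more than \<open>\<rho> z\<close>, so its quotient
  tends to infinity; the quotient of an active one tends to its own derivative. As there are finitely
  many alternatives, any number below all active derivatives is eventually below the minimum. The lemma
  also covers boundary points at which \<open>\<rho>\<close> jumps, where the derivative is infinite.
\<close>

lemma dir_deriv_ge:
  assumes z: "z \<in> nonneg_vecs" and d: "d \<in> nonneg_vecs" and \<theta>: "\<theta> \<in> space MT"
    and G: "\<And>k. G_cost lam k z = \<rho> z \<theta> \<Longrightarrow> y \<le> ennreal (G_cost lam k d)"
    and C: "cont z \<theta> = \<rho> z \<theta> \<Longrightarrow> y \<le> cont_deriv z d \<theta>"
  shows "y \<le> dir_deriv z d \<theta>"
proof (rule dense_le)
  \<comment> \<open>it suffices to show that every real number \<open>r\<close> below \<open>y\<close> is below some quotient\<close>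
  fix x assume "x < y"
  then have "x < top" using top_greatest order_less_le_trans by blast
  then obtain r where r: "0 \<le> r" "x = ennreal r" by (cases x) auto
  have large: "\<forall>\<^sub>F N::nat in sequentially. r \<le> real N * a" if "a > 0" for a
  proof -
    have "filterlim (\<lambda>N. real N * a) at_top sequentially"
      using that by (intro filterlim_at_top_mult_tendsto_pos[OF tendsto_const] filterlim_real_sequentially)
    then show ?thesis by (simp add: filterlim_at_top)
  qed
  have evG: "\<forall>\<^sub>F N::nat in sequentially. r \<le> G_cost lam k (real N *\<^sub>R z + d) - real N * \<rho> z \<theta>" for k
  proof (cases "G_cost lam k z = \<rho> z \<theta>")
    case True
    have "ennreal r \<le> ennreal (G_cost lam k d)" using \<open>x < y\<close> G[OF True] r by simp
    then have "r \<le> G_cost lam k d" using G_nonneg[OF d] by simp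
    then show ?thesis using True by (simp add: G_cost_add G_cost_scaleR)
  next
    case False
    have "\<rho> z \<theta> \<le> G_cost lam k z" using rho_le_g[OF z \<theta>] g_cost_le order_trans by blast
    then have "\<forall>\<^sub>F N::nat in sequentially. r \<le> real N * (G_cost lam k z - \<rho> z \<theta>)" using False by (intro large) simp
    then show ?thesis
      by eventually_elim (use G_nonneg[OF d, of k] in \<open>simp add: G_cost_add G_cost_scaleR algebra_simps\<close>)
  qed
  have evC: "\<forall>\<^sub>F N::nat in sequentially. r \<le> cont (real N *\<^sub>R z + d) \<theta> - real N * \<rho> z \<theta>"
  proof (cases "cont z \<theta> = \<rho> z \<theta>")
    case True
    have "ennreal r < cont_deriv z d \<theta>" using \<open>x < y\<close> C[OF True] r by simp
    from order_tendstoD(1)[OF cont_difference_tendsto[OF z d \<theta>] this] show ?thesis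
    proof eventually_elim
      case (elim N)
      then show ?case using True r(1) cont_difference(2)[OF z d \<theta>, of N] by (simp add: ennreal_less_iff)
    qed
  next
    case False
    have "\<rho> z \<theta> \<le> cont z \<theta>" using rho_eq[OF z \<theta>] by simp
    then have "\<forall>\<^sub>F N::nat in sequentially. r \<le> real N * (cont z \<theta> - \<rho> z \<theta>)" using False by (intro large) simp
    then show ?thesis
    proof eventually_elim
      case (elim N)
      then show ?case using cont_difference(2)[OF z d \<theta>, of N] by (simp add: algebra_simps)
    qed
  qed
  have "\<forall>\<^sub>F N::nat in sequentially. \<forall>k. r \<le> G_cost lam k (real N *\<^sub>R z + d) - real N * \<rho> z \<theta>"
    by (rule eventually_all_finite[OF evG])
  from eventually_happens'[OF sequentially_bot eventually_conj[OF this evC]]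
  obtain N :: nat where N: "\<And>k. r \<le> G_cost lam k (real N *\<^sub>R z + d) - real N * \<rho> z \<theta>"
      "r \<le> cont (real N *\<^sub>R z + d) \<theta> - real N * \<rho> z \<theta>"
    by blast
  have "r + real N * \<rho> z \<theta> \<le> g (real N *\<^sub>R z + d)"
    unfolding le_g_cost_iff using N(1) by (simp add: algebra_simps)
  moreover have "real N *\<^sub>R z + d \<in> nonneg_vecs" using nonneg_comb[OF z d, of "real N" 1] by simp
  ultimately have "r \<le> \<rho> (real N *\<^sub>R z + d) \<theta> - real N * \<rho> z \<theta>"
    using N(2) \<theta> by (simp add: rho_eq[of "real N *\<^sub>R z + d"])
  then show "x \<le> dir_deriv z d \<theta>"
    unfolding r(2) dir_deriv_def by (intro SUP_upper2[of N] ennreal_leI) auto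
qed

text \<open>
  If the derivative along the run of a test, with the direction carried along by the likelihoods, is a
  supersolution of the one-step recursion, then it dominates the cost of the test with the direction as
  weights. \<open>Inv\<close> records what is known about the pairs of weight and direction that a run can reach.
\<close>

theorem total_le_dir_deriv:
  assumes \<pi>: "\<pi> \<in> hom_policies MT"
    and z: "z \<in> nonneg_vecs" and d: "d \<in> nonneg_vecs" and \<theta>: "\<theta> \<in> space MT"
    and Inv: "Inv z d"
    and Inv_upd: "\<And>z d \<theta> x. Inv z d \<Longrightarrow> \<theta> \<in> space MT \<Longrightarrow> x \<in> space \<mu> \<Longrightarrow> Inv (upd z \<theta> x) (upd d \<theta> x)"
    and step: "\<And>z d \<theta>. z \<in> nonneg_vecs \<Longrightarrow> d \<in> nonneg_vecs \<Longrightarrow> \<theta> \<in> space MT \<Longrightarrow> Inv z d \<Longrightarrow>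
      ennreal (fst \<pi> z \<theta>) * ennreal (error_cost lam d (snd \<pi> z)) + ennreal (1 - fst \<pi> z \<theta>) * cont_deriv z d \<theta>
        \<le> dir_deriv z d \<theta>"
  shows "total_cost (run \<pi> z \<theta>) \<theta> d \<le> dir_deriv z d \<theta>"
proof -
  define \<Phi> where "\<Phi> m \<omega> = dir_deriv (weight_seq \<xi> p z \<theta> \<omega> m) (weight_seq \<xi> p d \<theta> \<omega> m) (stat_seq \<xi> \<theta> \<omega> m)" for m \<omega>
  have m: "\<Phi> m \<in> borel_measurable (obs_space \<mu>)" for m
    unfolding \<Phi>_def by (rule dir_deriv_measurable[OF weight_seq_measurable[OF z \<theta>] weight_seq_measurable[OF d \<theta>] stat_seq_measurable[OF \<theta>]])
  have inv: "Inv (weight_seq \<xi> p z \<theta> \<omega> m) (weight_seq \<xi> p d \<theta> \<omega> m)" if "\<omega> \<in> space (obs_space \<mu>)" for m \<omega>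
  proof (induction m)
    case (Suc m)
    have "\<omega> m \<in> space \<mu>" using that by (simp add: space_obs_space)
    with Inv_upd[OF Suc stat_seq_space[OF \<theta> that]] show ?case by simp
  qed (simp add: Inv)
  have "total_cost (run \<pi> z \<theta>) \<theta> d \<le> \<Phi> 0 obs0"
  proof (rule telescope_ge[where \<Phi> = \<Phi>, OF run_in_policies[OF \<pi> z \<theta>] d \<theta> m])
    fix m \<omega> assume \<omega>: "\<omega> \<in> space (obs_space \<mu>)"
    have "one_step (run \<pi> z \<theta>) \<theta> d \<Phi> m \<omega> =
      ennreal (fst \<pi> (weight_seq \<xi> p z \<theta> \<omega> m) (stat_seq \<xi> \<theta> \<omega> m)) *
        ennreal (error_cost lam (weight_seq \<xi> p d \<theta> \<omega> m) (snd \<pi> (weight_seq \<xi> p z \<theta> \<omega> m))) +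
      ennreal (1 - fst \<pi> (weight_seq \<xi> p z \<theta> \<omega> m) (stat_seq \<xi> \<theta> \<omega> m)) *
        cont_deriv (weight_seq \<xi> p z \<theta> \<omega> m) (weight_seq \<xi> p d \<theta> \<omega> m) (stat_seq \<xi> \<theta> \<omega> m)"
      unfolding one_step_def \<Phi>_def cont_deriv_def
      by (simp add: run_policy_def weight_seq_upd stat_seq_upd fun_upd_same del: fun_upd_apply)
    also have "\<dots> \<le> \<Phi> m \<omega>"
      unfolding \<Phi>_def by (rule step[OF weight_seq_nonneg[OF z \<theta> \<omega>] weight_seq_nonneg[OF d \<theta> \<omega>] stat_seq_space[OF \<theta> \<omega>] inv[OF \<omega>]])
    finally show "one_step (run \<pi> z \<theta>) \<theta> d \<Phi> m \<omega> \<le> \<Phi> m \<omega>" .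
  qed
  then show ?thesis by (simp add: \<Phi>_def)
qed

text \<open>
  Since the test always takes the active alternative with the smallest derivative, \<open>dir_deriv_ge\<close> is
  exactly the supersolution property.
\<close>

lemma mask_policy_total_le:
  assumes z: "z \<in> nonneg_vecs" and \<theta>: "\<theta> \<in> space MT"
  shows "total_cost (run (mask_policy S) z \<theta>) \<theta> (mask S z) \<le> dir_deriv z (mask S z) \<theta>"
proof (rule total_le_dir_deriv[where Inv = "\<lambda>z d. d = mask S z"])
  fix z d \<theta> assume z: "z \<in> nonneg_vecs" and d: "d \<in> nonneg_vecs" and \<theta>: "\<theta> \<in> space MT" and inv: "d = mask S z"
  define e where "e = error_cost lam d (mask_decision S z)"
  have e: "e \<le> G_cost lam k d" if "G_cost lam k z = g z" for k
    unfolding e_def inv by (rule mask_decision_error_le[OF that])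
  let ?stop = "g z < cont z \<theta> \<or> g z = cont z \<theta> \<and> ennreal e \<le> cont_deriv z d \<theta>"
  have \<rho>: "\<rho> z \<theta> = min (g z) (cont z \<theta>)" by (rule rho_eq[OF z \<theta>])
  have \<psi>: "fst (mask_policy S) z \<theta> = (if ?stop then 1 else 0)" "snd (mask_policy S) z = mask_decision S z"
    by (simp_all add: mask_policy_def e_def inv)
  show "ennreal (fst (mask_policy S) z \<theta>) * ennreal (error_cost lam d (snd (mask_policy S) z)) +
      ennreal (1 - fst (mask_policy S) z \<theta>) * cont_deriv z d \<theta> \<le> dir_deriv z d \<theta>"
  proof (cases ?stop)
    case True
    have "ennreal e \<le> dir_deriv z d \<theta>"
    proof (rule dir_deriv_ge[OF z d \<theta>])
      have "\<rho> z \<theta> = g z" using True \<rho> by auto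
      then show "ennreal e \<le> ennreal (G_cost lam k d)" if "G_cost lam k z = \<rho> z \<theta>" for k
        using e[of k] that by (simp add: ennreal_leI)
      show "ennreal e \<le> cont_deriv z d \<theta>" if "cont z \<theta> = \<rho> z \<theta>"
      proof -
        have "cont z \<theta> \<le> g z" unfolding that by (rule rho_le_g[OF z \<theta>])
        then show ?thesis using True by auto
      qed
    qed
    then show ?thesis using True unfolding \<psi> e_def[symmetric] by simp
  next
    case False
    have "cont_deriv z d \<theta> \<le> dir_deriv z d \<theta>"
    proof (rule dir_deriv_ge[OF z d \<theta>])
      fix k assume k: "G_cost lam k z = \<rho> z \<theta>"
      have "g z \<le> \<rho> z \<theta>" unfolding k[symmetric] by (rule g_cost_le)
      then have "g z \<le> cont z \<theta>" "G_cost lam k z = g z" using \<rho> k by linarith+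
      with False have eq: "g z = cont z \<theta>" "G_cost lam k z = g z" by auto
      with False have "cont_deriv z d \<theta> \<le> ennreal e" by simp
      also have "\<dots> \<le> ennreal (G_cost lam k d)" by (intro ennreal_leI e eq)
      finally show "cont_deriv z d \<theta> \<le> ennreal (G_cost lam k d)" .
    qed simp
    moreover have "fst (mask_policy S) z \<theta> = 0"
      unfolding \<psi>(1) by (rule if_not_P[OF False])
    ultimately show ?thesis by simp
  qed
qed (use mask_policy_greedy z \<theta> in \<open>auto simp: greedy_def mask_nonneg mask_upd\<close>)

lemma cont_eq_0:
  assumes z: "z \<in> nonneg_vecs" and \<theta>: "\<theta> \<in> space MT" and 0: "z $ None = 0"
  shows "cont z \<theta> = 0"
proof -
  have "ennreal (\<rho> (upd z \<theta> x) (\<xi> \<theta> x)) = 0" if "x \<in> space \<mu>" for x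
    using rho_eq_0[OF upd_nonneg[OF z \<theta> that] xi_space[OF \<theta> that]] 0 by (simp add: vec_mult_def)
  then have "(\<integral>\<^sup>+x. ennreal (\<rho> (upd z \<theta> x) (\<xi> \<theta> x)) \<partial>\<mu>) = (\<integral>\<^sup>+x. 0 \<partial>\<mu>)"
    by (intro nn_integral_cong)
  then have "ennreal (cont z \<theta>) = 0"
    unfolding cont_eq[OF z \<theta>] using 0 by simp
  then show ?thesis using cont_nonneg[OF z \<theta>] by simp
qed

lemma axis_nonneg: "0 \<le> s \<Longrightarrow> axis i s \<in> nonneg_vecs"
  by (simp add: nonneg_vecs_def axis_def)

text \<open>
  For \<open>z\<^sub>0 = 0\<close> the direction \<open>mask {None} z\<close> vanishes, and the derivative in the direction \<open>e\<^sub>0\<close> has to be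
  treated separately. The weight \<open>z\<^sub>0\<close> then stays \<open>0\<close> and the test stops exactly when \<open>g\<close> vanishes; as
  long as \<open>g\<close> is positive, continuing is the only active alternative, so no tie has to be broken.
\<close>

lemma mask_policy_total_le_at_zero:
  assumes z: "z \<in> nonneg_vecs" and \<theta>: "\<theta> \<in> space MT" and 0: "z $ None = 0"
  shows "total_cost (run (mask_policy {None}) z \<theta>) \<theta> (axis None 1) \<le> dir_deriv z (axis None 1) \<theta>"
proof (rule total_le_dir_deriv[where Inv = "\<lambda>z d. z $ None = 0 \<and> (\<forall>k. d $ Some k = 0)"])
  fix z d :: "real ^ 'k option" and \<theta>
  assume z: "z \<in> nonneg_vecs" and d: "d \<in> nonneg_vecs" and \<theta>: "\<theta> \<in> space MT"
    and inv: "z $ None = 0 \<and> (\<forall>k. d $ Some k = 0)"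
  let ?\<pi> = "mask_policy {None} :: ('t, 'k) hom_policy"
  have err: "error_cost lam d e = 0" for e using inv by (simp add: error_cost_def)
  have "mask {None} z = 0" using inv by (simp add: mask_def vec_eq_iff)
  then have \<psi>: "fst ?\<pi> z \<theta> = (if g z = 0 then 1 else 0)"
    using cont_eq_0[OF z \<theta>] inv g_nonneg[OF z] by (auto simp: mask_policy_def error_cost_def)
  show "ennreal (fst ?\<pi> z \<theta>) * ennreal (error_cost lam d (snd ?\<pi> z)) +
      ennreal (1 - fst ?\<pi> z \<theta>) * cont_deriv z d \<theta> \<le> dir_deriv z d \<theta>"
  proof (cases "g z = 0")
    case False
    have "cont_deriv z d \<theta> \<le> dir_deriv z d \<theta>"
    proof (rule dir_deriv_ge[OF z d \<theta>])
      fix k assume "G_cost lam k z = \<rho> z \<theta>"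
      then have False using False rho_eq_0[OF z \<theta>] inv g_nonneg[OF z] g_cost_le[of lam z k] by simp
      then show "cont_deriv z d \<theta> \<le> ennreal (G_cost lam k d)" ..
    qed simp
    then show ?thesis using False by (simp add: \<psi>)
  qed (simp add: \<psi> err)
qed (use mask_policy_greedy z \<theta> 0 in \<open>auto simp: greedy_def vec_mult_def axis_nonneg\<close>, simp add: axis_def)

end

section \<open>Mixtures of tests\<close>

definition mix :: "real \<Rightarrow> ('t, 'k::finite) hom_policy \<Rightarrow> ('t, 'k) hom_policy \<Rightarrow> ('t, 'k) hom_policy" where
  "mix q \<pi> \<pi>' = (\<lambda>z \<theta>. (1 - q) * fst \<pi> z \<theta> + q * fst \<pi>' z \<theta>, \<lambda>z k. (1 - q) * snd \<pi> z k + q * snd \<pi>' z k)"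

lemma mix_0 [simp]: "mix 0 \<pi> \<pi>' = \<pi>" and mix_1 [simp]: "mix 1 \<pi> \<pi>' = \<pi>'"
  by (simp_all add: mix_def)

context sequential_test
begin

lemma greedy_hom: "greedy \<pi> \<Longrightarrow> \<pi> \<in> hom_policies MT"
  by (simp add: greedy_def)

lemma mix_greedy:
  assumes "greedy \<pi>" "greedy \<pi>'" and q: "0 \<le> q" "q \<le> 1"
  shows "greedy (mix q \<pi> \<pi>')"
  unfolding greedy_def
proof (intro conjI ballI allI)
  note hom = greedy_hom[OF assms(1)] greedy_hom[OF assms(2)]
  note meas = hom_policies_measurable[OF hom(1)] hom_policies_measurable[OF hom(2)]
  show "mix q \<pi> \<pi>' \<in> hom_policies MT"
    unfolding hom_policies_def mix_def mem_Collect_eq prod.case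
  proof (intro conjI ballI allI)
    show "(\<lambda>(z, \<theta>). (1 - q) * fst \<pi> z \<theta> + q * fst \<pi>' z \<theta>) \<in> borel_measurable (rho_space MT)"
      using meas(1)[of fst "orthant \<Otimes>\<^sub>M MT" snd] meas(3)[of fst "orthant \<Otimes>\<^sub>M MT" snd]
      unfolding rho_space_def case_prod_unfold by simp
    show "(\<lambda>z. (1 - q) * snd \<pi> z k + q * snd \<pi>' z k) \<in> borel_measurable orthant" for k
      using meas(2)[of "\<lambda>z. z" orthant k] meas(4)[of "\<lambda>z. z" orthant k] by simp
    show "(1 - q) * fst \<pi> z \<theta> + q * fst \<pi>' z \<theta> \<in> {0..1}" if "z \<in> nonneg_vecs" "\<theta> \<in> space MT" for z \<theta>
      using hom_policiesD[OF hom(1) that(1)] hom_policiesD[OF hom(2) that(1)] that q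
      by (auto intro!: convex_bound_le)
    show "0 \<le> (1 - q) * snd \<pi> z k + q * snd \<pi>' z k" if "z \<in> nonneg_vecs" for z k
      using hom_policiesD[OF hom(1) that] hom_policiesD[OF hom(2) that] q by auto
    show "(\<Sum>k\<in>UNIV. (1 - q) * snd \<pi> z k + q * snd \<pi>' z k) = 1" if "z \<in> nonneg_vecs" for z
      using hom_policiesD(4)[OF hom(1) that] hom_policiesD(4)[OF hom(2) that]
      by (simp add: sum.distrib sum_distrib_left[symmetric])
  qed
qed (use assms in \<open>auto simp: greedy_def mix_def\<close>)

text \<open>
  Single stages are continuous in the mixing parameter by dominated convergence. For their
  sum this only yields lower semicontinuity, since the expected times need not be summable uniformly in
  the parameter.
\<close>

lemma stage_cost_mix_tendsto:
  assumes gr: "greedy \<pi>" "greedy \<pi>'" and z: "z \<in> nonneg_vecs" and \<theta>: "\<theta> \<in> space MT"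
    and q: "\<And>n. q n \<in> {0..1}" "q' \<in> {0..1}" "q \<longlonglongrightarrow> q'"
  shows "(\<lambda>n. stage_cost (run (mix (q n) \<pi> \<pi>') z \<theta>) \<theta> i m) \<longlonglongrightarrow> stage_cost (run (mix q' \<pi> \<pi>') z \<theta>) \<theta> i m"
proof -
  define R where "R r = run (mix r \<pi> \<pi>') z \<theta>" for r
  have R: "R r \<in> policies \<mu>" if "r \<in> {0..1}" for r
    unfolding R_def using that by (intro run_in_policies greedy_hom mix_greedy gr z \<theta>) auto
  have lim_fst: "(\<lambda>n. fst (R (q n)) j \<omega>) \<longlonglongrightarrow> fst (R q') j \<omega>" for j \<omega>
    unfolding R_def run_policy_def mix_def using q(3) by (auto intro!: tendsto_intros)
  have lim_snd: "(\<lambda>n. snd (R (q n)) j \<omega> k) \<longlonglongrightarrow> snd (R q') j \<omega> k" for j \<omega> k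
    unfolding R_def run_policy_def mix_def using q(3) by (auto intro!: tendsto_intros)
  have lim_c: "(\<lambda>n. continue_prob (R (q n)) j \<omega>) \<longlonglongrightarrow> continue_prob (R q') j \<omega>" for j \<omega>
    unfolding continue_prob_def by (intro tendsto_prod tendsto_diff tendsto_const lim_fst)
  have lim_s: "(\<lambda>n. stop_prob (R (q n)) j \<omega>) \<longlonglongrightarrow> stop_prob (R q') j \<omega>" for j \<omega>
    unfolding stop_prob_def by (intro tendsto_mult lim_c lim_fst)
  have dom: "(\<lambda>n. \<integral>\<^sup>+\<omega>. ennreal (f (R (q n)) \<omega>) \<partial>P i \<theta>) \<longlonglongrightarrow> (\<integral>\<^sup>+\<omega>. ennreal (f (R q') \<omega>) \<partial>P i \<theta>)"
    if m: "\<And>\<pi>. \<pi> \<in> policies \<mu> \<Longrightarrow> f \<pi> \<in> borel_measurable (obs_filtration \<mu> m)"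
      and b: "\<And>\<pi> \<omega>. \<pi> \<in> policies \<mu> \<Longrightarrow> \<omega> \<in> space (obs_space \<mu>) \<Longrightarrow> f \<pi> \<omega> \<le> 1"
      and l: "\<And>\<omega>. (\<lambda>n. f (R (q n)) \<omega>) \<longlonglongrightarrow> f (R q') \<omega>" for f :: "('x, 'k) policy \<Rightarrow> (nat \<Rightarrow> 'x) \<Rightarrow> real" and i
  proof (rule nn_integral_dominated_convergence[where w = "\<lambda>_. 1"])
    interpret prob_space "P i \<theta>" using process_law[OF \<theta>, of i] by (simp add: process_laws_def)
    show "(\<integral>\<^sup>+x. 1 \<partial>P i \<theta>) < \<infinity>" by (simp add: emeasure_space_1)
    show "(\<lambda>\<omega>. ennreal (f (R (q j)) \<omega>)) \<in> borel_measurable (P i \<theta>)" for j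
      by (rule measurable_compose[OF measurable_P[OF \<theta> m[OF R[OF q(1)]]] measurable_ennreal])
    show "(\<lambda>\<omega>. ennreal (f (R q') \<omega>)) \<in> borel_measurable (P i \<theta>)"
      by (rule measurable_compose[OF measurable_P[OF \<theta> m[OF R[OF q(2)]]] measurable_ennreal])
    show "AE \<omega> in P i \<theta>. ennreal (f (R (q j)) \<omega>) \<le> 1" for j
      using b[OF R[OF q(1)]] by (intro AE_I2) (simp add: space_P[OF \<theta>])
    show "AE \<omega> in P i \<theta>. (\<lambda>j. ennreal (f (R (q j)) \<omega>)) \<longlonglongrightarrow> ennreal (f (R q') \<omega>)"
      by (intro AE_I2 tendsto_ennrealI l)
  qed simp
  show ?thesis
  proof (cases i)
    case None
    have "(\<lambda>n. \<integral>\<^sup>+\<omega>. ennreal (continue_prob (R (q n)) (Suc m) \<omega>) \<partial>P None \<theta>) \<longlonglongrightarrow>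
        (\<integral>\<^sup>+\<omega>. ennreal (continue_prob (R q') (Suc m) \<omega>) \<partial>P None \<theta>)"
      by (rule dom[where f = "\<lambda>\<pi>. continue_prob \<pi> (Suc m)"])
        (auto intro: continue_prob_measurable continue_prob_bounds lim_c)
    then show ?thesis by (simp add: stage_cost_def None R_def)
  next
    case (Some k)
    have b: "stop_prob \<pi> m \<omega> * (1 - snd \<pi> m \<omega> k) \<le> 1" if "\<pi> \<in> policies \<mu>" "\<omega> \<in> space (obs_space \<mu>)" for \<pi> \<omega>
      using policies_bounds[OF that] continue_prob_bounds[OF that] stop_prob_nonneg[OF that]
      unfolding stop_prob_def by (intro mult_le_one) auto
    have "(\<lambda>n. \<integral>\<^sup>+\<omega>. ennreal (stop_prob (R (q n)) m \<omega> * (1 - snd (R (q n)) m \<omega> k)) \<partial>P (Some k) \<theta>) \<longlonglongrightarrow>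
        (\<integral>\<^sup>+\<omega>. ennreal (stop_prob (R q') m \<omega> * (1 - snd (R q') m \<omega> k)) \<partial>P (Some k) \<theta>)"
      by (rule dom[where f = "\<lambda>\<pi> \<omega>. stop_prob \<pi> m \<omega> * (1 - snd \<pi> m \<omega> k)"])
        (auto intro!: stop_error_measurable b tendsto_intros lim_s lim_snd)
    then show ?thesis by (auto simp: stage_cost_def Some R_def intro!: ennreal_tendsto_cmult)
  qed
qed

lemma total_mix_lsc:
  assumes gr: "greedy \<pi>" "greedy \<pi>'" and z: "z \<in> nonneg_vecs" and \<theta>: "\<theta> \<in> space MT"
    and q: "\<And>n. q n \<in> {0..1}" "q' \<in> {0..1}" "q \<longlonglongrightarrow> q'"
    and y: "y < total_cost (run (mix q' \<pi> \<pi>') z \<theta>) \<theta> u"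
  shows "\<forall>\<^sub>F n in sequentially. y < total_cost (run (mix (q n) \<pi> \<pi>') z \<theta>) \<theta> u"
proof -
  let ?s = "\<lambda>r N. \<Sum>m<N. \<Sum>i\<in>UNIV. ennreal (u $ i) * stage_cost (run (mix r \<pi> \<pi>') z \<theta>) \<theta> i m"
  have total_cost: "total_cost (run (mix r \<pi> \<pi>') z \<theta>) \<theta> u = (SUP N. ?s r N)" for r
    unfolding total_eq_suminf by (rule suminf_eq_SUP)
  obtain N where "y < ?s q' N" using y unfolding total_cost less_SUP_iff by auto
  moreover have "(\<lambda>n. ?s (q n) N) \<longlonglongrightarrow> ?s q' N"
    by (intro tendsto_sum ennreal_tendsto_cmult stage_cost_mix_tendsto[OF gr z \<theta> q]) simp
  ultimately have "\<forall>\<^sub>F n in sequentially. y < ?s (q n) N" by (rule order_tendstoD(1)[rotated])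
  then show ?thesis
    by eventually_elim (auto simp: total_cost less_SUP_iff)
qed

lemma total_mask_split: "total_cost \<pi> \<theta> (mask S z) + total_cost \<pi> \<theta> (mask (- S) z) = total_cost \<pi> \<theta> z"
  unfolding total_cost_def mask_def sum.distrib[symmetric] by (intro sum.cong) auto

text \<open>
  The costs with weights \<open>mask S z\<close> and \<open>mask (- S) z\<close> are both lower semicontinuous in \<open>q\<close>, and they
  add up to \<open>\<rho> z \<theta>\<close> for every \<open>q\<close>. So each is \<open>\<rho> z \<theta>\<close> minus a lower semicontinuous function, hence also upper
  semicontinuous.
\<close>

lemma total_mix_continuous:
  assumes gr: "greedy \<pi>" "greedy \<pi>'" and z: "z \<in> nonneg_vecs" and \<theta>: "\<theta> \<in> space MT"
  shows "continuous_on {0..1} (\<lambda>q. total_cost (run (mix q \<pi> \<pi>') z \<theta>) \<theta> (mask S z))"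
proof (rule continuous_on_sequentiallyI)
  fix q :: "nat \<Rightarrow> real" and q' :: real
  assume q: "\<forall>n. q n \<in> {0..1}" "q' \<in> {0..1}" "q \<longlonglongrightarrow> q'"
  define T where "T S r = total_cost (run (mix r \<pi> \<pi>') z \<theta>) \<theta> (mask S z)" for S r
  have lsc: "\<forall>\<^sub>F n in sequentially. y < T S (q n)" if "y < T S q'" for y S
    unfolding T_def by (rule total_mix_lsc[OF gr z \<theta> _ q(2,3)]) (use q(1) that in \<open>auto simp: T_def\<close>)
  have sum: "T S r + T (- S) r = ennreal (\<rho> z \<theta>)" if "r \<in> {0..1}" for r
    unfolding T_def total_mask_split using that by (intro greedy_total_eq_rho mix_greedy gr z \<theta>) auto
  have \<rho>0: "0 \<le> \<rho> z \<theta>" by (rule rho_nonneg[OF z \<theta>])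
  have real: "\<exists>a b. 0 \<le> a \<and> 0 \<le> b \<and> T S r = ennreal a \<and> T (- S) r = ennreal b \<and> a + b = \<rho> z \<theta>" if "r \<in> {0..1}" for r
    using sum[OF that] \<rho>0 by (cases "T S r"; cases "T (- S) r") (auto simp: ennreal_plus[symmetric] simp del: ennreal_plus)
  have "(\<lambda>n. T S (q n)) \<longlonglongrightarrow> T S q'"
  proof (rule order_tendstoI)
    show "\<forall>\<^sub>F n in sequentially. y < T S (q n)" if "y < T S q'" for y using lsc[OF that] .
    fix y assume y: "T S q' < y"
    obtain a b where ab: "0 \<le> a" "0 \<le> b" "T S q' = ennreal a" "T (- S) q' = ennreal b" "a + b = \<rho> z \<theta>"
      using real[OF q(2)] by auto
    show "\<forall>\<^sub>F n in sequentially. T S (q n) < y"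
    proof (cases "ennreal (\<rho> z \<theta>) < y")
      case True
      have "T S (q n) < y" for n
      proof -
        have "T S (q n) \<le> T S (q n) + T (- S) (q n)" by simp
        also have "\<dots> = ennreal (\<rho> z \<theta>)" using q(1) by (intro sum) auto
        finally show ?thesis using True by simp
      qed
      then show ?thesis by simp
    next
      case False
      then obtain c where c: "0 \<le> c" "y = ennreal c" "c \<le> \<rho> z \<theta>"
        using \<rho>0 by (cases y) (auto simp: not_less)
      \<comment> \<open>an upper bound \<open>c\<close> for \<open>T S\<close> is a lower bound \<open>\<rho> z \<theta> - c\<close> for the complementary part\<close>
      have "ennreal (\<rho> z \<theta> - c) < T (- S) q'"
        using y c ab by (auto simp: ennreal_less_iff)
      from lsc[OF this] show ?thesis
      proof eventually_elim
        case (elim n)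
        obtain a b where "0 \<le> a" "0 \<le> b" "T S (q n) = ennreal a" "T (- S) (q n) = ennreal b" "a + b = \<rho> z \<theta>"
          using real[of "q n"] q(1) by auto
        then show ?case using elim c by (auto simp: ennreal_less_iff)
      qed
    qed
  qed
  then show "(\<lambda>n. total_cost (run (mix (q n) \<pi> \<pi>') z \<theta>) \<theta> (mask S z)) \<longlonglongrightarrow> total_cost (run (mix q' \<pi> \<pi>') z \<theta>) \<theta> (mask S z)"
    by (simp add: T_def)
qed

lemma total_intermediate:
  assumes gr: "greedy \<pi>" "greedy \<pi>'" and z: "z \<in> nonneg_vecs" and \<theta>: "\<theta> \<in> space MT"
    and y: "total_cost (run \<pi> z \<theta>) \<theta> (mask S z) \<le> y" "y \<le> total_cost (run \<pi>' z \<theta>) \<theta> (mask S z)"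
  obtains \<pi>'' where "greedy \<pi>''" "total_cost (run \<pi>'' z \<theta>) \<theta> (mask S z) = y"
proof -
  have "\<exists>q. 0 \<le> q \<and> q \<le> 1 \<and> total_cost (run (mix q \<pi> \<pi>') z \<theta>) \<theta> (mask S z) = y"
    using y by (intro IVT' total_mix_continuous gr z \<theta>) auto
  then show ?thesis using that mix_greedy[OF gr] by blast
qed

section \<open>Superdifferentials at positive weights\<close>

lemma mask_singleton: "mask {i} z = axis i (z $ i)"
  by (auto simp: mask_def axis_def vec_eq_iff)

lemma total_axis: "total_cost \<pi> \<theta> (axis i s) = ennreal s * cost_component \<pi> \<theta> i"
proof -
  have "total_cost \<pi> \<theta> (axis i s) = (\<Sum>j\<in>UNIV. if j = i then ennreal s * cost_component \<pi> \<theta> j else 0)"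
    unfolding total_cost_def axis_def by (intro sum.cong) auto
  then show ?thesis by simp
qed

lemma superdiff_iff:
  "c \<in> rho_superdiff \<rho> i z \<theta> \<longleftrightarrow> (\<forall>y\<in>nonneg_vecs. (\<forall>j. j \<noteq> i \<longrightarrow> y $ j = z $ j) \<longrightarrow>
     ereal (\<rho> y \<theta> - \<rho> z \<theta>) \<le> c * ereal (y $ i - z $ i))"
  by (simp add: rho_superdiff_def partial_superdiff_def)

text \<open>
  The linear form given by the cost vector touches \<open>\<rho>\<close> from above at \<open>z\<close>. An infinite component \<open>v\<^sub>i\<close> is
  only possible for \<open>z\<^sub>i = 0\<close>, where \<open>\<infinity>\<close> belongs to the superdifferential.
\<close>

theorem greedy_cost_component_in_superdiff:
  assumes gr: "greedy \<pi>" and z: "z \<in> nonneg_vecs" and \<theta>: "\<theta> \<in> space MT"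
  shows "enn2ereal (cost_component (run \<pi> z \<theta>) \<theta> i) \<in> rho_superdiff \<rho> i z \<theta>"
  unfolding superdiff_iff
proof (intro ballI impI)
  fix y assume y: "y \<in> nonneg_vecs" and eq: "\<forall>j. j \<noteq> i \<longrightarrow> y $ j = z $ j"
  define v where "v = cost_component (run \<pi> z \<theta>) \<theta> i"
  define S where "S = total_cost (run \<pi> z \<theta>) \<theta> (mask (- {i}) z)"
  have "mask (- {i}) y = mask (- {i}) z" using eq by (auto simp: mask_def vec_eq_iff)
  then have tot: "total_cost (run \<pi> z \<theta>) \<theta> z = ennreal (z $ i) * v + S" "total_cost (run \<pi> z \<theta>) \<theta> y = ennreal (y $ i) * v + S"
    using total_mask_split[of "run \<pi> z \<theta>" \<theta> "{i}" z] total_mask_split[of "run \<pi> z \<theta>" \<theta> "{i}" y]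
    by (simp_all add: mask_singleton total_axis v_def S_def)
  have z_eq: "ennreal (z $ i) * v + S = ennreal (\<rho> z \<theta>)"
    using greedy_total_eq_rho[OF gr z \<theta>] tot by simp
  have y_le: "ennreal (\<rho> y \<theta>) \<le> ennreal (y $ i) * v + S"
    using rho_le_total[OF run_in_policies[OF greedy_hom[OF gr] z \<theta>] y \<theta>] tot by simp
  note nonneg = nonneg_vecsD[OF z, of i] nonneg_vecsD[OF y, of i] rho_nonneg[OF z \<theta>] rho_nonneg[OF y \<theta>]
  have "S \<noteq> top" using z_eq by (auto simp: top_unique)
  then obtain s where s: "0 \<le> s" "S = ennreal s" by (cases S) auto
  show "ereal (\<rho> y \<theta> - \<rho> z \<theta>) \<le> enn2ereal v * ereal (y $ i - z $ i)"
  proof (cases v)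
    case top
    have zi: "z $ i = 0"
    proof (rule ccontr)
      assume "z $ i \<noteq> 0"
      then have "ennreal (z $ i) * v = top" using nonneg top by (simp add: ennreal_mult_top)
      then show False using z_eq by simp
    qed
    show ?thesis
    proof (cases "y $ i = 0")
      case True
      then have "y = z" using eq zi by (metis vec_eq_iff)
      then show ?thesis by (simp add: zero_ereal_def[symmetric])
    next
      case False
      then show ?thesis using nonneg zi top by simp
    qed
  next
    case (real r)
    have "\<rho> z \<theta> = z $ i * r + s"
      using z_eq real s nonneg by (simp add: ennreal_mult[symmetric] ennreal_plus[symmetric] del: ennreal_plus)
    moreover have "\<rho> y \<theta> \<le> y $ i * r + s"
      using y_le real s nonneg by (simp add: ennreal_mult[symmetric] ennreal_plus[symmetric] del: ennreal_plus)
    ultimately show ?thesis using real by (simp add: algebra_simps)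
  qed
qed

lemma superdiff_upper:
  assumes z: "z \<in> nonneg_vecs" and \<theta>: "\<theta> \<in> space MT" and c: "ereal r \<in> rho_superdiff \<rho> i z \<theta>" and s: "0 < s"
  shows "dir_deriv z (axis i s) \<theta> \<le> ennreal (s * r)"
  unfolding dir_deriv_def
proof (rule SUP_least)
  fix N :: nat
  have d: "axis i s \<in> nonneg_vecs" using s by (simp add: axis_nonneg)
  define n where "n = real (Suc N)"
  have n: "n > 0" by (simp add: n_def)
  \<comment> \<open>by homogeneity the quotient at \<open>N + 1\<close> is the difference quotient from \<open>z\<close> to \<open>z + (s / n) e\<^sub>i\<close>\<close>
  define y where "y = z + (1 / n) *\<^sub>R axis i s"
  have y: "y \<in> nonneg_vecs"
    unfolding y_def using nonneg_comb[OF z d, of 1 "1 / n"] n by simp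
  have "y $ j = z $ j" if "j \<noteq> i" for j using that by (simp add: y_def axis_def)
  with c y have "\<rho> y \<theta> - \<rho> z \<theta> \<le> r * (y $ i - z $ i)"
    unfolding superdiff_iff by force
  then have le: "\<rho> y \<theta> - \<rho> z \<theta> \<le> r * (s / n)" by (simp add: y_def axis_def)
  have ny: "n *\<^sub>R y = n *\<^sub>R z + axis i s" using n by (simp add: y_def scaleR_add_right)
  have "\<rho> (real N *\<^sub>R z + axis i s) \<theta> - real N * \<rho> z \<theta> \<le> \<rho> (n *\<^sub>R z + axis i s) \<theta> - n * \<rho> z \<theta>"
    unfolding n_def by (rule difference_mono(2)[OF z d \<theta>])
  also have "\<dots> = n * (\<rho> y \<theta> - \<rho> z \<theta>)"
    unfolding ny[symmetric] rho_scale[OF y \<theta> n] by (simp add: algebra_simps)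
  also have "\<dots> \<le> n * (r * (s / n))" using le n by (intro mult_left_mono) auto
  also have "\<dots> = s * r" using n by simp
  finally show "ennreal (\<rho> (real N *\<^sub>R z + axis i s) \<theta> - real N * \<rho> z \<theta>) \<le> ennreal (s * r)"
    by (rule ennreal_leI)
qed

text \<open>
  Going from \<open>N z\<close> in the direction \<open>mask (- {i}) z\<close> means decreasing the \<open>i\<close>-th coordinate of \<open>(N + 1) z\<close>
  by \<open>z\<^sub>i\<close>. So by homogeneity a bound on \<open>\<rho>\<close> at decreased \<open>i\<close>-th coordinates bounds this derivative.
\<close>

lemma superdiff_lower:
  assumes z: "z \<in> nonneg_vecs" and \<theta>: "\<theta> \<in> space MT" and c: "ereal r \<in> rho_superdiff \<rho> i z \<theta>"
  shows "dir_deriv z (mask (- {i}) z) \<theta> \<le> ennreal (\<rho> z \<theta> - z $ i * r)"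
  unfolding dir_deriv_def
proof (rule SUP_least)
  fix N :: nat
  define n where "n = real (Suc N)"
  have n: "n \<ge> 1" by (simp add: n_def)
  define y where "y = z - axis i (z $ i / n)"
  have "z $ i / n \<le> z $ i"
    using n nonneg_vecsD[OF z, of i] mult_left_mono[of 1 n "z $ i"] by (simp add: field_simps)
  then have y: "y \<in> nonneg_vecs"
    using z by (auto simp: nonneg_vecs_def y_def axis_def)
  have "y $ j = z $ j" if "j \<noteq> i" for j using that by (simp add: y_def axis_def)
  with c y have "\<rho> y \<theta> - \<rho> z \<theta> \<le> r * (y $ i - z $ i)"
    unfolding superdiff_iff by force
  then have le: "\<rho> y \<theta> \<le> \<rho> z \<theta> - r * (z $ i / n)" by (simp add: y_def axis_def)
  have ny: "real N *\<^sub>R z + mask (- {i}) z = n *\<^sub>R y"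
  proof -
    have at_i: "n * (z $ i - z $ i / n) = real N * z $ i"
      using n by (simp add: right_diff_distrib) (simp add: n_def algebra_simps)
    show ?thesis
      unfolding vec_eq_iff
    proof
      fix j show "(real N *\<^sub>R z + mask (- {i}) z) $ j = (n *\<^sub>R y) $ j"
        by (cases "j = i") (simp_all add: y_def mask_def axis_def at_i, simp add: n_def algebra_simps)
    qed
  qed
  have "\<rho> (real N *\<^sub>R z + mask (- {i}) z) \<theta> - real N * \<rho> z \<theta> = n * \<rho> y \<theta> - real N * \<rho> z \<theta>"
    unfolding ny using n by (simp add: rho_scale[OF y \<theta>])
  also have "\<dots> \<le> n * (\<rho> z \<theta> - r * (z $ i / n)) - real N * \<rho> z \<theta>"
    using le n by (intro diff_right_mono mult_left_mono) auto
  also have "\<dots> = \<rho> z \<theta> - z $ i * r" using n by (simp add: field_simps n_def)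
  finally show "ennreal (\<rho> (real N *\<^sub>R z + mask (- {i}) z) \<theta> - real N * \<rho> z \<theta>) \<le> ennreal (\<rho> z \<theta> - z $ i * r)"
    by (rule ennreal_leI)
qed

lemma superdiff_nonneg:
  assumes z: "z \<in> nonneg_vecs" and \<theta>: "\<theta> \<in> space MT" and c: "c \<in> rho_superdiff \<rho> i z \<theta>"
  shows "0 \<le> c"
proof -
  have d: "axis i 1 \<in> nonneg_vecs" by (simp add: axis_nonneg)
  have y: "z + axis i 1 \<in> nonneg_vecs" using nonneg_comb[OF z d, of 1 1] by simp
  have "0 \<le> \<rho> (z + axis i 1) \<theta> - \<rho> z \<theta>" using difference_mono(1)[OF z d \<theta>, of 1] by simp
  then have "0 \<le> ereal (\<rho> (z + axis i 1) \<theta> - \<rho> z \<theta>)" by simp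
  also have "\<dots> \<le> c * ereal ((z + axis i 1) $ i - z $ i)"
    using c y unfolding superdiff_iff by (auto simp: axis_def)
  finally show ?thesis by (simp add: one_ereal_def[symmetric])
qed

lemma superdiff_finite:
  assumes z: "z \<in> nonneg_vecs" and \<theta>: "\<theta> \<in> space MT" and c: "c \<in> rho_superdiff \<rho> i z \<theta>" and i: "0 < z $ i"
  obtains r where "0 \<le> r" "c = ereal r"
proof -
  have "mask (- {i}) z \<in> nonneg_vecs" by (rule mask_nonneg[OF z])
  then have "ereal (\<rho> (mask (- {i}) z) \<theta> - \<rho> z \<theta>) \<le> c * ereal (mask (- {i}) z $ i - z $ i)"
    using c unfolding superdiff_iff by (auto simp: mask_def)
  then have "c \<noteq> \<infinity>" using i by (auto simp: mask_def)
  then show ?thesis using that superdiff_nonneg[OF z \<theta> c] by (cases c) auto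
qed

text \<open>
  Breaking ties for \<open>mask {i} z\<close> and for \<open>mask (- {i}) z\<close> yields tests whose \<open>i\<close>-th components enclose
  \<open>c\<close>; a mixture of the two attains it.
\<close>

theorem superdiff_attained:
  assumes z: "z \<in> nonneg_vecs" and \<theta>: "\<theta> \<in> space MT" and c: "c \<in> rho_superdiff \<rho> i z \<theta>" and i: "0 < z $ i"
  shows "\<exists>\<pi>. greedy \<pi> \<and> enn2ereal (cost_component (run \<pi> z \<theta>) \<theta> i) = c"
proof -
  obtain r where r: "0 \<le> r" "c = ereal r" by (rule superdiff_finite[OF z \<theta> c i])
  note c = c[unfolded r(2)]
  define lo where "lo = run (mask_policy {i}) z \<theta>"
  define hi where "hi = run (mask_policy (- {i})) z \<theta>"
  have low: "total_cost lo \<theta> (mask {i} z) \<le> ennreal (z $ i * r)"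
    unfolding lo_def
    using mask_policy_total_le[OF z \<theta>, of "{i}"] superdiff_upper[OF z \<theta> c i] by (simp add: mask_singleton)
  have "total_cost hi \<theta> (mask (- {i}) z) \<le> ennreal (\<rho> z \<theta> - z $ i * r)"
    unfolding hi_def using mask_policy_total_le[OF z \<theta>] superdiff_lower[OF z \<theta> c] by (rule order_trans)
  moreover have "total_cost hi \<theta> (mask {i} z) + total_cost hi \<theta> (mask (- {i}) z) = ennreal (\<rho> z \<theta>)"
    unfolding total_mask_split hi_def by (rule greedy_total_eq_rho[OF mask_policy_greedy z \<theta>])
  moreover have "z $ i * r \<le> \<rho> z \<theta>"
  proof -
    have "mask (- {i}) z $ j = z $ j" if "j \<noteq> i" for j using that by (simp add: mask_def)
    then have "ereal (\<rho> (mask (- {i}) z) \<theta> - \<rho> z \<theta>) \<le> ereal r * ereal (mask (- {i}) z $ i - z $ i)"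
      using c mask_nonneg[OF z] unfolding superdiff_iff by blast
    then show ?thesis using rho_nonneg[OF mask_nonneg[OF z] \<theta>, of "- {i}"] by (simp add: mask_def mult.commute)
  qed
  ultimately have high: "ennreal (z $ i * r) \<le> total_cost hi \<theta> (mask {i} z)"
    using r i rho_nonneg[OF z \<theta>] by (cases "total_cost hi \<theta> (mask {i} z)"; cases "total_cost hi \<theta> (mask (- {i}) z)")
      (auto simp: ennreal_plus[symmetric] simp del: ennreal_plus intro!: ennreal_leI)
  obtain \<pi> where \<pi>: "greedy \<pi>" "total_cost (run \<pi> z \<theta>) \<theta> (mask {i} z) = ennreal (z $ i * r)"
    using total_intermediate[OF mask_policy_greedy mask_policy_greedy z \<theta> low[unfolded lo_def] high[unfolded hi_def]] .
  have "ennreal (z $ i) * cost_component (run \<pi> z \<theta>) \<theta> i = ennreal (z $ i) * ennreal r"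
    using \<pi>(2) r i by (simp add: mask_singleton total_axis ennreal_mult)
  then have "cost_component (run \<pi> z \<theta>) \<theta> i = ennreal r"
    using i by (simp add: ennreal_mult_cancel_left)
  then show ?thesis using \<pi>(1) r by (intro exI[of _ \<pi>]) simp
qed

section \<open>Expected times at zero weight\<close>

text \<open>
  Where stopping is free of cost and observations are free as well, stopping with any probability \<open>r\<close>
  is optimal.
\<close>

definition delayed_policy :: "real \<Rightarrow> ('t, 'k) hom_policy" where
  "delayed_policy r = (\<lambda>z \<theta>. if z $ None = 0 \<and> g z = 0 then r else fst (mask_policy {None}) z \<theta>, mask_decision {None})"

lemma delayed_policy_greedy:
  assumes r: "0 \<le> r" "r \<le> 1"
  shows "greedy (delayed_policy r)"
  unfolding greedy_def
proof (intro conjI ballI allI)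
  have gr: "greedy (mask_policy {None})" by (rule mask_policy_greedy)
  note hom = greedy_hom[OF gr]
  show "delayed_policy r \<in> hom_policies MT"
    unfolding hom_policies_def delayed_policy_def mem_Collect_eq prod.case
  proof (intro conjI ballI allI)
    have [measurable]: "(\<lambda>w. fst (mask_policy {None}) (fst w) (snd w)) \<in> borel_measurable (orthant \<Otimes>\<^sub>M MT)"
      by (rule hom_policies_measurable(1)[OF hom]) measurable
    have [measurable]: "(\<lambda>w. fst w $ None) \<in> borel_measurable (orthant \<Otimes>\<^sub>M MT)"
      by (rule measurable_nonneg_vecs_nth) measurable
    show "(\<lambda>(z, \<theta>). if z $ None = 0 \<and> g z = 0 then r else fst (mask_policy {None}) z \<theta>) \<in> borel_measurable (rho_space MT)"
      unfolding rho_space_def case_prod_unfold by measurable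
    show "(\<lambda>z. mask_decision {None} z k) \<in> borel_measurable orthant" for k by measurable
    show "(if z $ None = 0 \<and> g z = 0 then r else fst (mask_policy {None}) z \<theta>) \<in> {0..1}"
      if "z \<in> nonneg_vecs" "\<theta> \<in> space MT" for z \<theta>
      using hom_policiesD[OF hom that(1)] that r by auto
  qed (auto simp: mask_decision_sum, auto simp: mask_decision_def)
  show "g z < cont z \<theta> \<longrightarrow> fst (delayed_policy r) z \<theta> = 1" "cont z \<theta> < g z \<longrightarrow> fst (delayed_policy r) z \<theta> = 0"
    if "z \<in> nonneg_vecs" "\<theta> \<in> space MT" for z \<theta>
    using gr that cont_eq_0[OF that] by (auto simp: delayed_policy_def greedy_def)
  show "G_cost lam k z \<noteq> g z \<longrightarrow> snd (delayed_policy r) z k = 0" if "z \<in> nonneg_vecs" for z k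
    using gr that by (auto simp: delayed_policy_def greedy_def mask_policy_def)
qed

text \<open>
  \<open>g z = 0\<close> means that at most one of the \<open>\<lambda>\<^sub>i z\<^sub>i\<close> is nonzero, which likelihood factors preserve.
\<close>

lemma g_upd_eq_0:
  assumes z: "z \<in> nonneg_vecs" and \<theta>: "\<theta> \<in> space MT" and x: "x \<in> space \<mu>" and 0: "g z = 0"
  shows "g (upd z \<theta> x) = 0"
proof -
  obtain k where k: "G_cost lam k z = 0" using g_cost_attained[of lam z] 0 by auto
  have "lam j * z $ Some j = 0" if "j \<noteq> k" for j
  proof -
    have "\<forall>j\<in>UNIV - {k}. lam j * z $ Some j = 0"
      using k unfolding G_cost_def
      by (subst (asm) sum_nonneg_eq_0_iff) (auto intro!: mult_nonneg_nonneg lam_nonneg nonneg_vecsD[OF z])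
    then show ?thesis using that by simp
  qed
  then have "G_cost lam k (upd z \<theta> x) = 0"
    unfolding G_cost_def by (intro sum.neutral) (auto simp: vec_mult_def)
  then show ?thesis
    using g_cost_le[of lam "upd z \<theta> x" k] g_nonneg[OF upd_nonneg[OF z \<theta> x]] by simp
qed

lemma delayed_policy_time:
  assumes z: "z \<in> nonneg_vecs" and \<theta>: "\<theta> \<in> space MT" and 0: "z $ None = 0" and r: "0 \<le> r" "r \<le> 1"
  shows "cost_component (run (delayed_policy r) z \<theta>) \<theta> None =
    cost_component (run (mask_policy {None}) z \<theta>) \<theta> None + (\<Sum>m. ennreal ((1 - r) ^ Suc m))"
proof -
  interpret prob_space "P None \<theta>" using process_law[OF \<theta>, of None] by (simp add: process_laws_def)
  have cost_component: "cost_component \<pi> \<theta> None = (\<integral>\<^sup>+\<omega>. (\<Sum>m. ennreal (continue_prob \<pi> (Suc m) \<omega>)) \<partial>P None \<theta>)"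
    and meas: "(\<lambda>\<omega>. (\<Sum>m. ennreal (continue_prob \<pi> (Suc m) \<omega>))) \<in> borel_measurable (P None \<theta>)"
    if "\<pi> \<in> policies \<mu>" for \<pi>
  proof -
    have m: "(\<lambda>\<omega>. ennreal (continue_prob \<pi> (Suc m) \<omega>)) \<in> borel_measurable (P None \<theta>)" for m
      by (rule measurable_compose[OF measurable_P[OF \<theta> continue_prob_measurable(1)[OF that]] measurable_ennreal])
    show "cost_component \<pi> \<theta> None = (\<integral>\<^sup>+\<omega>. (\<Sum>m. ennreal (continue_prob \<pi> (Suc m) \<omega>)) \<partial>P None \<theta>)"
      unfolding cost_component_def stage_cost_def option.case by (rule nn_integral_suminf[OF m, symmetric])
    show "(\<lambda>\<omega>. (\<Sum>m. ennreal (continue_prob \<pi> (Suc m) \<omega>))) \<in> borel_measurable (P None \<theta>)"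
      using m by measurable
  qed
  define \<pi> where "\<pi> = run (mask_policy {None}) z \<theta>"
  define \<pi>r where "\<pi>r = run (delayed_policy r) z \<theta>"
  have \<pi>: "\<pi> \<in> policies \<mu>" "\<pi>r \<in> policies \<mu>"
    unfolding \<pi>_def \<pi>r_def
    by (intro run_in_policies greedy_hom mask_policy_greedy delayed_policy_greedy z \<theta> r)+
  have pointwise: "(\<Sum>m. ennreal (continue_prob \<pi>r (Suc m) \<omega>)) =
      (\<Sum>m. ennreal (continue_prob \<pi> (Suc m) \<omega>)) + (\<Sum>m. ennreal ((1 - r) ^ Suc m))"
    if \<omega>: "\<omega> \<in> space (P None \<theta>)" for \<omega>
  proof -
    have \<omega>: "\<omega> \<in> space (obs_space \<mu>)" using that space_P[OF \<theta>] by simp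
    define A where "A i \<longleftrightarrow> g (weight_seq \<xi> p z \<theta> \<omega> i) = 0" for i
    have A: "A (Suc i)" if "A i" for i
    proof -
      have "\<omega> i \<in> space \<mu>" using \<omega> by (simp add: space_obs_space)
      then show ?thesis
        using g_upd_eq_0[OF weight_seq_nonneg[OF z \<theta> \<omega>] stat_seq_space[OF \<theta> \<omega>]] that by (simp add: A_def)
    qed
    have w0: "weight_seq \<xi> p z \<theta> \<omega> i $ None = 0" for i
      by (induction i) (auto simp: 0 vec_mult_def)
    have stop: "fst (mask_policy {None}) w t = (if g w = 0 then 1 else 0)"
      if "w \<in> nonneg_vecs" "t \<in> space MT" "w $ None = 0" for w t
    proof -
      have "mask {None} w = 0" using that(3) by (simp add: mask_def vec_eq_iff)
      then show ?thesis
        using cont_eq_0[OF that] g_nonneg[OF that(1)] by (auto simp: mask_policy_def error_cost_def)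
    qed
    have "1 - fst \<pi> i \<omega> = (if A i then 0 else 1)" "1 - fst \<pi>r i \<omega> = (if A i then 1 - r else 1)" for i
      using stop[OF weight_seq_nonneg[OF z \<theta> \<omega>, of i] stat_seq_space[OF \<theta> \<omega>, of i] w0] w0
      by (simp_all add: \<pi>_def \<pi>r_def run_policy_def delayed_policy_def A_def)
    then show ?thesis
      unfolding continue_prob_def by (simp only: suminf_absorbed_geometric[of A "1 - r", OF A])
  qed
  have "cost_component \<pi>r \<theta> None = (\<integral>\<^sup>+\<omega>. (\<Sum>m. ennreal (continue_prob \<pi> (Suc m) \<omega>)) + (\<Sum>m. ennreal ((1 - r) ^ Suc m)) \<partial>P None \<theta>)"
    unfolding cost_component[OF \<pi>(2)] by (intro nn_integral_cong pointwise)
  also have "\<dots> = cost_component \<pi> \<theta> None + (\<Sum>m. ennreal ((1 - r) ^ Suc m))"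
    unfolding cost_component[OF \<pi>(1)] using meas[OF \<pi>(1)] by (subst nn_integral_add) (auto simp: emeasure_space_1)
  finally show ?thesis by (simp only: \<pi>_def \<pi>r_def)
qed

theorem superdiff_time_attained_at_zero:
  assumes z: "z \<in> nonneg_vecs" and \<theta>: "\<theta> \<in> space MT" and 0: "z $ None = 0"
    and c: "c \<in> rho_superdiff \<rho> None z \<theta>"
  shows "\<exists>\<pi>. greedy \<pi> \<and> enn2ereal (cost_component (run \<pi> z \<theta>) \<theta> None) = c"
proof (cases "c = \<infinity>")
  case True
  have "(\<Sum>m::nat. (1::ennreal)) = top" by (simp add: nn_integral_count_space_nat[symmetric])
  then have "cost_component (run (delayed_policy 0) z \<theta>) \<theta> None = top"
    using delayed_policy_time[OF z \<theta> 0, of 0] by simp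
  then show ?thesis
    using delayed_policy_greedy[of 0] True by (intro exI[of _ "delayed_policy 0"]) simp
next
  case False
  then obtain x where x: "0 \<le> x" "c = ereal x" using superdiff_nonneg[OF z \<theta> c] by (cases c) auto
  define V where "V = cost_component (run (mask_policy {None}) z \<theta>) \<theta> None"
  have "V \<le> dir_deriv z (axis None 1) \<theta>"
    using mask_policy_total_le_at_zero[OF z \<theta> 0] by (simp add: total_axis V_def)
  also have "\<dots> \<le> ennreal x" using superdiff_upper[OF z \<theta> c[unfolded x(2)], of 1] by simp
  finally obtain v where v: "V = ennreal v" "0 \<le> v" "v \<le> x" using x by (cases V) (auto simp: top_unique)
  \<comment> \<open>the solution of \<open>(1 - r) / r = x - v\<close>, so that the delay makes up for the missing expected time\<close>
  define r where "r = 1 / (1 + (x - v))"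
  have r: "0 < r" "r \<le> 1" using v by (auto simp: r_def)
  have "(\<lambda>m. (1 - r) * (1 - r) ^ m) sums ((1 - r) * (1 / (1 - (1 - r))))"
    using r by (intro sums_mult geometric_sums) auto
  moreover have "(1 - r) * (1 / (1 - (1 - r))) = x - v" using v by (simp add: r_def field_simps)
  ultimately have "(\<Sum>m. ennreal ((1 - r) ^ Suc m)) = ennreal (x - v)"
    using r by (intro suminf_ennreal_eq) auto
  then have "cost_component (run (delayed_policy r) z \<theta>) \<theta> None = ennreal x"
    using delayed_policy_time[OF z \<theta> 0, of r] r v by (simp add: V_def[symmetric] ennreal_plus[symmetric] del: ennreal_plus)
  then show ?thesis
    using delayed_policy_greedy[of r] r x by (intro exI[of _ "delayed_policy r"]) simp
qed

section \<open>Optimal tests and the superdifferentials of the cost function\<close>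

text \<open>
  Every policy costs at least \<open>\<rho> 1 \<theta>\<^sub>0\<close>, and a test satisfying the pointwise conditions costs exactly this.
\<close>

lemma optimal_policies_eq_greedy:
  assumes \<theta>\<^sub>0: "\<theta>\<^sub>0 \<in> space MT"
  shows "optimal_policies \<mu> MT \<xi> p lam \<rho> \<theta>\<^sub>0 (\<lambda>i. P i \<theta>\<^sub>0) = Collect greedy"
proof -
  have one: "1 \<in> nonneg_vecs" by (simp add: nonneg_vecs_def)
  have "weighted_cost lam (\<lambda>i. P i \<theta>\<^sub>0) (run \<pi> 1 \<theta>\<^sub>0) \<le> weighted_cost lam (\<lambda>i. P i \<theta>\<^sub>0) \<pi>'"
    if "greedy \<pi>" "\<pi>' \<in> policies \<mu>" for \<pi> \<pi>'
    using greedy_total_le_rho[OF that(1) one \<theta>\<^sub>0] rho_le_total[OF that(2) one \<theta>\<^sub>0]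
    by (simp add: weighted_cost_eq_total[OF _ \<theta>\<^sub>0] that(2) run_in_policies[OF greedy_hom[OF that(1)] one \<theta>\<^sub>0])
  then show ?thesis
    unfolding optimal_policies_def by (auto simp: greedy_def)
qed

lemma perf_time_eq_cost_component:
  assumes "greedy \<pi>" "z \<in> nonneg_vecs" "\<theta> \<in> space MT"
  shows "enn2ereal (perf_time \<xi> p \<pi> (P None) z \<theta>) = enn2ereal (cost_component (run \<pi> z \<theta>) \<theta> None)"
  unfolding perf_time_def
  by (simp add: expected_time_eq_cost_component run_in_policies greedy_hom assms)

lemma expected_error_le_1:
  assumes \<pi>: "\<pi> \<in> policies \<mu>" and \<theta>: "\<theta> \<in> space MT"
  shows "expected_error (P i \<theta>) \<pi> k \<le> 1"
proof -
  interpret prob_space "P i \<theta>" using process_law[OF \<theta>, of i] by (simp add: process_laws_def)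
  have "expected_error (P i \<theta>) \<pi> k \<le> (\<integral>\<^sup>+\<omega>. 1 \<partial>P i \<theta>)"
    unfolding expected_error_def
  proof (rule nn_integral_mono)
    fix \<omega> assume "\<omega> \<in> space (P i \<theta>)"
    then have \<omega>: "\<omega> \<in> space (obs_space \<mu>)" using space_P[OF \<theta>] by simp
    note b = policies_bounds[OF \<pi> \<omega>] continue_prob_bounds[OF \<pi> \<omega>] stop_prob_nonneg[OF \<pi> \<omega>]
    have stops: "(\<Sum>m<n. stop_prob \<pi> m \<omega>) = 1 - continue_prob \<pi> n \<omega>" for n
      by (induction n) (auto simp: continue_prob_Suc stop_prob_def algebra_simps, simp add: continue_prob_def)
    have "(\<Sum>m<n. ennreal (stop_prob \<pi> m \<omega> * (1 - snd \<pi> m \<omega> k))) \<le> 1" for n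
    proof -
      have "(\<Sum>m<n. stop_prob \<pi> m \<omega> * (1 - snd \<pi> m \<omega> k)) \<le> (\<Sum>m<n. stop_prob \<pi> m \<omega>)"
        using b by (intro sum_mono mult_left_le) auto
      also have "\<dots> \<le> 1" unfolding stops using b by simp
      finally show ?thesis using b by (simp add: sum_ennreal ennreal_le_1)
    qed
    then show "(\<Sum>n. ennreal (stop_prob \<pi> n \<omega> * (1 - snd \<pi> n \<omega> k))) \<le> 1"
      by (intro suminf_le_const) auto
  qed
  then show ?thesis by (simp add: emeasure_space_1)
qed

lemma perf_error_eq_cost_component:
  assumes "greedy \<pi>" "z \<in> nonneg_vecs" "\<theta> \<in> space MT"
  shows "ereal (lam k * perf_error \<xi> p \<pi> (P (Some k)) k z \<theta>) = enn2ereal (cost_component (run \<pi> z \<theta>) \<theta> (Some k))"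
proof -
  have \<pi>: "run \<pi> z \<theta> \<in> policies \<mu>" by (intro run_in_policies greedy_hom assms)
  define e where "e = expected_error (P (Some k) \<theta>) (run \<pi> z \<theta>) k"
  have "e \<le> 1" unfolding e_def by (rule expected_error_le_1[OF \<pi> assms(3)])
  then obtain x where "0 \<le> x" "e = ennreal x" by (cases e) (auto simp: top_unique)
  moreover have "cost_component (run \<pi> z \<theta>) \<theta> (Some k) = ennreal (lam k) * e"
    unfolding e_def by (rule expected_error_eq_cost_component[OF \<pi> assms(3), symmetric])
  ultimately show ?thesis
    unfolding perf_error_def e_def[symmetric] using lam_nonneg[of k]
    by (simp add: ennreal_mult[symmetric] enn2ereal_ennreal)
qed

end

theorem theorem3:
  fixes \<mu> :: "'x measure" and MT :: "'t measure"
    and \<xi> :: "'t \<Rightarrow> 'x \<Rightarrow> 't" and \<theta>\<^sub>0 :: 't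
    and p :: "'k::finite option \<Rightarrow> 't \<Rightarrow> 'x \<Rightarrow> real"
    and P :: "'k option \<Rightarrow> 't \<Rightarrow> (nat \<Rightarrow> 'x) measure"
    and lam :: "'k \<Rightarrow> real"
    and \<rho> :: "real ^ 'k option \<Rightarrow> 't \<Rightarrow> real"
  assumes "sigma_finite_measure \<mu>"
    and "(\<lambda>(\<theta>, x). \<xi> \<theta> x) \<in> MT \<Otimes>\<^sub>M \<mu> \<rightarrow>\<^sub>M MT"
    and "\<theta>\<^sub>0 \<in> space MT"
    and "\<And>i. density_family \<mu> MT (p i)"
    and "\<And>i \<theta>. \<theta> \<in> space MT \<Longrightarrow> P i \<theta> \<in> process_laws \<mu> \<xi> (p i) \<theta>"
    and "\<And>k. 0 \<le> lam k"
    and "is_cost_function \<mu> MT \<xi> p lam \<rho>"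
  defines "Opt \<equiv> optimal_policies \<mu> MT \<xi> p lam \<rho> \<theta>\<^sub>0 (\<lambda>i. P i \<theta>\<^sub>0)"
    and "\<gamma> \<equiv> \<lambda>\<pi> z \<theta>. enn2ereal (perf_time \<xi> p \<pi> (P None) z \<theta>)"
    and "\<alpha> \<equiv> \<lambda>k \<pi> z \<theta>. perf_error \<xi> p \<pi> (P (Some k)) k z \<theta>"
  shows "(\<forall>\<pi>\<in>Opt. \<gamma> \<pi> \<in> rho_superdiff_funs MT \<rho> None \<and>
            (\<forall>k. (\<lambda>z \<theta>. ereal (lam k * \<alpha> k \<pi> z \<theta>)) \<in> rho_superdiff_funs MT \<rho> (Some k))) \<and>
         (\<forall>z\<in>nonneg_vecs. \<forall>\<theta>\<in>space MT.
            {\<gamma> \<pi> z \<theta> |\<pi>. \<pi> \<in> Opt} = rho_superdiff \<rho> None z \<theta> \<and>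
            (\<forall>k. 0 < z $ Some k \<longrightarrow>
               {ereal (lam k * \<alpha> k \<pi> z \<theta>) |\<pi>. \<pi> \<in> Opt} = rho_superdiff \<rho> (Some k) z \<theta>))"
proof -
  interpret sequential_test \<mu> MT \<xi> p P lam \<rho>
    by (intro sequential_test.intro sequential_test_axioms.intro assms(1-2,4-7))
  have Opt: "Opt = Collect greedy"
    unfolding Opt_def by (rule optimal_policies_eq_greedy[OF assms(3)])
  have \<gamma>_in: "\<gamma> \<pi> z \<theta> \<in> rho_superdiff \<rho> None z \<theta>"
    and \<alpha>_in: "ereal (lam k * \<alpha> k \<pi> z \<theta>) \<in> rho_superdiff \<rho> (Some k) z \<theta>"
    if "greedy \<pi>" "z \<in> nonneg_vecs" "\<theta> \<in> space MT" for \<pi> z \<theta> k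
    unfolding \<gamma>_def \<alpha>_def perf_time_eq_cost_component[OF that] perf_error_eq_cost_component[OF that]
    by (rule greedy_cost_component_in_superdiff[OF that])+
  have \<gamma>_onto: "\<exists>\<pi>. greedy \<pi> \<and> \<gamma> \<pi> z \<theta> = c"
    if "z \<in> nonneg_vecs" "\<theta> \<in> space MT" "c \<in> rho_superdiff \<rho> None z \<theta>" for z \<theta> c
  proof -
    have "\<exists>\<pi>. greedy \<pi> \<and> enn2ereal (cost_component (run \<pi> z \<theta>) \<theta> None) = c"
    proof (cases "z $ None = 0")
      case True
      then show ?thesis by (rule superdiff_time_attained_at_zero[OF that(1,2) _ that(3)])
    next
      case False
      then have "0 < z $ None" using nonneg_vecsD[OF that(1), of None] by simp
      then show ?thesis by (rule superdiff_attained[OF that])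
    qed
    then obtain \<pi> where "greedy \<pi>" "enn2ereal (cost_component (run \<pi> z \<theta>) \<theta> None) = c" by blast
    then show ?thesis
      using perf_time_eq_cost_component[of \<pi>] that(1,2) unfolding \<gamma>_def by (intro exI[of _ \<pi>]) simp
  qed
  have \<alpha>_onto: "\<exists>\<pi>. greedy \<pi> \<and> ereal (lam k * \<alpha> k \<pi> z \<theta>) = c"
    if "z \<in> nonneg_vecs" "\<theta> \<in> space MT" "c \<in> rho_superdiff \<rho> (Some k) z \<theta>" "0 < z $ Some k" for z \<theta> c k
    using superdiff_attained[OF that] perf_error_eq_cost_component[OF _ that(1,2)] unfolding \<alpha>_def by (metis (no_types, lifting))
  show ?thesis
  proof (intro conjI ballI allI impI)
    show "\<gamma> \<pi> \<in> rho_superdiff_funs MT \<rho> None"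
      "(\<lambda>z \<theta>. ereal (lam k * \<alpha> k \<pi> z \<theta>)) \<in> rho_superdiff_funs MT \<rho> (Some k)" if "\<pi> \<in> Opt" for \<pi> k
      using that \<gamma>_in \<alpha>_in unfolding Opt rho_superdiff_funs_def by auto
    fix z :: "real ^ 'k option" and \<theta> assume z: "z \<in> nonneg_vecs" and \<theta>: "\<theta> \<in> space MT"
    show "{\<gamma> \<pi> z \<theta> |\<pi>. \<pi> \<in> Opt} = rho_superdiff \<rho> None z \<theta>"
    proof (intro equalityI subsetI)
      fix c assume "c \<in> {\<gamma> \<pi> z \<theta> |\<pi>. \<pi> \<in> Opt}"
      then show "c \<in> rho_superdiff \<rho> None z \<theta>" using \<gamma>_in z \<theta> unfolding Opt by blast
    next
      fix c assume "c \<in> rho_superdiff \<rho> None z \<theta>"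
      then show "c \<in> {\<gamma> \<pi> z \<theta> |\<pi>. \<pi> \<in> Opt}" using \<gamma>_onto[OF z \<theta>] unfolding Opt by blast
    qed
    fix k assume k: "0 < z $ Some k"
    show "{ereal (lam k * \<alpha> k \<pi> z \<theta>) |\<pi>. \<pi> \<in> Opt} = rho_superdiff \<rho> (Some k) z \<theta>"
    proof (intro equalityI subsetI)
      fix c assume "c \<in> {ereal (lam k * \<alpha> k \<pi> z \<theta>) |\<pi>. \<pi> \<in> Opt}"
      then show "c \<in> rho_superdiff \<rho> (Some k) z \<theta>" using \<alpha>_in z \<theta> unfolding Opt by blast
    next
      fix c assume "c \<in> rho_superdiff \<rho> (Some k) z \<theta>"
      then show "c \<in> {ereal (lam k * \<alpha> k \<pi> z \<theta>) |\<pi>. \<pi> \<in> Opt}" using \<alpha>_onto[OF z \<theta> _ k] unfolding Opt by blast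
    qed
  qed
qed

end
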